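(* Let $\mathcal{M}^{+}$ and $B$ be the $\mathfrak{b}_+$-valued operators, with dependent variables $\lambda_i,\mu_i$ $(i=2,4,6)$ and independent variable $s$, obtained (as described in the context) from the similarity reduction of the Drinfeld–Sokolov hierarchy of type $E_6^{(1)}$ associated with the Heisenberg subalgebra of type $(1,1,0,1,0,1,0)$, and consider the system of ordinary differential equations $$\left[s(s-1)\frac{d}{ds}-B,\ \mathcal{M}^{+}\right]=0 .$$ Define $$q_1=\frac{1-\lambda_2}{1+c_1},\quad q_2=\frac{1-\lambda_4}{1+c_5},\quad q_3=\frac{1+c_3-c_0c_{63}}{1+c_3+c_{63}\lambda_6},\quad p_1=-\frac{(1+c_1)\mu_2}{6},\quad p_2=-\frac{(1+c_5)\mu_4}{6},$$ $$p_3=-\frac{(1+c_3+c_{63}\lambda_6)\{(1+c_3+c_{63}\lambda_6)\mu_6+c_{63}(\kappa|\alpha_6^\vee)\}}{6c_{63}(1+c_3-c_0c_{63})},\qquad \alpha_i=\frac{(\kappa|\alpha_i^\vee)}{6}\quad(i=0,\ldots,6).$$ Then, under this change of variables, the system $\left[s(s-1)\frac{d}{ds}-B,\ \mathcal{M}^{+}\right]=0$ is equivalent to the Hamiltonian system $$s(s-1)\frac{dq_i}{ds}=\{H,q_i\},\qquad s(s-1)\frac{dp_i}{ds}=\{H,p_i\}\qquad(i=1,2,3),$$ where $\{p_i,q_j\}=\delta_{i,j}$, $\{p_i,p_j\}=\{q_i,q_j\}=0$ and $$\begin{aligned}H&=H_{\rm VI}(p_1,q_1,s;\alpha_3,1-\alpha_1-2\alpha_2-2\alpha_3,\alpha_1,\alpha_3)+H_{\rm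 VI}(p_2,q_2,s;\alpha_3,1-2\alpha_3-2\alpha_4-\alpha_5,\alpha_5,\alpha_3)\\&\quad+H_{\rm VI}(p_3,q_3,s;\alpha_3,1-\alpha_0-2\alpha_3-2\alpha_6,\alpha_0,\alpha_3)\\&\quad+\sum_{1\le i<j\le3}\{(q_i-1)p_i+\alpha_{2i}\}\{(q_j-1)p_j+\alpha_{2j}\}(q_iq_j+s).\end{aligned}$$
   Context: **Painlevé VI Hamiltonian.** $H_{\rm VI}(p,q,s;\beta_0,\beta_1,\beta_3,\beta_4)=q(q-1)(q-s)p^2-\{(\beta_1-1)q(q-1)+\beta_3q(q-s)+\beta_4(q-1)(q-s)\}p+\beta_2(\beta_0+\beta_2)q$, where $\beta_2$ is determined by $\beta_0+\beta_1+2\beta_2+\beta_3+\beta_4=1$. **Affine Lie algebra.** $\mathfrak{g}=\mathfrak{g}(E_6^{(1)})$ is the affine Lie algebra with Chevalley generators $e_i,f_i,\alpha_i^\vee$ $(i=0,\ldots,6)$ and scaling element $d$, $[d,e_i]=\delta_{i,0}e_0$, $[d,f_i]=-\delta_{i,0}f_0$, for the symmetric generalized Cartan matrix $(a_{ij})$ with $a_{ii}=2$, $a_{ij}=-1$ for $\{i,j\}\in\{\{0,6\},\{1,2\},\{2,3\},\{3,4\},\{4,5\},\{3,6\}\}$ and $a_{ij}=0$ otherwise. $\mathfrak{h}=\bigoplus_j\mathbb{C}\alpha_j^\vee\oplus\mathbb{C}d$; $\mathfrak{n}_+$ is the subalgebra generated by $e_0,\ldots,e_6$; $\mathfrak{b}_+=\mathfrak{h}\oplus\mathfrak{n}_+$.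 The normalized invariant form satisfies $(\alpha_i^\vee|\alpha_j^\vee)=a_{ij}$, $(e_i|f_j)=\delta_{i,j}$, $(d|d)=0$, $(d|\alpha_j^\vee)=\delta_{0,j}$, and $(\alpha_i^\vee|e_j)=(\alpha_i^\vee|f_j)=(d|e_j)=(d|f_j)=0$. Let $\vartheta\in\mathfrak{h}$ be such that $(\vartheta|\alpha_i^\vee)=0$ for $i=2,4,6$ and $=1$ for $i=0,1,3,5$; put $\mathfrak{g}_k=\{x:[\vartheta,x]=kx\}$. Notation: $e_{i_1\ldots i_nj}=\mathrm{ad}\,e_{i_1}\cdots\mathrm{ad}\,e_{i_n}(e_j)$. The following commuting elements of $\mathfrak{g}_1$ are used: $$\Lambda_1=e_1+2e_3+e_5+e_{21}+e_{60}+e_{23}+e_{43}+e_{63}+e_{234}+e_{236}+e_{436}+2e_{6234},$$ $$\Lambda_2=2e_0-2e_3-2e_5-2e_{21}-2e_{45}+2e_{23}+2e_{43}-7e_{63}-4e_{234}+5e_{236}-4e_{436}-2e_{6234}.$$ **Similarity reduction.** For functions of $\boldsymbol{t}=(t_1,t_2)$ let $B_k=U_k+\Lambda_k$ with $U_k=\sum_{i=0}^6u_{k,i}\alpha_i^\vee+\sum_{i=2,4,6}(x_{k,i}e_i+y_{k,i}f_i)$ $(k=1,2)$, and set $\mathcal{M}=\vartheta-t_1B_1-t_2B_2$, $\mathcal{B}=B_1dt_1+B_2dt_2$. The similarity reduction is the system $d_{\boldsymbol t}\mathcal{M}=[\mathcal{B},\mathcal{M}]$, $d_{\boldsymbol t}\mathcal{B}=\mathcal{B}\wedge\mathcal{B}$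 (i.e. $[\partial_1-B_1,\partial_2-B_2]=0$ and $[\partial_k-B_k,\mathcal{M}]=0$). Let $\mathcal{M}_1=-t_1\Lambda_1-t_2\Lambda_2$. **First gauge transformation.** Let $\Gamma_1=\Gamma_1(t_1,t_2)$ take values in $\mathfrak{g}_0\cap\mathfrak{b}_+$ (with no $d$-component, i.e. in the span of the $\alpha_i^\vee$ and $e_2,e_4,e_6$) and be such that $$\exp(\mathrm{ad}\,\Gamma_1)(\mathcal{M}_1)=\sum_{i=0,1,3,5}c_ie_i+e_{21}+e_{45}+e_{60}+e_{23}+e_{43}+c_{63}e_{63}+e_{234},$$ where $c_0,c_1,c_3,c_5,c_{63}$ are algebraic functions of $t_1,t_2$. Put $\mathcal{M}^*=\exp(\mathrm{ad}\,\Gamma_1)\mathcal{M}$, $d_{\boldsymbol t}-\mathcal{B}^*=\exp(\mathrm{ad}\,\Gamma_1)(d_{\boldsymbol t}-\mathcal{B})$. Write the $\mathfrak{g}_0$-part of $\mathcal{M}^*$ as $\theta^*+\sum_{i=2,4,6}(\xi_i^*e_i+\psi_i^*f_i)$ with $\theta^*\in\vartheta+\sum_i\mathbb{C}\alpha_i^\vee$. **Second gauge transformation.** Let $\Gamma_2=\sum_{i=2,4,6}\lambda_if_i$ with $\xi_i^*\lambda_i^2-(\theta^*|\alpha_i^\vee)\lambda_i-\psi_i^*=0$ $(i=2,4,6)$, and put $\mathcal{M}^+=\exp(\mathrm{ad}\,\Gamma_2)\mathcal{M}^*$, $d_{\boldsymbol t}-\mathcal{B}^+=\exp(\mathrm{ad}\,\Gamma_2)(d_{\boldsymbol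 t}-\mathcal{B}^* )$. Then $\mathcal{M}^+$ and $\mathcal{B}^+$ take values in $\mathfrak{b}_+$ and satisfy $d_{\boldsymbol t}\mathcal{M}^+=[\mathcal{B}^+,\mathcal{M}^+]$, $d_{\boldsymbol t}\mathcal{B}^+=\mathcal{B}^+\wedge\mathcal{B}^+$. With $\mu_i=\xi_i^*$, $$\begin{aligned}\mathcal{M}^+&=\kappa+\sum_{i=2,4,6}\mu_ie_i+(c_0+\lambda_6)e_0+(c_1+\lambda_2)e_1+(c_3+\lambda_2+\lambda_4+c_{63}\lambda_6-\lambda_2\lambda_4)e_3+(c_5+\lambda_4)e_5\\&\quad+e_{21}+e_{45}+e_{60}+(1-\lambda_4)e_{23}+(1-\lambda_2)e_{43}+c_{63}e_{63}+e_{234},\end{aligned}$$ with $\kappa\in\mathfrak{h}$, $d_{\boldsymbol t}\kappa=0$. The dependent variables are $\lambda_i,\mu_i$ $(i=2,4,6)$. **Reduction to an ODE.** Let $s_1=\dfrac{c_{63}(1+c_3-c_0c_{63})}{6}$, $s_2=\dfrac{c_{63}(1+c_1)(1+c_5)}{6}$, used as new independent variables in place of $t_1,t_2$. Set $s_2=1$ and $s=s_1$. The operator $B$ is defined by $\mathcal{B}^+|_{s_2=1}=\dfrac{1}{s(s-1)}B\,ds$, so that the restriction of $d_{\boldsymbol t}\mathcal{M}^+=[\mathcal{B}^+,\mathcal{M}^+]$ to $s_2=1$ reads $[s(s-1)\frac{d}{ds}-B,\mathcal{M}^+]=0$. It has the form $$B=\sum_{i=0}^6u_i\alpha_i^\vee+\sum_{i=0}^6x_ie_i+x_{21}e_{21}+x_{45}e_{45}+x_{23}e_{23}+x_{43}e_{43}+x_{63}e_{63}+x_{234}e_{234}+x_{236}e_{236}+x_{436}e_{436}+x_{6234}e_{6234},$$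 each coefficient being determined as a polynomial in the $\lambda_i,\mu_i$ (with coefficients depending on $s$ through the $c$'s); the $\mathfrak{g}_1$-part of $B\,ds/(s(s-1))$ is $\exp(\mathrm{ad}\,\Gamma_2)\exp(\mathrm{ad}\,\Gamma_1)(\Lambda_1dt_1+\Lambda_2dt_2)$ restricted to $s_2=1$. *)

theory Defs
  imports "HOL-Analysis.Analysis"
begin

section \<open>The affine Lie algebra of type $E_6^{(1)}$\<close>

record 'g km_data =
  vscale :: "complex \<Rightarrow> 'g \<Rightarrow> 'g" (infixr "\<cdot>\<index>" 75)
  ad :: "'g \<Rightarrow> 'g \<Rightarrow> 'g"
  e_gen :: "nat \<Rightarrow> 'g"
  f_gen :: "nat \<Rightarrow> 'g"
  coroot :: "nat \<Rightarrow> 'g"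
  scaling :: 'g
  form :: "'g \<Rightarrow> 'g \<Rightarrow> complex"

text \<open>\<open>ad G x y\<close> is the Lie bracket \<open>[x, y]\<close>; it is written as an operator because it is
  mostly iterated.\<close>

definition cartan_E6 :: "nat \<Rightarrow> nat \<Rightarrow> int" where
  "cartan_E6 i j =
     (if i = j then 2
      else if {i, j} \<in> {{0,6}, {1,2}, {2,3}, {3,4}, {4,5}, {3,6}} then -1 else 0)"

inductive_set lie_generated :: "'g::ab_group_add km_data \<Rightarrow> 'g set \<Rightarrow> 'g set"
  for G :: "'g::ab_group_add km_data" and X :: "'g set" where
  "x \<in> X \<Longrightarrow> x \<in> lie_generated G X"
| "0 \<in> lie_generated G X"
| "x \<in> lie_generated G X \<Longrightarrow> y \<in> lie_generated G X \<Longrightarrow> x + y \<in> lie_generated G X"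
| "x \<in> lie_generated G X \<Longrightarrow> vscale G a x \<in> lie_generated G X"
| "x \<in> lie_generated G X \<Longrightarrow> y \<in> lie_generated G X \<Longrightarrow> ad G x y \<in> lie_generated G X"

text \<open>The Chevalley-Serre relations present the Kac-Moody algebra (Gabber-Kac), and an ideal of it
  that meets the Cartan subalgebra trivially is zero. So the relations, generation, and linear
  independence of the \<open>coroot i\<close> and \<open>scaling\<close> determine the algebra up to isomorphism, and the
  form is then determined as well.\<close>

locale affine_E6 =
  fixes G :: "'g::ab_group_add km_data" (structure)
  assumes vector_space: "vector_space (vscale G)"
    and ad_linear_right: "Vector_Spaces.linear (vscale G) (vscale G) (\<lambda>y. ad G x y)"
    and ad_linear_left: "Vector_Spaces.linear (vscale G) (vscale G) (\<lambda>x. ad G x y)"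
    and ad_self: "ad G x x = 0"
    and jacobi: "ad G x (ad G y z) + ad G y (ad G z x) + ad G z (ad G x y) = 0"
    and coroot_coroot: "\<lbrakk>i \<le> 6; j \<le> 6\<rbrakk> \<Longrightarrow> ad G (coroot G i) (coroot G j) = 0"
    and scaling_coroot: "i \<le> 6 \<Longrightarrow> ad G (scaling G) (coroot G i) = 0"
    and e_f: "\<lbrakk>i \<le> 6; j \<le> 6\<rbrakk> \<Longrightarrow>
                ad G (e_gen G i) (f_gen G j) = (if i = j then coroot G i else 0)"
    and coroot_e: "\<lbrakk>i \<le> 6; j \<le> 6\<rbrakk> \<Longrightarrow>
                ad G (coroot G i) (e_gen G j) = of_int (cartan_E6 i j) \<cdot> e_gen G j"
    and coroot_f: "\<lbrakk>i \<le> 6; j \<le> 6\<rbrakk> \<Longrightarrow>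
                ad G (coroot G i) (f_gen G j) = of_int (- cartan_E6 i j) \<cdot> f_gen G j"
    and scaling_e: "i \<le> 6 \<Longrightarrow>
                ad G (scaling G) (e_gen G i) = (if i = 0 then e_gen G 0 else 0)"
    and scaling_f: "i \<le> 6 \<Longrightarrow>
                ad G (scaling G) (f_gen G i) = (if i = 0 then - f_gen G 0 else 0)"
    and serre_e: "\<lbrakk>i \<le> 6; j \<le> 6; i \<noteq> j\<rbrakk> \<Longrightarrow>
                (ad G (e_gen G i) ^^ nat (1 - cartan_E6 i j)) (e_gen G j) = 0"
    and serre_f: "\<lbrakk>i \<le> 6; j \<le> 6; i \<noteq> j\<rbrakk> \<Longrightarrow>
                (ad G (f_gen G i) ^^ nat (1 - cartan_E6 i j)) (f_gen G j) = 0"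
    and generated: "lie_generated G (e_gen G ` {..6} \<union> f_gen G ` {..6} \<union> coroot G ` {..6} \<union> {scaling G})
                    = UNIV"
    and cartan_independent: "(\<Sum>i\<le>6. a i \<cdot> coroot G i) + b \<cdot> scaling G = 0 \<Longrightarrow>
                (\<forall>i\<le>6. a i = 0) \<and> b = 0"
    and form_linear: "Vector_Spaces.linear (vscale G) (*) (\<lambda>y. form G x y)"
    and form_sym: "form G x y = form G y x"
    and form_invariant: "form G (ad G x y) z = form G x (ad G y z)"
    and form_coroot_coroot: "\<lbrakk>i \<le> 6; j \<le> 6\<rbrakk> \<Longrightarrow>
                form G (coroot G i) (coroot G j) = of_int (cartan_E6 i j)"
    and form_e_f: "\<lbrakk>i \<le> 6; j \<le> 6\<rbrakk> \<Longrightarrow>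
                form G (e_gen G i) (f_gen G j) = (if i = j then 1 else 0)"
    and form_scaling_scaling: "form G (scaling G) (scaling G) = 0"
    and form_scaling_coroot: "j \<le> 6 \<Longrightarrow>
                form G (scaling G) (coroot G j) = (if j = 0 then 1 else 0)"
    and form_cartan_ef: "\<lbrakk>i \<le> 6; j \<le> 6\<rbrakk> \<Longrightarrow>
                form G (coroot G i) (e_gen G j) = 0 \<and> form G (coroot G i) (f_gen G j) = 0 \<and>
                form G (scaling G) (e_gen G j) = 0 \<and> form G (scaling G) (f_gen G j) = 0"

abbreviation lspan :: "'g::ab_group_add km_data \<Rightarrow> 'g set \<Rightarrow> 'g set" where
  "lspan G \<equiv> module.span (vscale G)"

definition cartan_subalgebra :: "'g::ab_group_add km_data \<Rightarrow> 'g set" where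
  "cartan_subalgebra G = lspan G (coroot G ` {..6} \<union> {scaling G})"

definition borel_plus :: "'g::ab_group_add km_data \<Rightarrow> 'g set" where
  "borel_plus G = {x + y | x y. x \<in> cartan_subalgebra G \<and> y \<in> lie_generated G (e_gen G ` {..6})}"

text \<open>\<open>e_word G [i\<^sub>1, \<dots>, i\<^sub>n, j]\<close> is \<open>ad e\<^sub>i\<^sub>1 \<dots> ad e\<^sub>i\<^sub>n (e\<^sub>j)\<close>.\<close>

fun e_word :: "'g::ab_group_add km_data \<Rightarrow> nat list \<Rightarrow> 'g" where
  "e_word G [] = 0"
| "e_word G [j] = e_gen G j"
| "e_word G (i # j # w) = ad G (e_gen G i) (e_word G (j # w))"


section \<open>Series and derivatives in the Lie algebra\<close>

text \<open>The algebra is infinite-dimensional and carries no topology. All series and all functions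
  below stay in finite-dimensional subspaces, where convergence and differentiability may be
  tested against the linear functionals; these separate points, so the values are unique.\<close>

definition functional :: "'g::ab_group_add km_data \<Rightarrow> ('g \<Rightarrow> complex) \<Rightarrow> bool" where
  "functional G \<phi> \<longleftrightarrow> Vector_Spaces.linear (vscale G) (*) \<phi>"

definition lie_suminf :: "'g::ab_group_add km_data \<Rightarrow> (nat \<Rightarrow> 'g) \<Rightarrow> 'g" where
  "lie_suminf G a = (THE y. \<forall>\<phi>. functional G \<phi> \<longrightarrow> (\<lambda>n. \<phi> (a n)) sums \<phi> y)"

definition lie_deriv :: "'g::ab_group_add km_data \<Rightarrow> (complex \<Rightarrow> 'g) \<Rightarrow> complex \<Rightarrow> 'g" where
  "lie_deriv G F s = (THE v. \<forall>\<phi>. functional G \<phi> \<longrightarrow> \<phi> v = deriv (\<lambda>z. \<phi> (F z)) s)"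

text \<open>Functions of \<open>(t\<^sub>1, t\<^sub>2)\<close>; the index \<open>k\<close> of \<open>\<partial>\<^sub>k\<close> is 1 or 2.\<close>

definition holomorphic2_on :: "(complex \<times> complex \<Rightarrow> complex) \<Rightarrow> (complex \<times> complex) set \<Rightarrow> bool"
  where "holomorphic2_on F W \<longleftrightarrow>
    (\<forall>\<tau>\<in>W. \<exists>a b. (F has_derivative (\<lambda>v. a * fst v + b * snd v)) (at \<tau>))"

definition partial :: "nat \<Rightarrow> (complex \<times> complex \<Rightarrow> complex) \<Rightarrow> complex \<times> complex \<Rightarrow> complex" where
  "partial k F \<tau> = (if k = 1 then deriv (\<lambda>z. F (z, snd \<tau>)) (fst \<tau>)
                    else deriv (\<lambda>z. F (fst \<tau>, z)) (snd \<tau>))"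

definition lie_holomorphic2_on ::
  "'g::ab_group_add km_data \<Rightarrow> (complex \<times> complex \<Rightarrow> 'g) \<Rightarrow> (complex \<times> complex) set \<Rightarrow> bool" where
  "lie_holomorphic2_on G F W \<longleftrightarrow>
    (\<forall>\<phi>. functional G \<phi> \<longrightarrow> holomorphic2_on (\<lambda>\<tau>. \<phi> (F \<tau>)) W)"

definition lie_partial ::
  "'g::ab_group_add km_data \<Rightarrow> nat \<Rightarrow> (complex \<times> complex \<Rightarrow> 'g) \<Rightarrow> complex \<times> complex \<Rightarrow> 'g" where
  "lie_partial G k F \<tau> =
    (THE v. \<forall>\<phi>. functional G \<phi> \<longrightarrow> \<phi> v = partial k (\<lambda>\<sigma>. \<phi> (F \<sigma>)) \<tau>)"

definition exp_ad :: "'g::ab_group_add km_data \<Rightarrow> 'g \<Rightarrow> 'g \<Rightarrow> 'g" where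
  "exp_ad G x y = lie_suminf G (\<lambda>n. vscale G (1 / fact n) ((ad G x ^^ n) y))"

text \<open>Since \<open>[\<Gamma>, \<partial>\<^sub>k] = - \<partial>\<^sub>k\<Gamma>\<close>, the series \<open>exp(ad \<Gamma>)(\<partial>\<^sub>k - B)\<close> equals \<open>\<partial>\<^sub>k - B\<^sup>*\<close> with
  \<open>B\<^sup>* = exp(ad \<Gamma>)(B) + (\<Sum>n. (ad \<Gamma>)\<^sup>n (\<partial>\<^sub>k\<Gamma>) / (n+1)!)\<close>.\<close>

definition gauge :: "'g::ab_group_add km_data \<Rightarrow> (complex \<times> complex \<Rightarrow> 'g) \<Rightarrow> nat \<Rightarrow>
    (complex \<times> complex \<Rightarrow> 'g) \<Rightarrow> complex \<times> complex \<Rightarrow> 'g" where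
  "gauge G \<Gamma> k B \<tau> = exp_ad G (\<Gamma> \<tau>) (B \<tau>) +
     lie_suminf G (\<lambda>n. vscale G (1 / fact (Suc n)) ((ad G (\<Gamma> \<tau>) ^^ n) (lie_partial G k \<Gamma> \<tau>)))"


section \<open>The similarity reduction and its gauge transformations\<close>

context
  fixes G :: "'g::ab_group_add km_data" (structure)
begin

definition is_theta :: "'g \<Rightarrow> bool" where
  "is_theta \<theta> \<longleftrightarrow> \<theta> \<in> cartan_subalgebra G \<and>
     (\<forall>i\<in>{2,4,6}. form G \<theta> (coroot G i) = 0) \<and> (\<forall>i\<in>{0,1,3,5}. form G \<theta> (coroot G i) = 1)"

definition Lambda :: "nat \<Rightarrow> 'g" where
  "Lambda k =
    (if k = 1 then
       e_word G [1] + 2 \<cdot> e_word G [3] + e_word G [5] + e_word G [2,1] + e_word G [6,0]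
       + e_word G [2,3] + e_word G [4,3] + e_word G [6,3] + e_word G [2,3,4] + e_word G [2,3,6]
       + e_word G [4,3,6] + 2 \<cdot> e_word G [6,2,3,4]
     else
       2 \<cdot> e_word G [0] - 2 \<cdot> e_word G [3] - 2 \<cdot> e_word G [5] - 2 \<cdot> e_word G [2,1]
       - 2 \<cdot> e_word G [4,5] + 2 \<cdot> e_word G [2,3] + 2 \<cdot> e_word G [4,3] - 7 \<cdot> e_word G [6,3]
       - 4 \<cdot> e_word G [2,3,4] + 5 \<cdot> e_word G [2,3,6] - 4 \<cdot> e_word G [4,3,6]
       - 2 \<cdot> e_word G [6,2,3,4])"

definition B_op :: "(nat \<Rightarrow> complex \<times> complex \<Rightarrow> 'g) \<Rightarrow> nat \<Rightarrow> complex \<times> complex \<Rightarrow> 'g" where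
  "B_op U k \<tau> = U k \<tau> + Lambda k"

definition M_op :: "'g \<Rightarrow> (nat \<Rightarrow> complex \<times> complex \<Rightarrow> 'g) \<Rightarrow> complex \<times> complex \<Rightarrow> 'g" where
  "M_op \<theta> U \<tau> = \<theta> - fst \<tau> \<cdot> B_op U 1 \<tau> - snd \<tau> \<cdot> B_op U 2 \<tau>"

definition M1_op :: "complex \<times> complex \<Rightarrow> 'g" where
  "M1_op \<tau> = - (fst \<tau> \<cdot> Lambda 1) - snd \<tau> \<cdot> Lambda 2"

definition similarity_reduction ::
  "'g \<Rightarrow> (complex \<times> complex) set \<Rightarrow> (nat \<Rightarrow> complex \<times> complex \<Rightarrow> 'g) \<Rightarrow> bool" where
  "similarity_reduction \<theta> W U \<longleftrightarrow>
     (\<forall>k\<in>{1,2}. lie_holomorphic2_on G (U k) W \<and>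
        (\<forall>\<tau>\<in>W. U k \<tau> \<in> lspan G (coroot G ` {..6} \<union> e_gen G ` {2,4,6} \<union> f_gen G ` {2,4,6}))) \<and>
     (\<forall>\<tau>\<in>W.
        (\<forall>k\<in>{1,2}. lie_partial G k (M_op \<theta> U) \<tau> = ad G (B_op U k \<tau>) (M_op \<theta> U \<tau>)) \<and>
        lie_partial G 1 (B_op U 2) \<tau> - lie_partial G 2 (B_op U 1) \<tau>
          = ad G (B_op U 1 \<tau>) (B_op U 2 \<tau>))"

text \<open>The coefficient \<open>c\<^sub>6\<^sub>3\<close> of \<open>e\<^sub>6\<^sub>3\<close> is stored at index 63 of the family \<open>c\<close>.\<close>

definition M1_star :: "(nat \<Rightarrow> complex) \<Rightarrow> 'g" where
  "M1_star c = (\<Sum>i\<in>{0,1,3,5}. c i \<cdot> e_gen G i) + e_word G [2,1] + e_word G [4,5] + e_word G [6,0]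
     + e_word G [2,3] + e_word G [4,3] + c 63 \<cdot> e_word G [6,3] + e_word G [2,3,4]"

definition first_gauge :: "(complex \<times> complex) set \<Rightarrow> (complex \<times> complex \<Rightarrow> 'g) \<Rightarrow>
    (nat \<Rightarrow> complex \<times> complex \<Rightarrow> complex) \<Rightarrow> bool" where
  "first_gauge D \<Gamma> c \<longleftrightarrow>
     lie_holomorphic2_on G \<Gamma> D \<and>
     (\<forall>j\<in>{0,1,3,5,63}. holomorphic2_on (c j) D) \<and>
     (\<forall>\<tau>\<in>D. \<Gamma> \<tau> \<in> lspan G (coroot G ` {..6} \<union> e_gen G ` {2,4,6}) \<and>
        exp_ad G (\<Gamma> \<tau>) (M1_op \<tau>) = M1_star (\<lambda>j. c j \<tau>))"

definition Gamma2 :: "(nat \<Rightarrow> complex \<times> complex \<Rightarrow> complex) \<Rightarrow> complex \<times> complex \<Rightarrow> 'g" where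
  "Gamma2 l \<tau> = (\<Sum>i\<in>{2,4,6}. l i \<tau> \<cdot> f_gen G i)"

definition M_plus :: "'g \<Rightarrow> (nat \<Rightarrow> complex) \<Rightarrow> (nat \<Rightarrow> complex) \<Rightarrow> (nat \<Rightarrow> complex) \<Rightarrow> 'g" where
  "M_plus \<kappa> c l m =
     \<kappa> + (\<Sum>i\<in>{2,4,6}. m i \<cdot> e_gen G i)
     + (c 0 + l 6) \<cdot> e_gen G 0 + (c 1 + l 2) \<cdot> e_gen G 1
     + (c 3 + l 2 + l 4 + c 63 * l 6 - l 2 * l 4) \<cdot> e_gen G 3 + (c 5 + l 4) \<cdot> e_gen G 5
     + e_word G [2,1] + e_word G [4,5] + e_word G [6,0] + (1 - l 4) \<cdot> e_word G [2,3]
     + (1 - l 2) \<cdot> e_word G [4,3] + c 63 \<cdot> e_word G [6,3] + e_word G [2,3,4]"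

definition M_star :: "'g \<Rightarrow> (complex \<times> complex \<Rightarrow> 'g) \<Rightarrow> (nat \<Rightarrow> complex \<times> complex \<Rightarrow> 'g) \<Rightarrow>
    complex \<times> complex \<Rightarrow> 'g" where
  "M_star \<theta> \<Gamma>1 U \<tau> = exp_ad G (\<Gamma>1 \<tau>) (M_op \<theta> U \<tau>)"

definition B_plus :: "(complex \<times> complex \<Rightarrow> 'g) \<Rightarrow> (nat \<Rightarrow> complex \<times> complex \<Rightarrow> complex) \<Rightarrow>
    (nat \<Rightarrow> complex \<times> complex \<Rightarrow> 'g) \<Rightarrow> nat \<Rightarrow> complex \<times> complex \<Rightarrow> 'g" where
  "B_plus \<Gamma>1 l U k = gauge G (Gamma2 l) k (gauge G \<Gamma>1 k (B_op U k))"

text \<open>\<open>l i\<close> and \<open>\<xi> i\<close> are the dependent variables \<open>\<lambda>\<^sub>i\<close> and \<open>\<mu>\<^sub>i\<close> as functions of \<open>(t\<^sub>1, t\<^sub>2)\<close>.\<close>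

definition second_gauge :: "'g \<Rightarrow> (complex \<times> complex \<Rightarrow> 'g) \<Rightarrow>
    (nat \<Rightarrow> complex \<times> complex \<Rightarrow> complex) \<Rightarrow> 'g \<Rightarrow> (complex \<times> complex) set \<Rightarrow>
    (nat \<Rightarrow> complex \<times> complex \<Rightarrow> 'g) \<Rightarrow> (nat \<Rightarrow> complex \<times> complex \<Rightarrow> complex) \<Rightarrow>
    (nat \<Rightarrow> complex \<times> complex \<Rightarrow> complex) \<Rightarrow> bool" where
  "second_gauge \<theta> \<Gamma>1 c \<kappa> W U l \<xi> \<longleftrightarrow>
     (\<forall>i\<in>{2,4,6}. holomorphic2_on (l i) W) \<and>
     (\<exists>\<theta>s \<psi>. \<forall>\<tau>\<in>W.
        \<theta>s \<tau> - \<theta> \<in> lspan G (coroot G ` {..6}) \<and>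
        M_star \<theta> \<Gamma>1 U \<tau> =
          \<theta>s \<tau> + (\<Sum>i\<in>{2,4,6}. \<xi> i \<tau> \<cdot> e_gen G i + \<psi> i \<tau> \<cdot> f_gen G i) + M1_star (\<lambda>j. c j \<tau>) \<and>
        (\<forall>i\<in>{2,4,6}. \<xi> i \<tau> * (l i \<tau>)\<^sup>2 - form G (\<theta>s \<tau>) (coroot G i) * l i \<tau> - \<psi> i \<tau> = 0)) \<and>
     (\<forall>\<tau>\<in>W.
        exp_ad G (Gamma2 l \<tau>) (M_star \<theta> \<Gamma>1 U \<tau>)
          = M_plus \<kappa> (\<lambda>j. c j \<tau>) (\<lambda>i. l i \<tau>) (\<lambda>i. \<xi> i \<tau>) \<and>
        (\<forall>k\<in>{1,2}. B_plus \<Gamma>1 l U k \<tau> \<in> borel_plus G))"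

definition s1_fun :: "(nat \<Rightarrow> complex) \<Rightarrow> complex" where
  "s1_fun c = c 63 * (1 + c 3 - c 0 * c 63) / 6"

definition s2_fun :: "(nat \<Rightarrow> complex) \<Rightarrow> complex" where
  "s2_fun c = c 63 * (1 + c 1) * (1 + c 5) / 6"

text \<open>The slice \<open>s\<^sub>2 = 1\<close>, parametrized by \<open>s = s\<^sub>1\<close> as a curve \<open>s \<mapsto> t s = (t\<^sub>1, t\<^sub>2)\<close>.\<close>

definition slice_curve :: "(complex \<times> complex) set \<Rightarrow> (nat \<Rightarrow> complex \<times> complex \<Rightarrow> complex) \<Rightarrow>
    complex set \<Rightarrow> (complex \<Rightarrow> complex \<times> complex) \<Rightarrow> bool" where
  "slice_curve D c S t \<longleftrightarrow>
     (\<lambda>s. fst (t s)) holomorphic_on S \<and> (\<lambda>s. snd (t s)) holomorphic_on S \<and>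
     (\<forall>s\<in>S. t s \<in> D \<and> s1_fun (\<lambda>j. c j (t s)) = s \<and> s2_fun (\<lambda>j. c j (t s)) = 1)"

text \<open>\<open>reduced_B \<dots> s l\<^sub>0 m\<^sub>0 X\<close>: \<open>X\<close> is the value of \<open>B\<close> at the point \<open>s\<close> with
  \<open>\<lambda>\<^sub>i = l\<^sub>0 i\<close>, \<open>\<mu>\<^sub>i = m\<^sub>0 i\<close>, i.e. \<open>X ds / (s (s - 1))\<close> is the pullback to the slice of
  \<open>B\<^sup>+ = B\<^sup>+\<^sub>1 dt\<^sub>1 + B\<^sup>+\<^sub>2 dt\<^sub>2\<close> for some solution of the similarity reduction, defined near \<open>t s\<close>,
  whose dependent variables take these values at \<open>t s\<close>. The relation determines \<open>X\<close> up to the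
  centre of the algebra, where \<open>B\<close> does not enter the Lax equation.\<close>

definition reduced_B :: "'g \<Rightarrow> (complex \<times> complex) set \<Rightarrow> (complex \<times> complex \<Rightarrow> 'g) \<Rightarrow>
    (nat \<Rightarrow> complex \<times> complex \<Rightarrow> complex) \<Rightarrow> (complex \<Rightarrow> complex \<times> complex) \<Rightarrow> 'g \<Rightarrow>
    complex \<Rightarrow> (nat \<Rightarrow> complex) \<Rightarrow> (nat \<Rightarrow> complex) \<Rightarrow> 'g \<Rightarrow> bool" where
  "reduced_B \<theta> D \<Gamma>1 c t \<kappa> s l\<^sub>0 m\<^sub>0 X \<longleftrightarrow>
     (\<exists>W U l \<xi>. open W \<and> t s \<in> W \<and> W \<subseteq> D \<and>
        similarity_reduction \<theta> W U \<and> second_gauge \<theta> \<Gamma>1 c \<kappa> W U l \<xi> \<and>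
        (\<forall>i\<in>{2,4,6}. l i (t s) = l\<^sub>0 i \<and> \<xi> i (t s) = m\<^sub>0 i) \<and>
        X = (s * (s - 1)) \<cdot>
              (deriv (\<lambda>z. fst (t z)) s \<cdot> B_plus \<Gamma>1 l U 1 (t s)
               + deriv (\<lambda>z. snd (t z)) s \<cdot> B_plus \<Gamma>1 l U 2 (t s)))"

text \<open>The commutator \<open>[s (s - 1) d/ds - B, M]\<close> at the point \<open>s\<close>.\<close>

definition lax_commutator :: "(complex \<Rightarrow> 'g) \<Rightarrow> (complex \<Rightarrow> 'g) \<Rightarrow> complex \<Rightarrow> 'g" where
  "lax_commutator B M s = (s * (s - 1)) \<cdot> lie_deriv G M s - ad G (B s) (M s)"

end


section \<open>The coupled Hamiltonian system\<close>

definition H_VI ::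
  "complex \<Rightarrow> complex \<Rightarrow> complex \<Rightarrow> complex \<Rightarrow> complex \<Rightarrow> complex \<Rightarrow> complex \<Rightarrow> complex" where
  "H_VI p q s \<beta>\<^sub>0 \<beta>\<^sub>1 \<beta>\<^sub>3 \<beta>\<^sub>4 =
    (let \<beta>\<^sub>2 = (1 - \<beta>\<^sub>0 - \<beta>\<^sub>1 - \<beta>\<^sub>3 - \<beta>\<^sub>4) / 2 in
     q * (q - 1) * (q - s) * p\<^sup>2
     - ((\<beta>\<^sub>1 - 1) * q * (q - 1) + \<beta>\<^sub>3 * q * (q - s) + \<beta>\<^sub>4 * (q - 1) * (q - s)) * p
     + \<beta>\<^sub>2 * (\<beta>\<^sub>0 + \<beta>\<^sub>2) * q)"

definition H_coupled ::
  "(nat \<Rightarrow> complex) \<Rightarrow> complex \<Rightarrow> (nat \<Rightarrow> complex) \<Rightarrow> (nat \<Rightarrow> complex) \<Rightarrow> complex" where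
  "H_coupled \<alpha> s p q =
     H_VI (p 1) (q 1) s (\<alpha> 3) (1 - \<alpha> 1 - 2 * \<alpha> 2 - 2 * \<alpha> 3) (\<alpha> 1) (\<alpha> 3)
     + H_VI (p 2) (q 2) s (\<alpha> 3) (1 - 2 * \<alpha> 3 - 2 * \<alpha> 4 - \<alpha> 5) (\<alpha> 5) (\<alpha> 3)
     + H_VI (p 3) (q 3) s (\<alpha> 3) (1 - \<alpha> 0 - 2 * \<alpha> 3 - 2 * \<alpha> 6) (\<alpha> 0) (\<alpha> 3)
     + (\<Sum>(i, j) | 1 \<le> i \<and> i < j \<and> j \<le> 3.
          ((q i - 1) * p i + \<alpha> (2 * i)) * ((q j - 1) * p j + \<alpha> (2 * j)) * (q i * q j + s))"

text \<open>Functions on phase space take \<open>p\<close> first, then \<open>q\<close>; coordinates are indexed by 1, 2, 3.\<close>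

definition poisson :: "((nat \<Rightarrow> complex) \<Rightarrow> (nat \<Rightarrow> complex) \<Rightarrow> complex) \<Rightarrow>
    ((nat \<Rightarrow> complex) \<Rightarrow> (nat \<Rightarrow> complex) \<Rightarrow> complex) \<Rightarrow>
    (nat \<Rightarrow> complex) \<Rightarrow> (nat \<Rightarrow> complex) \<Rightarrow> complex" where
  "poisson F K p q =
     (\<Sum>i\<in>{1,2,3}.
        deriv (\<lambda>z. F (p(i := z)) q) (p i) * deriv (\<lambda>z. K p (q(i := z))) (q i)
        - deriv (\<lambda>z. F p (q(i := z))) (q i) * deriv (\<lambda>z. K (p(i := z)) q) (p i))"

lemma poisson_canonical:
  assumes "i \<in> {1,2,3}" "j \<in> {1,2,3}"
  shows "poisson (\<lambda>p q. p i) (\<lambda>p q. q j) p q = (if i = j then 1 else 0)"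
    and "poisson (\<lambda>p q. p i) (\<lambda>p q. p j) p q = 0"
    and "poisson (\<lambda>p q. q i) (\<lambda>p q. q j) p q = 0"
  using assms by (auto simp: poisson_def fun_upd_def)

end

theory Submission
  imports Defs "HOL-Complex_Analysis.Cauchy_Integral_Formula"
begin

text \<open>
  Only the Lax equation of one local solution through each point of the slice is needed, never the
  gauge transformation \<open>\<Gamma>\<^sub>1\<close> itself. Gauge covariance turns the similarity reduction into
  \<open>s(s - 1) dM\<^sup>+/ds = [X, M\<^sup>+]\<close> along the slice, where \<open>X\<close> is the value of \<open>B\<close>; since it has
  degrees 0 and 1 in the \<open>\<theta>\<close>-grading and lies in \<open>\<bb>\<^sub>+\<close>, it has the form \<open>h + \<Sum> x\<^sub>i e\<^sub>i + N\<close> with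
  \<open>N\<close> of degree 1, and a multiple of \<open>M\<^sup>+\<close> may be subtracted from it. The part of degree 2,
  \<open>[N, M\<^sup>+\<^sub>1] = 0\<close>, then determines \<open>N\<close> up to a factor, the parts of degree 1 and 0 determine
  \<open>h\<close>, \<open>x\<^sub>i\<close> and the derivatives of \<open>\<lambda>\<^sub>i\<close>, \<open>\<mu>\<^sub>i\<close> up to the action of a two-dimensional torus, and
  \<open>s\<^sub>1 = s\<close>, \<open>s\<^sub>2 = 1\<close> fix the factor. The functions \<open>q\<^sub>i\<close>, \<open>p\<^sub>i\<close> are invariant under this
  torus and satisfy the Hamiltonian equations. Finally, both sides of the claimed equivalence say
  that \<open>\<lambda>\<^sub>i\<close>, \<open>\<mu>\<^sub>i\<close> have at \<open>s\<close> the same derivatives as those of the local solution.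
\<close>

section \<open>Weak sums, weak derivatives and coordinates\<close>

text \<open>\<open>lie_suminf\<close>, \<open>lie_deriv\<close> and \<open>lie_partial\<close> are
  definite descriptions, so every series and every derivative needs an existence proof. All of them
  stay in \<open>vs.span gens\<close>, a finite-dimensional space of degrees 0 and 1 that is stable
  under brackets with \<open>gens0\<close>, where \<Gamma>_1 and \<Gamma>_2 take their values; there
  everything reduces to complex coordinates. Degree 2 gets no basis: an identity there is bracketed
  with f_0, f_1, f_3, f_5, which lead back to the fourteen root vectors of degree 1. The torus has
  dimension two because the seven numbers \<open>H i\<close> obey four equations from the constant
  coefficients 1 at e_21, e_45, e_60, e_234 and a fifth one from s_2 = 1; \<open>H 2\<close> and
  \<open>H 4\<close> stay free. The number 6 in the change of variables is the level of \<theta>,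
  which is also that of \<kappa>.\<close>

context affine_E6
begin

sublocale vs: vector_space "vscale G"
  by (rule vector_space)

lemma ad_add_right: "ad G x (y + z) = ad G x y + ad G x z"
  and ad_scale_right: "ad G x (a \<cdot> y) = a \<cdot> ad G x y"
  and ad_add_left: "ad G (x + y) z = ad G x z + ad G y z"
  and ad_scale_left: "ad G (a \<cdot> x) z = a \<cdot> ad G x z"
  using ad_linear_right[of x] ad_linear_left[of z] by (simp_all add: Vector_Spaces.linear_iff)

lemma ad_zero_right [simp]: "ad G x 0 = 0"
  and ad_zero_left [simp]: "ad G 0 x = 0"
  using ad_scale_right[of x 0 0] ad_scale_left[of 0 0 x] by simp_all

lemma ad_minus_right: "ad G x (- y) = - ad G x y"
  and ad_minus_left: "ad G (- x) y = - ad G x y"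
  using ad_scale_right[of x "-1" y] ad_scale_left[of "-1" x y] by simp_all

lemma ad_diff_right: "ad G x (y - z) = ad G x y - ad G x z"
  and ad_diff_left: "ad G (x - y) z = ad G x z - ad G y z"
  using ad_add_right[of x y "-z"] ad_add_left[of x "-y" z] ad_minus_right ad_minus_left by simp_all

lemma ad_sum_right: "ad G x (sum f I) = (\<Sum>i\<in>I. ad G x (f i))"
  by (induction I rule: infinite_finite_induct) (auto simp: ad_add_right)

lemma ad_antisym: "ad G x y = - ad G y x"
proof -
  have "0 = ad G (x + y) (x + y)" by (simp add: ad_self)
  also have "\<dots> = ad G y x + ad G x y" by (simp only: ad_add_left ad_add_right) (simp add: ad_self)
  finally show ?thesis by (metis eq_neg_iff_add_eq_0 add.commute)
qed

lemma ad_ad: "ad G x (ad G y z) = ad G (ad G x y) z + ad G y (ad G x z)"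
proof -
  have "ad G y (ad G z x) = - ad G y (ad G x z)" "ad G z (ad G x y) = - ad G (ad G x y) z"
    by (metis ad_antisym ad_minus_right) (rule ad_antisym)
  then show ?thesis using jacobi[of x y z] by (simp add: algebra_simps)
qed

section \<open>Linear functionals, and limits tested against them\<close>

lemma functional_iff:
  "functional G \<phi> \<longleftrightarrow> (\<forall>x y. \<phi> (x + y) = \<phi> x + \<phi> y) \<and> (\<forall>c x. \<phi> (c \<cdot> x) = c * \<phi> x)"
proof -
  have "vector_space ((*) :: complex \<Rightarrow> complex \<Rightarrow> complex)"
    by unfold_locales (auto simp: algebra_simps)
  then show ?thesis
    by (simp add: functional_def Vector_Spaces.linear_iff vector_space)
qed

lemma functional_add: "functional G \<phi> \<Longrightarrow> \<phi> (x + y) = \<phi> x + \<phi> y"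
  and functional_scale: "functional G \<phi> \<Longrightarrow> \<phi> (c \<cdot> x) = c * \<phi> x"
  by (simp_all add: functional_iff)

lemma functional_zero: "functional G \<phi> \<Longrightarrow> \<phi> 0 = 0"
  using functional_scale[of \<phi> 0 0] by simp

lemma functional_minus: "functional G \<phi> \<Longrightarrow> \<phi> (- x) = - \<phi> x"
  using functional_scale[of \<phi> "-1" x] by simp

lemma functional_diff: "functional G \<phi> \<Longrightarrow> \<phi> (x - y) = \<phi> x - \<phi> y"
  using functional_add[of \<phi> x "-y"] by (simp add: functional_minus)

lemma functional_sum: "functional G \<phi> \<Longrightarrow> \<phi> (sum f I) = (\<Sum>i\<in>I. \<phi> (f i))"
  by (induction I rule: infinite_finite_induct) (auto simp: functional_add functional_zero)

lemma functional_ad_right: "functional G \<phi> \<Longrightarrow> functional G (\<lambda>y. \<phi> (ad G x y))"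
  and functional_ad_left: "functional G \<phi> \<Longrightarrow> functional G (\<lambda>x. \<phi> (ad G x y))"
  by (auto simp: functional_iff ad_add_right ad_add_left ad_scale_right ad_scale_left)

lemma functional_form: "functional G (form G x)"
  using form_linear by (simp add: functional_def)

lemma functional_extend:
  assumes "vs.independent Bs"
  shows "\<exists>\<phi>. functional G \<phi> \<and> (\<forall>b\<in>Bs. \<phi> b = f b)"
proof -
  interpret vp: vector_space_pair "vscale G" "(*) :: complex \<Rightarrow> complex \<Rightarrow> complex"
    by unfold_locales (auto simp: algebra_simps)
  show ?thesis using vp.linear_independent_extend[OF assms] unfolding functional_def .
qed

text \<open>A nonzero vector is independent, so some functional takes the value 1 on it. All
  uniqueness of weak limits and weak derivatives rests on this.\<close>

lemma functional_eqI:
  assumes "\<And>\<phi>. functional G \<phi> \<Longrightarrow> \<phi> x = \<phi> y"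
  shows "x = y"
proof (rule ccontr)
  assume "x \<noteq> y"
  then have "vs.independent {x - y}" by (simp add: vs.dependent_single)
  from functional_extend[OF this, of "\<lambda>_. 1"] obtain \<phi> where "functional G \<phi>" "\<phi> (x - y) = 1"
    by auto
  with assms[of \<phi>] show False by (simp add: functional_diff)
qed

text \<open>Asserts convergence together with the value, whereas the description
  \<open>lie_suminf\<close> alone says nothing about existence.\<close>

definition wsums :: "(nat \<Rightarrow> 'g) \<Rightarrow> 'g \<Rightarrow> bool" where
  "wsums a y \<longleftrightarrow> (\<forall>\<phi>. functional G \<phi> \<longrightarrow> (\<lambda>n. \<phi> (a n)) sums \<phi> y)"

lemma wsumsD: "wsums a y \<Longrightarrow> functional G \<phi> \<Longrightarrow> (\<lambda>n. \<phi> (a n)) sums \<phi> y"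
  by (simp add: wsums_def)

lemma lie_suminf_eq: "wsums a y \<Longrightarrow> lie_suminf G a = y"
  unfolding lie_suminf_def wsums_def
  by (rule the_equality) (auto intro!: functional_eqI intro: sums_unique2)

lemma wsums_add: "wsums a x \<Longrightarrow> wsums b y \<Longrightarrow> wsums (\<lambda>n. a n + b n) (x + y)"
  by (auto simp: wsums_def functional_add intro: sums_add)

lemma wsums_scale: "wsums a x \<Longrightarrow> wsums (\<lambda>n. c \<cdot> a n) (c \<cdot> x)"
  by (auto simp: wsums_def functional_scale intro: sums_mult)

text \<open>\<open>lie_deriv\<close> is built on the total function \<open>deriv\<close>; this
  predicate adds differentiability against every functional.\<close>

definition wderiv :: "(complex \<Rightarrow> 'g) \<Rightarrow> 'g \<Rightarrow> complex \<Rightarrow> bool" where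
  "wderiv F v s \<longleftrightarrow>
     (\<forall>\<phi>. functional G \<phi> \<longrightarrow> ((\<lambda>z. \<phi> (F z)) has_field_derivative \<phi> v) (at s))"

lemma wderivD: "wderiv F v s \<Longrightarrow> functional G \<phi> \<Longrightarrow> ((\<lambda>z. \<phi> (F z)) has_field_derivative \<phi> v) (at s)"
  by (simp add: wderiv_def)

lemma lie_deriv_eq: "wderiv F v s \<Longrightarrow> lie_deriv G F s = v"
  unfolding lie_deriv_def wderiv_def
  by (rule the_equality) (auto intro!: functional_eqI simp: DERIV_imp_deriv)

lemma wderiv_unique: "wderiv F v s \<Longrightarrow> wderiv F w s \<Longrightarrow> v = w"
  using lie_deriv_eq by metis

lemma wderiv_transform:
  assumes "wderiv F v s" "open V" "s \<in> V" "\<And>z. z \<in> V \<Longrightarrow> F z = F' z"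
  shows "wderiv F' v s"
  unfolding wderiv_def
proof (intro allI impI)
  fix \<phi> assume "functional G \<phi>"
  from wderivD[OF assms(1) this] show "((\<lambda>z. \<phi> (F' z)) has_field_derivative \<phi> v) (at s)"
    by (rule has_field_derivative_transform_within_open[OF _ assms(2,3)]) (simp add: assms(4))
qed

lemma wderiv_add: "wderiv F v s \<Longrightarrow> wderiv F' v' s \<Longrightarrow> wderiv (\<lambda>z. F z + F' z) (v + v') s"
  by (auto simp: wderiv_def functional_add intro!: derivative_intros)

lemma wderiv_const: "wderiv (\<lambda>z. x) 0 s"
  by (auto simp: wderiv_def functional_zero)

lemma wderiv_scale: "(f has_field_derivative f') (at s) \<Longrightarrow> wderiv (\<lambda>z. f z \<cdot> x) (f' \<cdot> x) s"
  by (auto simp: wderiv_def functional_scale intro!: DERIV_cmult_right)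

lemma wderiv_sum:
  "(\<And>i. i \<in> I \<Longrightarrow> wderiv (F i) (v i) s) \<Longrightarrow> wderiv (\<lambda>z. \<Sum>i\<in>I. F i z) (\<Sum>i\<in>I. v i) s"
  by (auto simp: wderiv_def functional_sum intro!: DERIV_sum)

text \<open>The coordinate maps are functionals on the whole algebra, so weak sums and weak
  derivatives can be tested against them directly.\<close>

definition coordinates :: "'g set \<Rightarrow> 'g set \<Rightarrow> ('g \<Rightarrow> 'g \<Rightarrow> complex) \<Rightarrow> bool" where
  "coordinates W Bs r \<longleftrightarrow> vs.subspace W \<and> finite Bs \<and> Bs \<subseteq> W \<and>
     (\<forall>b\<in>Bs. functional G (r b)) \<and> (\<forall>x\<in>W. x = (\<Sum>b\<in>Bs. r b x \<cdot> b))"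

lemma coordinates_exist:
  assumes "finite F"
  shows "\<exists>Bs r. coordinates (vs.span F) Bs r"
proof -
  obtain Bs where Bs: "Bs \<subseteq> F" "vs.independent Bs" "F \<subseteq> vs.span Bs"
    by (rule vs.maximal_independent_subset)
  then have fin: "finite Bs" and sp: "vs.span F = vs.span Bs"
    using assms by (auto intro: finite_subset simp: vs.span_eq vs.span_mono vs.span_superset
        dest: subsetD[OF vs.span_mono] intro: vs.span_base)
  \<comment> \<open>A dual functional for each basis vector, extended from \<open>Bs\<close> to the
    whole algebra.\<close>
  define r where "r b = (SOME \<phi>. functional G \<phi> \<and> (\<forall>c\<in>Bs. \<phi> c = (if c = b then 1 else 0)))" for b
  have r: "functional G (r b) \<and> (\<forall>c\<in>Bs. r b c = (if c = b then 1 else 0))" for b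
    unfolding r_def by (rule someI_ex[OF functional_extend[OF Bs(2)]])
  have "x = (\<Sum>b\<in>Bs. r b x \<cdot> b)" if "x \<in> vs.span Bs" for x
    using that
  proof (induction rule: vs.span_induct_alt)
    case base
    then show ?case using r by (simp add: functional_zero)
  next
    case (step c b y)
    have "(\<Sum>d\<in>Bs. r d (c \<cdot> b + y) \<cdot> d) = (\<Sum>d\<in>Bs. (if d = b then c \<cdot> b else 0) + r d y \<cdot> d)"
      using r step(1)
      by (intro sum.cong) (auto simp: functional_add functional_scale vs.scale_left_distrib)
    also have "\<dots> = c \<cdot> b + y"
      using step fin by (simp add: sum.distrib flip: step(2))
    finally show ?case by simp
  qed
  then show ?thesis
    unfolding coordinates_def sp using r fin Bs(1) vs.span_superset
    by (intro exI[of _ Bs] exI[of _ r]) auto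
qed

text \<open>Stands in for a norm, which the algebra does not carry.\<close>

definition cnorm :: "'g set \<Rightarrow> ('g \<Rightarrow> 'g \<Rightarrow> complex) \<Rightarrow> 'g \<Rightarrow> real" where
  "cnorm Bs r x = (\<Sum>b\<in>Bs. norm (r b x))"

lemma cnorm_nonneg: "0 \<le> cnorm Bs r x"
  by (simp add: cnorm_def sum_nonneg)

lemma coordinates_functional:
  assumes "coordinates W Bs r" "x \<in> W" "functional G \<phi>"
  shows "\<phi> x = (\<Sum>b\<in>Bs. r b x * \<phi> b)"
proof -
  have "\<phi> x = \<phi> (\<Sum>b\<in>Bs. r b x \<cdot> b)"
    using assms by (simp add: coordinates_def)
  then show ?thesis by (simp add: functional_sum functional_scale assms(3))
qed

text \<open>Reduces the bracket to products of scalar coordinates, so that Cauchy products and the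
  product rule can be taken from complex analysis.\<close>

lemma coordinates_bilinear:
  assumes "coordinates W1 B1 r1" "coordinates W2 B2 r2" "x \<in> W1" "y \<in> W2" "functional G \<phi>"
  shows "\<phi> (ad G x y) = (\<Sum>b\<in>B1. \<Sum>c\<in>B2. r1 b x * r2 c y * \<phi> (ad G b c))"
  using coordinates_functional[OF assms(1,3) functional_ad_left[OF assms(5), of y]]
    coordinates_functional[OF assms(2,4) functional_ad_right[OF assms(5)]]
  by (simp add: sum_distrib_left mult.assoc)

text \<open>In finite dimension the limit can be assembled from the sums of the coordinates, and it
  stays in the subspace.\<close>

lemma wsums_exists:
  assumes "coordinates W Bs r" "\<And>n. a n \<in> W" "\<And>b. b \<in> Bs \<Longrightarrow> summable (\<lambda>n. r b (a n))"
  shows "\<exists>y\<in>W. wsums a y"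
proof
  let ?y = "\<Sum>b\<in>Bs. (\<Sum>n. r b (a n)) \<cdot> b"
  show "?y \<in> W"
    using assms(1) unfolding coordinates_def
    by (auto intro!: vs.subspace_sum vs.subspace_scale)
  show "wsums a ?y"
    unfolding wsums_def
  proof (intro allI impI)
    fix \<phi> assume \<phi>: "functional G \<phi>"
    have "(\<lambda>n. \<Sum>b\<in>Bs. r b (a n) * \<phi> b) sums (\<Sum>b\<in>Bs. (\<Sum>n. r b (a n)) * \<phi> b)"
      by (intro sums_sum sums_mult2 summable_sums assms(3))
    then show "(\<lambda>n. \<phi> (a n)) sums \<phi> ?y"
      using coordinates_functional[OF assms(1,2) \<phi>]
      by (simp add: functional_sum functional_scale \<phi>)
  qed
qed

lemma functional_bound:
  assumes "coordinates W Bs r" "functional G \<phi>"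
  shows "\<exists>K\<ge>0. \<forall>x\<in>W. norm (\<phi> x) \<le> K * cnorm Bs r x"
proof (intro exI[of _ "cnorm Bs (\<lambda>b _. \<phi> b) 0"] conjI ballI)
  fix x assume "x \<in> W"
  \<comment> \<open>An abuse of \<open>cnorm\<close>: this is the sum of the norms of
    \<open>\<phi> b\<close> over the basis, and the last argument is a dummy.\<close>
  let ?K = "cnorm Bs (\<lambda>b _. \<phi> b) 0"
  have fin: "finite Bs" using assms(1) by (simp add: coordinates_def)
  have "norm (\<phi> x) \<le> (\<Sum>b\<in>Bs. norm (r b x) * norm (\<phi> b))"
    using coordinates_functional[OF assms(1) \<open>x \<in> W\<close> assms(2)]
    by (simp add: norm_mult sum_norm_le)
  also have "\<dots> \<le> (\<Sum>b\<in>Bs. norm (r b x) * ?K)"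
    unfolding cnorm_def using fin
    by (intro sum_mono mult_left_mono member_le_sum) auto
  finally show "norm (\<phi> x) \<le> ?K * cnorm Bs r x"
    by (simp add: cnorm_def mult.commute flip: sum_distrib_left sum_distrib_right)
qed (rule cnorm_nonneg)

lemma bracket_bound:
  assumes c1: "coordinates W1 B1 r1" and c2: "coordinates W2 B2 r2" and c3: "coordinates W Bs r"
  shows "\<exists>K\<ge>0. \<forall>x\<in>W1. \<forall>y\<in>W2. ad G x y \<in> W \<longrightarrow>
           cnorm Bs r (ad G x y) \<le> K * cnorm B1 r1 x * cnorm B2 r2 y"
proof (intro exI[of _ "\<Sum>b\<in>B1. \<Sum>c\<in>B2. cnorm Bs r (ad G b c)"] conjI ballI impI)
  let ?K = "\<Sum>b\<in>B1. \<Sum>c\<in>B2. cnorm Bs r (ad G b c)"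
  fix x y assume x: "x \<in> W1" and y: "y \<in> W2"
  have fin: "finite B1" "finite B2" using c1 c2 by (simp_all add: coordinates_def)
  have "norm (r d (ad G x y))
      \<le> (\<Sum>b\<in>B1. \<Sum>c\<in>B2. norm (r1 b x) * norm (r2 c y) * norm (r d (ad G b c)))" if "d \<in> Bs" for d
  proof -
    have "functional G (r d)" using c3 that by (simp add: coordinates_def)
    from coordinates_bilinear[OF c1 c2 x y this] show ?thesis
      by (auto intro!: sum_norm_le simp: norm_mult)
  qed
  then have "cnorm Bs r (ad G x y) \<le>
      (\<Sum>d\<in>Bs. \<Sum>b\<in>B1. \<Sum>c\<in>B2. norm (r1 b x) * norm (r2 c y) * norm (r d (ad G b c)))"
    unfolding cnorm_def by (rule sum_mono)
  also have "\<dots> = (\<Sum>b\<in>B1. \<Sum>c\<in>B2. norm (r1 b x) * norm (r2 c y) * cnorm Bs r (ad G b c))"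
    unfolding cnorm_def sum_distrib_left
    by (subst sum.swap) (intro sum.cong refl sum.swap)
  also have "\<dots> \<le> (\<Sum>b\<in>B1. \<Sum>c\<in>B2. norm (r1 b x) * norm (r2 c y) * ?K)"
  proof (intro sum_mono mult_left_mono)
    fix b c assume b: "b \<in> B1" and c: "c \<in> B2"
    have "cnorm Bs r (ad G b c) \<le> (\<Sum>c\<in>B2. cnorm Bs r (ad G b c))"
      using c fin by (intro member_le_sum) (auto simp: cnorm_nonneg)
    also have "\<dots> \<le> ?K"
      using b fin by (intro member_le_sum[of b B1 "\<lambda>b. \<Sum>c\<in>B2. cnorm Bs r (ad G b c)"])
        (auto simp: cnorm_nonneg sum_nonneg)
    finally show "cnorm Bs r (ad G b c) \<le> ?K" .
  qed auto
  also have "\<dots> = ?K * cnorm B1 r1 x * cnorm B2 r2 y"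
    unfolding cnorm_def
    by (simp add: mult.commute mult.left_commute flip: sum_distrib_left sum_distrib_right)
  finally show "cnorm Bs r (ad G x y) \<le> ?K * cnorm B1 r1 x * cnorm B2 r2 y" .
qed (auto intro!: sum_nonneg cnorm_nonneg)

text \<open>The product is taken coordinate by coordinate, which is why absolute convergence is
  asked of the coordinates.\<close>

lemma wsums_Cauchy:
  assumes c1: "coordinates W1 B1 r1" and c2: "coordinates W2 B2 r2"
    and a: "\<And>n. a n \<in> W1" and b: "\<And>n. b n \<in> W2"
    and sa: "\<And>c. c \<in> B1 \<Longrightarrow> summable (\<lambda>n. norm (r1 c (a n)))"
    and sb: "\<And>c. c \<in> B2 \<Longrightarrow> summable (\<lambda>n. norm (r2 c (b n)))"
    and x: "wsums a x" "x \<in> W1" and y: "wsums b y" "y \<in> W2"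
  shows "wsums (\<lambda>n. \<Sum>k\<le>n. ad G (a k) (b (n - k))) (ad G x y)"
  unfolding wsums_def
proof (intro allI impI)
  fix \<phi> assume \<phi>: "functional G \<phi>"
  have "(\<lambda>n. (\<Sum>k\<le>n. r1 c (a k) * r2 d (b (n - k)))) sums (r1 c x * r2 d y)"
    if "c \<in> B1" "d \<in> B2" for c d
    using Cauchy_product_sums[OF sa[OF that(1)] sb[OF that(2)]]
      sums_unique[OF wsumsD[OF x(1), of "r1 c"]] sums_unique[OF wsumsD[OF y(1), of "r2 d"]] that c1 c2
    by (simp add: coordinates_def)
  then have "(\<lambda>n. \<Sum>c\<in>B1. \<Sum>d\<in>B2. (\<Sum>k\<le>n. r1 c (a k) * r2 d (b (n - k))) * \<phi> (ad G c d))
      sums (\<Sum>c\<in>B1. \<Sum>d\<in>B2. r1 c x * r2 d y * \<phi> (ad G c d))"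
    by (intro sums_sum sums_mult2)
  moreover have "(\<Sum>c\<in>B1. \<Sum>d\<in>B2. (\<Sum>k\<le>n. r1 c (a k) * r2 d (b (n - k))) * \<phi> (ad G c d))
      = \<phi> (\<Sum>k\<le>n. ad G (a k) (b (n - k)))" for n
  proof -
    have "\<phi> (\<Sum>k\<le>n. ad G (a k) (b (n - k)))
        = (\<Sum>k\<le>n. \<Sum>c\<in>B1. \<Sum>d\<in>B2. r1 c (a k) * r2 d (b (n - k)) * \<phi> (ad G c d))"
      by (simp add: functional_sum \<phi> coordinates_bilinear[OF c1 c2 a b \<phi>])
    also have "\<dots> = (\<Sum>c\<in>B1. \<Sum>d\<in>B2. \<Sum>k\<le>n. r1 c (a k) * r2 d (b (n - k)) * \<phi> (ad G c d))"
      by (subst sum.swap) (intro sum.cong refl sum.swap)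
    finally show ?thesis by (simp add: sum_distrib_right)
  qed
  ultimately show "(\<lambda>n. \<phi> (\<Sum>k\<le>n. ad G (a k) (b (n - k)))) sums \<phi> (ad G x y)"
    using coordinates_bilinear[OF c1 c2 x(2) y(2) \<phi>] by simp
qed

text \<open>The vector \<open>v\<close> and the vector built from its coordinates are both
  derivatives of the same function against each functional, hence equal.\<close>

lemma wderiv_in_span:
  assumes "coordinates W Bs r" "open V" "s \<in> V" "\<And>z. z \<in> V \<Longrightarrow> F z \<in> W" "wderiv F v s"
  shows "v \<in> W"
proof -
  have "v = (\<Sum>b\<in>Bs. r b v \<cdot> b)"
  proof (rule functional_eqI)
    fix \<phi> assume \<phi>: "functional G \<phi>"
    have "((\<lambda>z. \<Sum>b\<in>Bs. r b (F z) * \<phi> b) has_field_derivative (\<Sum>b\<in>Bs. r b v * \<phi> b)) (at s)"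
      using assms(1) by (intro DERIV_sum DERIV_cmult_right wderivD[OF assms(5)]) (auto simp: coordinates_def)
    then have "((\<lambda>z. \<phi> (F z)) has_field_derivative (\<Sum>b\<in>Bs. r b v * \<phi> b)) (at s)"
      by (rule has_field_derivative_transform_within_open[OF _ assms(2,3)])
        (simp add: coordinates_functional[OF assms(1,4) \<phi>])
    with wderivD[OF assms(5) \<phi>] show "\<phi> v = \<phi> (\<Sum>b\<in>Bs. r b v \<cdot> b)"
      using DERIV_unique by (simp add: functional_sum functional_scale \<phi>) blast
  qed
  moreover have "(\<Sum>b\<in>Bs. r b v \<cdot> b) \<in> W"
    using assms(1) by (auto simp: coordinates_def intro!: vs.subspace_sum vs.subspace_scale)
  ultimately show ?thesis by simp
qed

end

section \<open>The exponential of an inner derivation\<close>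

context affine_E6
begin

definition exp_term :: "'g \<Rightarrow> nat \<Rightarrow> 'g \<Rightarrow> 'g" where
  "exp_term g n x = (1 / fact n) \<cdot> (ad G g ^^ n) x"

text \<open>Terms of the series (exp z - 1) / z at z = ad g, which governs the derivative of the
  exponential map.\<close>

definition log_term :: "'g \<Rightarrow> nat \<Rightarrow> 'g \<Rightarrow> 'g" where
  "log_term g n x = (1 / fact (Suc n)) \<cdot> (ad G g ^^ n) x"

lemma log_term_alt: "log_term g n x = (1 / of_nat (Suc n)) \<cdot> exp_term g n x"
  by (simp add: log_term_def exp_term_def)

lemma exp_term_0 [simp]: "exp_term g 0 x = x"
  and log_term_0 [simp]: "log_term g 0 x = x"
  by (simp_all add: exp_term_def log_term_def)

lemma ad_exp_term: "ad G g (exp_term g n x) = of_nat (Suc n) \<cdot> exp_term g (Suc n) x"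
  by (simp add: exp_term_def ad_scale_right divide_simps del: of_nat_Suc)

lemma ad_log_term: "ad G g (log_term g n x) = of_nat (Suc (Suc n)) \<cdot> log_term g (Suc n) x"
  by (simp add: log_term_def ad_scale_right divide_simps del: of_nat_Suc)

lemma exp_term_Suc: "exp_term g (Suc n) x = (1 / of_nat (Suc n)) \<cdot> ad G g (exp_term g n x)"
  by (simp add: ad_exp_term del: of_nat_Suc)

lemma exp_term_add: "exp_term g n (x + y) = exp_term g n x + exp_term g n y"
  by (induction n) (simp_all add: exp_term_Suc ad_add_right vs.scale_right_distrib del: of_nat_Suc)

lemma exp_term_scale: "exp_term g n (c \<cdot> x) = c \<cdot> exp_term g n x"
  by (induction n) (simp_all add: exp_term_Suc ad_scale_right mult.commute del: of_nat_Suc)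

lemma log_term_add: "log_term g n (x + y) = log_term g n x + log_term g n y"
  and log_term_scale: "log_term g n (c \<cdot> x) = c \<cdot> log_term g n x"
  by (simp_all add: log_term_alt exp_term_add exp_term_scale vs.scale_right_distrib mult.commute
      del: of_nat_Suc)

lemma exp_ad_exp_term: "exp_ad G g x = lie_suminf G (\<lambda>n. exp_term g n x)"
  by (simp add: exp_ad_def exp_term_def)

definition gauge_term :: "'g \<Rightarrow> 'g \<Rightarrow> 'g" where
  "gauge_term g x = lie_suminf G (\<lambda>n. log_term g n x)"

text \<open>For \<open>e = 0\<close> and \<open>e = 1\<close> this is the recursion behind \<open>exp(ad g)[x, y] = [exp(ad g) x, exp(ad g) y]\<close>
  and behind the derivative of \<open>exp(ad \<Gamma>) y\<close>, respectively.\<close>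

lemma ad_Cauchy_product:
  assumes a: "\<And>k. ad G g (a k) = of_nat (k + 1 + e) \<cdot> a (Suc k)"
    and b: "\<And>k. ad G g (b k) = of_nat (k + 1) \<cdot> b (Suc k)"
  shows "ad G g (\<Sum>k\<le>n. ad G (a k) (b (n - k))) + of_nat e \<cdot> ad G (a 0) (b (Suc n))
       = of_nat (n + 1 + e) \<cdot> (\<Sum>k\<le>Suc n. ad G (a k) (b (Suc n - k)))"
proof -
  let ?t = "\<lambda>k. ad G (a k) (b (Suc n - k))"
  have "ad G g (\<Sum>k\<le>n. ad G (a k) (b (n - k)))
      = (\<Sum>k\<le>n. of_nat (k + 1 + e) \<cdot> ?t (Suc k) + of_nat (Suc n - k) \<cdot> ?t k)"
    unfolding ad_sum_right
  proof (intro sum.cong refl)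
    fix k assume k: "k \<in> {..n}"
    have "ad G g (ad G (a k) (b (n - k)))
        = of_nat (k + 1 + e) \<cdot> ?t (Suc k) + of_nat (n - k + 1) \<cdot> ad G (a k) (b (Suc (n - k)))"
      unfolding ad_ad[of g "a k"] a b by (simp only: ad_scale_left ad_scale_right diff_Suc_Suc)
    then show "ad G g (ad G (a k) (b (n - k)))
        = of_nat (k + 1 + e) \<cdot> ?t (Suc k) + of_nat (Suc n - k) \<cdot> ?t k"
      using k by (simp add: Suc_diff_le)
  qed
  also have "\<dots> = (\<Sum>k\<le>n. of_nat (Suc k + e) \<cdot> ?t (Suc k)) + (\<Sum>k\<le>n. of_nat (Suc n - k) \<cdot> ?t k)"
    by (simp add: sum.distrib)
  \<comment> \<open>The shifted sum starts at k = 1. The missing term at k = 0 has weight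
    \<open>e\<close> and is the correction on the left side of the claim.\<close>
  also have "(\<Sum>k\<le>n. of_nat (Suc k + e) \<cdot> ?t (Suc k))
      = (\<Sum>k\<le>Suc n. of_nat (k + e) \<cdot> ?t k) - of_nat e \<cdot> ?t 0"
    by (simp add: sum.atMost_Suc_shift del: sum.atMost_Suc of_nat_add of_nat_Suc)
  also have "(\<Sum>k\<le>n. of_nat (Suc n - k) \<cdot> ?t k) = (\<Sum>k\<le>Suc n. of_nat (Suc n - k) \<cdot> ?t k)"
    by simp
  also have "(\<Sum>k\<le>Suc n. of_nat (k + e) \<cdot> ?t k) - of_nat e \<cdot> ?t 0 + (\<Sum>k\<le>Suc n. of_nat (Suc n - k) \<cdot> ?t k)
      = (\<Sum>k\<le>Suc n. (of_nat (k + e) + of_nat (Suc n - k)) \<cdot> ?t k) - of_nat e \<cdot> ?t 0"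
    by (simp only: vs.scale_left_distrib sum.distrib) (simp add: algebra_simps)
  also have "(\<Sum>k\<le>Suc n. (of_nat (k + e) + of_nat (Suc n - k)) \<cdot> ?t k)
      = (\<Sum>k\<le>Suc n. of_nat (n + 1 + e) \<cdot> ?t k)"
  proof (intro sum.cong refl)
    fix k assume "k \<in> {..Suc n}"
    then have "k + e + (Suc n - k) = n + 1 + e" by simp
    then show "(of_nat (k + e) + of_nat (Suc n - k)) \<cdot> ?t k = of_nat (n + 1 + e) \<cdot> ?t k"
      by (metis of_nat_add)
  qed
  finally show ?thesis by (simp only: vs.scale_sum_right) simp
qed

text \<open>The Leibniz rule for the derivation ad g; the factorials absorb the binomial
  coefficients.\<close>

lemma exp_term_ad:
  "exp_term g n (ad G x y) = (\<Sum>k\<le>n. ad G (exp_term g k x) (exp_term g (n - k) y))"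
proof (induction n)
  case (Suc n)
  have "ad G g (\<Sum>k\<le>n. ad G (exp_term g k x) (exp_term g (n - k) y))
      = of_nat (n + 1) \<cdot> (\<Sum>k\<le>Suc n. ad G (exp_term g k x) (exp_term g (Suc n - k) y))"
    using ad_Cauchy_product[of g "\<lambda>k. exp_term g k x" 0 "\<lambda>k. exp_term g k y" n]
    by (simp add: ad_exp_term del: of_nat_Suc sum.atMost_Suc)
  then show ?case
    by (simp add: exp_term_Suc Suc.IH del: of_nat_Suc sum.atMost_Suc)
qed simp

text \<open>\<open>D n\<close> is the derivative of \<open>exp_term \<Gamma> n y\<close>.\<close>

lemma exp_term_derivative_rec:
  fixes x x' y y' :: 'g
  defines "D \<equiv> \<lambda>n. exp_term x n y' +
      (case n of 0 \<Rightarrow> 0 | Suc m \<Rightarrow> (\<Sum>k\<le>m. ad G (log_term x k x') (exp_term x (m - k) y)))"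
  shows "D (Suc n) = (1 / of_nat (Suc n)) \<cdot> (ad G x' (exp_term x n y) + ad G x (D n))"
proof -
  have "ad G x' (exp_term x n y) + ad G x (D n) = of_nat (Suc n) \<cdot> D (Suc n)"
  proof (cases n)
    case 0
    then show ?thesis
      using ad_exp_term[of x 0 y'] by (simp add: D_def vs.scale_right_distrib add.commute)
  next
    case (Suc m)
    have one: "complex_of_nat (Suc 0) = 1" by simp
    show ?thesis
      using ad_Cauchy_product[of x "\<lambda>k. log_term x k x'" 1 "\<lambda>k. exp_term x k y" m]
      by (simp add: one Suc D_def ad_add_right ad_exp_term ad_log_term vs.scale_right_distrib
          algebra_simps del: of_nat_Suc sum.atMost_Suc)
  qed
  then show ?thesis by (simp del: of_nat_Suc)
qed

lemma wderiv_ad: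
  assumes c1: "coordinates W1 B1 r1" and c2: "coordinates W2 B2 r2" and V: "open V" "s \<in> V"
    and a: "\<And>z. z \<in> V \<Longrightarrow> a z \<in> W1" "wderiv a a' s"
    and b: "\<And>z. z \<in> V \<Longrightarrow> b z \<in> W2" "wderiv b b' s"
  shows "wderiv (\<lambda>z. ad G (a z) (b z)) (ad G a' (b s) + ad G (a s) b') s"
  unfolding wderiv_def
proof (intro allI impI)
  fix \<phi> assume \<phi>: "functional G \<phi>"
  have a': "a' \<in> W1" and b': "b' \<in> W2"
    using wderiv_in_span[OF c1 V a] wderiv_in_span[OF c2 V b] by auto
  have "((\<lambda>z. \<Sum>c\<in>B1. \<Sum>d\<in>B2. r1 c (a z) * r2 d (b z) * \<phi> (ad G c d)) has_field_derivative
     (\<Sum>c\<in>B1. \<Sum>d\<in>B2. (r1 c a' * r2 d (b s) + r2 d b' * r1 c (a s)) * \<phi> (ad G c d))) (at s)"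
    using c1 c2
    by (intro DERIV_sum DERIV_cmult_right DERIV_mult wderivD[OF a(2)] wderivD[OF b(2)])
      (auto simp: coordinates_def)
  moreover have "(\<Sum>c\<in>B1. \<Sum>d\<in>B2. (r1 c a' * r2 d (b s) + r2 d b' * r1 c (a s)) * \<phi> (ad G c d))
      = \<phi> (ad G a' (b s) + ad G (a s) b')"
    using coordinates_bilinear[OF c1 c2 a' b(1)[OF V(2)] \<phi>]
      coordinates_bilinear[OF c1 c2 a(1)[OF V(2)] b' \<phi>]
    by (simp add: functional_add[OF \<phi>] algebra_simps sum.distrib)
  ultimately show "((\<lambda>z. \<phi> (ad G (a z) (b z))) has_field_derivative
      \<phi> (ad G a' (b s) + ad G (a s) b')) (at s)"
    by (auto intro: has_field_derivative_transform_within_open[OF _ V]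
        simp: coordinates_bilinear[OF c1 c2 a(1) b(1) \<phi>])
qed

end

text \<open>In the application \<open>W0\<close> holds the gauge parameters, of degree 0, and
  \<open>W\<close> the operators, of degrees 0 and 1. \<open>W\<close> is a module over
  \<open>W0\<close> and not a subalgebra, since brackets within degree 1 lead to degree 2.\<close>

locale ad_invariant = affine_E6 G for G :: "'g::ab_group_add km_data" (structure) +
  fixes W0 B0 :: "'g set" and r0 W Bs r
  assumes c0: "coordinates W0 B0 r0" and c: "coordinates W Bs r"
    and W0_W: "\<And>g x. g \<in> W0 \<Longrightarrow> x \<in> W \<Longrightarrow> ad G g x \<in> W"
    and W0_W0: "W0 \<subseteq> W"
begin

section \<open>Convergence of exp(ad g) and its dependence on parameters\<close>

lemma subspace_W: "vs.subspace W"
  using c by (simp add: coordinates_def)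

lemma exp_term_W: "g \<in> W0 \<Longrightarrow> x \<in> W \<Longrightarrow> exp_term g n x \<in> W"
  by (induction n) (auto simp: exp_term_Suc intro!: vs.subspace_scale subspace_W W0_W)

lemma log_term_W: "g \<in> W0 \<Longrightarrow> x \<in> W \<Longrightarrow> log_term g n x \<in> W"
  by (auto simp: log_term_alt intro!: vs.subspace_scale subspace_W exp_term_W)

text \<open>The constant is the same for all \<open>g\<close>, as the locally uniform estimate for a
  varying gauge parameter requires.\<close>

lemma exp_term_bound:
  "\<exists>K\<ge>0. \<forall>g\<in>W0. \<forall>x\<in>W. \<forall>n.
     cnorm Bs r (exp_term g n x) \<le> (K * cnorm B0 r0 g) ^ n / fact n * cnorm Bs r x"
proof -
  from bracket_bound[OF c0 c c] obtain K where K: "K \<ge> 0"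
    "\<And>g x. g \<in> W0 \<Longrightarrow> x \<in> W \<Longrightarrow> cnorm Bs r (ad G g x) \<le> K * cnorm B0 r0 g * cnorm Bs r x"
    using W0_W by blast
  have fr: "functional G (r b)" if "b \<in> Bs" for b using c that by (simp add: coordinates_def)
  have cs: "cnorm Bs r (a \<cdot> x) = norm a * cnorm Bs r x" for a x
    unfolding cnorm_def sum_distrib_left
    by (intro sum.cong refl) (simp add: functional_scale fr norm_mult)
  have "cnorm Bs r (exp_term g n x) \<le> (K * cnorm B0 r0 g) ^ n / fact n * cnorm Bs r x"
    if "g \<in> W0" "x \<in> W" for g x n
  proof (induction n)
    case (Suc n)
    have "cnorm Bs r (exp_term g (Suc n) x) = 1 / real (Suc n) * cnorm Bs r (ad G g (exp_term g n x))"
      by (simp add: exp_term_Suc cs norm_divide del: of_nat_Suc)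
    also have "\<dots> \<le> 1 / real (Suc n) * (K * cnorm B0 r0 g * cnorm Bs r (exp_term g n x))"
      using that by (intro mult_left_mono K exp_term_W) auto
    also have "\<dots> \<le> 1 / real (Suc n) * (K * cnorm B0 r0 g * ((K * cnorm B0 r0 g) ^ n / fact n * cnorm Bs r x))"
      using K(1) by (intro mult_left_mono Suc.IH) (auto simp: cnorm_nonneg)
    finally show ?case by (simp add: field_simps)
  qed simp
  then show ?thesis using K(1) by blast
qed

lemma exp_term_summable:
  assumes "g \<in> W0" "x \<in> W" "b \<in> Bs"
  shows "summable (\<lambda>n. norm (r b (exp_term g n x)))"
proof -
  obtain K where K: "K \<ge> 0"
    "\<And>n. cnorm Bs r (exp_term g n x) \<le> (K * cnorm B0 r0 g) ^ n / fact n * cnorm Bs r x"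
    using exp_term_bound assms by blast
  have fin: "finite Bs" using c by (simp add: coordinates_def)
  show ?thesis
  proof (rule summable_comparison_test')
    show "summable (\<lambda>n. (K * cnorm B0 r0 g) ^ n / fact n * cnorm Bs r x)"
      using summable_exp[of "K * cnorm B0 r0 g"] by (intro summable_mult2) (simp add: field_simps)
    fix n :: nat
    have "norm (r b (exp_term g n x)) \<le> cnorm Bs r (exp_term g n x)"
      unfolding cnorm_def using assms fin by (intro member_le_sum) auto
    with K(2)[of n] show "norm (norm (r b (exp_term g n x))) \<le> (K * cnorm B0 r0 g) ^ n / fact n * cnorm Bs r x"
      by simp
  qed
qed

lemma log_term_summable:
  assumes "g \<in> W0" "x \<in> W" "b \<in> Bs"
  shows "summable (\<lambda>n. norm (r b (log_term g n x)))"
proof (rule summable_comparison_test'[OF exp_term_summable[OF assms]])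
  fix n :: nat
  have "functional G (r b)" using c assms by (simp add: coordinates_def)
  then show "norm (norm (r b (log_term g n x))) \<le> norm (r b (exp_term g n x))"
    by (simp add: log_term_alt functional_scale norm_mult norm_divide mult_left_le_one_le divide_simps
        del: of_nat_Suc) (simp add: mult_le_cancel_left1)
qed

lemma exp_ad_wsums: "g \<in> W0 \<Longrightarrow> x \<in> W \<Longrightarrow> wsums (\<lambda>n. exp_term g n x) (exp_ad G g x) \<and> exp_ad G g x \<in> W"
  using wsums_exists[OF c exp_term_W summable_norm_cancel[OF exp_term_summable]]
  unfolding exp_ad_exp_term by (metis lie_suminf_eq)

lemma gauge_term_wsums: "g \<in> W0 \<Longrightarrow> x \<in> W \<Longrightarrow> wsums (\<lambda>n. log_term g n x) (gauge_term g x) \<and> gauge_term g x \<in> W"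
  using wsums_exists[OF c log_term_W summable_norm_cancel[OF log_term_summable]]
  unfolding gauge_term_def by (metis lie_suminf_eq)

lemmas exp_ad_sums = exp_ad_wsums[THEN conjunct1] and exp_ad_W = exp_ad_wsums[THEN conjunct2]
lemmas gauge_term_sums = gauge_term_wsums[THEN conjunct1] and gauge_term_W = gauge_term_wsums[THEN conjunct2]

lemma exp_ad_add: "g \<in> W0 \<Longrightarrow> x \<in> W \<Longrightarrow> y \<in> W \<Longrightarrow> exp_ad G g (x + y) = exp_ad G g x + exp_ad G g y"
  using wsums_add[OF exp_ad_sums exp_ad_sums] unfolding exp_ad_exp_term[of g "x + y"]
  by (intro lie_suminf_eq) (simp add: exp_term_add)

lemma exp_ad_scale: "g \<in> W0 \<Longrightarrow> x \<in> W \<Longrightarrow> exp_ad G g (a \<cdot> x) = a \<cdot> exp_ad G g x"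
  using wsums_scale[OF exp_ad_sums] unfolding exp_ad_exp_term[of g "a \<cdot> x"]
  by (intro lie_suminf_eq) (simp add: exp_term_scale)

lemma gauge_term_add: "g \<in> W0 \<Longrightarrow> x \<in> W \<Longrightarrow> y \<in> W \<Longrightarrow> gauge_term g (x + y) = gauge_term g x + gauge_term g y"
  using wsums_add[OF gauge_term_sums gauge_term_sums] unfolding gauge_term_def[of g "x + y"]
  by (intro lie_suminf_eq) (simp add: log_term_add)

lemma gauge_term_scale: "g \<in> W0 \<Longrightarrow> x \<in> W \<Longrightarrow> gauge_term g (a \<cdot> x) = a \<cdot> gauge_term g x"
  using wsums_scale[OF gauge_term_sums] unfolding gauge_term_def[of g "a \<cdot> x"]
  by (intro lie_suminf_eq) (simp add: log_term_scale)

lemma exp_ad_ad: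
  assumes "g \<in> W0" "x \<in> W" "y \<in> W"
  shows "exp_ad G g (ad G x y) = ad G (exp_ad G g x) (exp_ad G g y)"
  unfolding exp_ad_exp_term[of g "ad G x y"] exp_term_ad
  by (rule lie_suminf_eq, rule wsums_Cauchy[OF c c])
    (use assms in \<open>auto intro: exp_term_W exp_term_summable exp_ad_sums exp_ad_W\<close>)

text \<open>Termwise differentiation. For holomorphic terms a locally uniform majorant of the series
  itself is enough, so only the terms and not their derivatives are estimated. The derivative series
  is then recognized as a series of exponential type plus a Cauchy product.\<close>

lemma wderiv_exp_ad:
  assumes V: "open V" "s \<in> V"
    and \<Gamma>: "\<And>z. z \<in> V \<Longrightarrow> \<Gamma> z \<in> W0" "\<And>z. z \<in> V \<Longrightarrow> wderiv \<Gamma> (\<Gamma>' z) z"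
    and y: "\<And>z. z \<in> V \<Longrightarrow> y z \<in> W" "\<And>z. z \<in> V \<Longrightarrow> wderiv y (y' z) z"
  shows "wderiv (\<lambda>z. exp_ad G (\<Gamma> z) (y z))
           (exp_ad G (\<Gamma> s) (y' s) + ad G (gauge_term (\<Gamma> s) (\<Gamma>' s)) (exp_ad G (\<Gamma> s) (y s))) s"
proof -
  have \<Gamma>': "\<Gamma>' z \<in> W0" and y': "y' z \<in> W" if "z \<in> V" for z
    using wderiv_in_span[OF c0 V(1) that \<Gamma>(1) \<Gamma>(2)] wderiv_in_span[OF c V(1) that y(1) y(2)] that
    by auto
  define T where "T z m = (\<Sum>k\<le>m. ad G (log_term (\<Gamma> z) k (\<Gamma>' z)) (exp_term (\<Gamma> z) (m - k) (y z)))" for z m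
  \<comment> \<open>The commutator part of the derivative of term n is entry n - 1 of the Cauchy
    product \<open>T\<close>, hence the case distinction.\<close>
  define D where "D z n = exp_term (\<Gamma> z) n (y' z) + (case n of 0 \<Rightarrow> 0 | Suc m \<Rightarrow> T z m)" for z n
  have D: "wderiv (\<lambda>z. exp_term (\<Gamma> z) n (y z)) (D z n) z" if "z \<in> V" for z n
    using that
  proof (induction n arbitrary: z)
    case 0
    then show ?case by (simp add: D_def y)
  next
    case (Suc n)
    have "wderiv (\<lambda>z. (1 / of_nat (Suc n)) \<cdot> ad G (\<Gamma> z) (exp_term (\<Gamma> z) n (y z)))
       ((1 / of_nat (Suc n)) \<cdot> (ad G (\<Gamma>' z) (exp_term (\<Gamma> z) n (y z)) + ad G (\<Gamma> z) (D z n))) z"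
      using wderiv_ad[OF c0 c V(1) Suc.prems \<Gamma> exp_term_W[OF \<Gamma>(1) y(1)] Suc.IH] Suc.prems
      unfolding wderiv_def
      by (auto simp: functional_scale simp del: of_nat_Suc intro!: DERIV_cdivide)
    moreover have "D z (Suc n)
        = (1 / of_nat (Suc n)) \<cdot> (ad G (\<Gamma>' z) (exp_term (\<Gamma> z) n (y z)) + ad G (\<Gamma> z) (D z n))"
      unfolding D_def T_def by (rule exp_term_derivative_rec)
    ultimately show ?case
      by (simp only: exp_term_Suc)
  qed
  have T: "wsums (T s) (ad G (gauge_term (\<Gamma> s) (\<Gamma>' s)) (exp_ad G (\<Gamma> s) (y s)))"
    unfolding T_def
    by (rule wsums_Cauchy[OF c c])
      (use V(2) \<Gamma>' \<Gamma>(1) y(1) W0_W0 in \<open>auto intro!: exp_term_W log_term_W exp_term_summable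
         log_term_summable exp_ad_sums exp_ad_W gauge_term_sums gauge_term_W\<close>)
  obtain K where K: "K \<ge> 0" "\<And>g x n. g \<in> W0 \<Longrightarrow> x \<in> W \<Longrightarrow>
      cnorm Bs r (exp_term g n x) \<le> (K * cnorm B0 r0 g) ^ n / fact n * cnorm Bs r x"
    using exp_term_bound by blast
  have cont: "continuous_on V (\<lambda>z. cnorm B0 r0 (\<Gamma> z))" "continuous_on V (\<lambda>z. cnorm Bs r (y z))"
    unfolding cnorm_def using c c0
    by (intro continuous_on_sum continuous_on_norm continuous_at_imp_continuous_on ballI
        DERIV_isCont[OF wderivD[OF \<Gamma>(2)]] DERIV_isCont[OF wderivD[OF y(2)]];
        auto simp: coordinates_def)+
  show ?thesis
    unfolding wderiv_def
  proof (intro allI impI)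
    fix \<phi> assume \<phi>: "functional G \<phi>"
    obtain C where C: "C \<ge> 0" "\<And>x. x \<in> W \<Longrightarrow> norm (\<phi> x) \<le> C * cnorm Bs r x"
      using functional_bound[OF c \<phi>] by blast
    have "\<exists>f f'. \<forall>z\<in>V. (\<lambda>n. \<phi> (exp_term (\<Gamma> z) n (y z))) sums f z \<and>
        (\<lambda>n. \<phi> (D z n)) sums f' z \<and> (f has_field_derivative f' z) (at z)"
    proof (rule series_and_derivative_comparison_complex[OF V(1)])
      show "((\<lambda>z. \<phi> (exp_term (\<Gamma> z) n (y z))) has_field_derivative \<phi> (D z n)) (at z)" if "z \<in> V" for z n
        by (rule wderivD[OF D[OF that] \<phi>])
    next
      fix x assume x: "x \<in> V"
      \<comment> \<open>The summand 1 leaves room for a neighbourhood in which both norms stay below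
        \<open>a\<close> and \<open>b\<close>.\<close>
      define a where "a = cnorm B0 r0 (\<Gamma> x) + 1"
      define b where "b = cnorm Bs r (y x) + 1"
      have "continuous (at x) (\<lambda>z. cnorm B0 r0 (\<Gamma> z))" "continuous (at x) (\<lambda>z. cnorm Bs r (y z))"
        using cont x V(1) by (auto simp: continuous_on_eq_continuous_at)
      then have "((\<lambda>z. cnorm B0 r0 (\<Gamma> z)) \<longlongrightarrow> cnorm B0 r0 (\<Gamma> x)) (nhds x)"
          "((\<lambda>z. cnorm Bs r (y z)) \<longlongrightarrow> cnorm Bs r (y x)) (nhds x)"
        using tendsto_at_iff_tendsto_nhds[of "\<lambda>z. cnorm B0 r0 (\<Gamma> z)" x]
          tendsto_at_iff_tendsto_nhds[of "\<lambda>z. cnorm Bs r (y z)" x]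
        unfolding continuous_at by blast+
      then have "\<forall>\<^sub>F z in nhds x. cnorm B0 r0 (\<Gamma> z) < a" "\<forall>\<^sub>F z in nhds x. cnorm Bs r (y z) < b"
        by (auto simp: a_def b_def elim!: order_tendstoD)
      then have "\<forall>\<^sub>F z in nhds x. cnorm B0 r0 (\<Gamma> z) < a \<and> cnorm Bs r (y z) < b"
        by (rule eventually_conj)
      then obtain d where d: "d > 0" "\<And>z. dist z x < d \<Longrightarrow> cnorm B0 r0 (\<Gamma> z) < a \<and> cnorm Bs r (y z) < b"
        by (auto simp: eventually_nhds_metric)
      define h where "h n = complex_of_real (C * ((K * a) ^ n / fact n * b))" for n
      have ab: "a \<ge> 0" "b \<ge> 0" by (simp_all add: a_def b_def cnorm_nonneg add_nonneg_nonneg)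
      have "summable h"
        unfolding h_def using summable_exp[of "K * a"]
        by (intro summable_of_real summable_mult summable_mult2) (simp add: field_simps)
      moreover have "range h \<subseteq> \<real>\<^sub>\<ge>\<^sub>0"
        using ab K(1) C(1) by (auto simp: h_def simp del: of_real_mult of_real_divide of_real_power)
      moreover have "norm (\<phi> (exp_term (\<Gamma> z) n (y z))) \<le> norm (h n)" if z: "z \<in> ball x d \<inter> V" for z n
      proof -
        have "norm (\<phi> (exp_term (\<Gamma> z) n (y z))) \<le> C * cnorm Bs r (exp_term (\<Gamma> z) n (y z))"
          using z by (intro C exp_term_W \<Gamma> y) auto
        also have "\<dots> \<le> C * ((K * cnorm B0 r0 (\<Gamma> z)) ^ n / fact n * cnorm Bs r (y z))"
          using z by (intro mult_left_mono K C \<Gamma> y) auto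
        also have "\<dots> \<le> C * ((K * a) ^ n / fact n * b)"
          using z d(2)[of z] K(1) C(1) ab
          by (intro mult_left_mono mult_mono divide_right_mono power_mono)
            (auto simp: cnorm_nonneg dist_commute)
        also have "\<dots> = norm (h n)"
          unfolding h_def norm_of_real using ab K(1) C(1) by simp
        finally show ?thesis .
      qed
      ultimately show "\<exists>d h. 0 < d \<and> summable h \<and> range h \<subseteq> \<real>\<^sub>\<ge>\<^sub>0 \<and>
          (\<forall>\<^sub>F n in sequentially. \<forall>z\<in>ball x d \<inter> V. norm (\<phi> (exp_term (\<Gamma> z) n (y z))) \<le> cmod (h n))"
        using d(1) by (intro exI[of _ d] exI[of _ h]) auto
    qed
    then obtain f f' where f: "\<And>z. z \<in> V \<Longrightarrow> (\<lambda>n. \<phi> (exp_term (\<Gamma> z) n (y z))) sums f z"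
        "(\<lambda>n. \<phi> (D s n)) sums f' s" "(f has_field_derivative f' s) (at s)"
      using V(2) by blast
    have "f z = \<phi> (exp_ad G (\<Gamma> z) (y z))" if "z \<in> V" for z
      using sums_unique2[OF f(1)[OF that] wsumsD[OF exp_ad_sums \<phi>]] \<Gamma>(1) y(1) that by blast
    moreover have "f' s = \<phi> (exp_ad G (\<Gamma> s) (y' s)) + \<phi> (ad G (gauge_term (\<Gamma> s) (\<Gamma>' s)) (exp_ad G (\<Gamma> s) (y s)))"
    proof (rule sums_unique2[OF f(2)])
      have "(\<lambda>n. \<phi> (case n of 0 \<Rightarrow> 0 | Suc m \<Rightarrow> T s m)) sums
          \<phi> (ad G (gauge_term (\<Gamma> s) (\<Gamma>' s)) (exp_ad G (\<Gamma> s) (y s)))"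
        using wsumsD[OF T \<phi>] sums_Suc_iff[of "\<lambda>n. \<phi> (case n of 0 \<Rightarrow> 0 | Suc m \<Rightarrow> T s m)"]
        by (simp add: functional_zero \<phi>)
      then show "(\<lambda>n. \<phi> (D s n)) sums (\<phi> (exp_ad G (\<Gamma> s) (y' s)) +
          \<phi> (ad G (gauge_term (\<Gamma> s) (\<Gamma>' s)) (exp_ad G (\<Gamma> s) (y s))))"
        unfolding D_def functional_add[OF \<phi>]
        by (intro sums_add wsumsD[OF exp_ad_sums \<phi>]) (use V(2) \<Gamma>(1) y' in auto)
    qed
    ultimately show "((\<lambda>z. \<phi> (exp_ad G (\<Gamma> z) (y z))) has_field_derivative
       \<phi> (exp_ad G (\<Gamma> s) (y' s) + ad G (gauge_term (\<Gamma> s) (\<Gamma>' s)) (exp_ad G (\<Gamma> s) (y s)))) (at s)"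
      using has_field_derivative_transform_within_open[OF f(3) V] by (simp add: functional_add \<phi>)
  qed
qed

text \<open>As exp(ad \<Gamma>) preserves brackets, it turns [b, y] into a bracket with the
  transformed y; the contribution of the derivative of \<Gamma> is a bracket with the same vector
  and can be added to the transformed b.\<close>

lemma wderiv_exp_ad_Lax:
  assumes V: "open V" "s \<in> V"
    and \<Gamma>: "\<And>z. z \<in> V \<Longrightarrow> \<Gamma> z \<in> W0" "\<And>z. z \<in> V \<Longrightarrow> wderiv \<Gamma> (\<Gamma>' z) z"
    and y: "\<And>z. z \<in> V \<Longrightarrow> y z \<in> W" "\<And>z. z \<in> V \<Longrightarrow> wderiv y (ad G (b z) (y z)) z"
    and b: "b s \<in> W"
  shows "wderiv (\<lambda>z. exp_ad G (\<Gamma> z) (y z))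
           (ad G (exp_ad G (\<Gamma> s) (b s) + gauge_term (\<Gamma> s) (\<Gamma>' s)) (exp_ad G (\<Gamma> s) (y s))) s"
  using wderiv_exp_ad[OF V \<Gamma> y]
  by (simp add: exp_ad_ad[OF \<Gamma>(1)[OF V(2)] b y(1)[OF V(2)]] ad_add_left)

end

section \<open>Root vectors of degree zero and one\<close>

text \<open>Keeps the index 1 in words and coefficient families from turning into
  \<open>Suc 0\<close>.\<close>

declare One_nat_def [simp del]

text \<open>The pairs e_2 and f_2, e_4 and f_4, e_6 and f_6 generate three commuting copies of sl_2
  in degree 0. Under them e_0, e_1 and e_5 each generate a doublet and e_3 a triple tensor product
  of doublets, so there are 2 + 2 + 2 + 8 words.\<close>

definition words :: "nat list set" where
  "words = {[0], [6,0], [1], [2,1], [5], [4,5], [3], [2,3], [4,3], [6,3], [2,3,4], [2,3,6], [4,3,6],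
     [6,2,3,4]}"

text \<open>\<open>raise i n\<close> and \<open>lower i n\<close> are the coordinates of \<open>[e\<^sub>i, x]\<close> and \<open>[f\<^sub>i, x]\<close>, where \<open>n\<close> are those
  of \<open>x\<close>. The signs come from the words \<open>234\<close>, \<open>236\<close>, \<open>436\<close> and \<open>6234\<close>, which do not end in 3.\<close>

definition raise :: "nat \<Rightarrow> (nat list \<Rightarrow> complex) \<Rightarrow> nat list \<Rightarrow> complex" where
  "raise i n w =
    (if i = 2 then
       if w = [2,1] then n [1] else if w = [2,3] then n [3] else if w = [2,3,4] then - n [4,3]
       else if w = [2,3,6] then - n [6,3] else if w = [6,2,3,4] then n [4,3,6] else 0
     else if i = 4 then
       if w = [4,5] then n [5] else if w = [4,3] then n [3] else if w = [2,3,4] then - n [2,3]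
       else if w = [4,3,6] then - n [6,3] else if w = [6,2,3,4] then n [2,3,6] else 0
     else
       if w = [6,0] then n [0] else if w = [6,3] then n [3] else if w = [2,3,6] then - n [2,3]
       else if w = [4,3,6] then - n [4,3] else if w = [6,2,3,4] then n [2,3,4] else 0)"

definition lower :: "nat \<Rightarrow> (nat list \<Rightarrow> complex) \<Rightarrow> nat list \<Rightarrow> complex" where
  "lower i n w =
    (if i = 2 then
       if w = [1] then n [2,1] else if w = [3] then n [2,3] else if w = [4,3] then - n [2,3,4]
       else if w = [6,3] then - n [2,3,6] else if w = [4,3,6] then n [6,2,3,4] else 0
     else if i = 4 then
       if w = [5] then n [4,5] else if w = [3] then n [4,3] else if w = [2,3] then - n [2,3,4]
       else if w = [6,3] then - n [4,3,6] else if w = [2,3,6] then n [6,2,3,4] else 0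
     else
       if w = [0] then n [6,0] else if w = [3] then n [6,3] else if w = [2,3] then - n [2,3,6]
       else if w = [4,3] then - n [4,3,6] else if w = [2,3,4] then n [6,2,3,4] else 0)"

context affine_E6
begin

abbreviation "e \<equiv> e_gen G"
abbreviation "f \<equiv> f_gen G"

section \<open>The Cartan subalgebra acting through the invariant form\<close>

lemma functional_form_left: "functional G (\<lambda>x. form G x y)"
proof -
  have "(\<lambda>x. form G x y) = form G y" by (rule ext) (rule form_sym)
  then show ?thesis by (simp add: functional_form)
qed

lemmas form_add = functional_add[OF functional_form] functional_add[OF functional_form_left]
lemmas form_scale = functional_scale[OF functional_form] functional_scale[OF functional_form_left]
lemmas form_zero = functional_zero[OF functional_form] functional_zero[OF functional_form_left]

lemma cartan_induct [consumes 1, case_names zero add scale coroot scaling]: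
  assumes "h \<in> cartan_subalgebra G" "P 0" "\<And>x y. P x \<Longrightarrow> P y \<Longrightarrow> P (x + y)"
    "\<And>a x. P x \<Longrightarrow> P (a \<cdot> x)" "\<And>i. i \<le> 6 \<Longrightarrow> P (coroot G i)" "P (scaling G)"
  shows "P h"
  using assms(1) unfolding cartan_subalgebra_def
  by (induction rule: vs.span_induct) (use assms in \<open>auto intro!: vs.subspaceI\<close>)

lemma subspace_cartan: "vs.subspace (cartan_subalgebra G)"
  by (simp add: cartan_subalgebra_def)

lemma coroot_cartan: "i \<le> 6 \<Longrightarrow> coroot G i \<in> cartan_subalgebra G"
  and scaling_cartan: "scaling G \<in> cartan_subalgebra G"
  by (auto simp: cartan_subalgebra_def intro: vs.span_base)

text \<open>The Cartan matrix is symmetric, so the normalized form identifies each simple root with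
  its coroot, and the form value is the root evaluated at \<open>h\<close>.\<close>

lemma cartan_e: "h \<in> cartan_subalgebra G \<Longrightarrow> i \<le> 6 \<Longrightarrow> ad G h (e i) = form G h (coroot G i) \<cdot> e i"
  by (induction rule: cartan_induct)
    (auto simp: coroot_e scaling_e form_coroot_coroot form_scaling_coroot ad_add_left ad_scale_left
      form_zero form_add form_scale vs.scale_left_distrib)

lemma cartan_f: "h \<in> cartan_subalgebra G \<Longrightarrow> i \<le> 6 \<Longrightarrow> ad G h (f i) = (- form G h (coroot G i)) \<cdot> f i"
  by (induction rule: cartan_induct)
    (auto simp: coroot_f scaling_f form_coroot_coroot form_scaling_coroot ad_add_left ad_scale_left
      form_zero form_add form_scale vs.scale_left_diff_distrib)

lemma form_cartan: "h \<in> cartan_subalgebra G \<Longrightarrow> i \<le> 6 \<Longrightarrow> form G h (e i) = 0 \<and> form G h (f i) = 0"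
  by (induction rule: cartan_induct) (auto simp: form_cartan_ef form_zero form_add form_scale)

lemma cartan_coroot: "h \<in> cartan_subalgebra G \<Longrightarrow> i \<le> 6 \<Longrightarrow> ad G h (coroot G i) = 0"
  by (induction rule: cartan_induct) (auto simp: coroot_coroot scaling_coroot ad_add_left ad_scale_left)

lemma cartan_scaling: "h \<in> cartan_subalgebra G \<Longrightarrow> ad G h (scaling G) = 0"
  by (induction rule: cartan_induct)
    (auto simp: ad_antisym[of "coroot G _" "scaling G"] scaling_coroot ad_self ad_add_left ad_scale_left)

lemma cartan_cartan: "h' \<in> cartan_subalgebra G \<Longrightarrow> h \<in> cartan_subalgebra G \<Longrightarrow> ad G h h' = 0"
  by (induction rule: cartan_induct)
    (auto simp: cartan_coroot cartan_scaling ad_add_right ad_scale_right)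

lemma f_e: "i \<le> 6 \<Longrightarrow> j \<le> 6 \<Longrightarrow> ad G (f i) (e j) = (if i = j then - coroot G i else 0)"
  by (subst ad_antisym) (auto simp: e_f)

lemma form_f_e: "i \<le> 6 \<Longrightarrow> j \<le> 6 \<Longrightarrow> form G (f i) (e j) = (if i = j then 1 else 0)"
  by (subst form_sym) (auto simp: form_e_f)

lemma e_comm:
  assumes "i \<le> 6" "j \<le> 6" "i \<noteq> j" "cartan_E6 i j = 0"
  shows "ad G (e i) (e j) = 0" "ad G (e i) (ad G (e j) x) = ad G (e j) (ad G (e i) x)"
proof -
  show *: "ad G (e i) (e j) = 0"
    using serre_e[OF assms(1-3)] assms(4) by (simp add: numeral_eq_Suc One_nat_def)
  show "ad G (e i) (ad G (e j) x) = ad G (e j) (ad G (e i) x)"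
    by (simp add: ad_ad[of "e i" "e j" x] *)
qed

lemma f_comm:
  assumes "i \<le> 6" "j \<le> 6" "i \<noteq> j" "cartan_E6 i j = 0"
  shows "ad G (f i) (f j) = 0"
  using serre_f[OF assms(1-3)] assms(4) by (simp add: numeral_eq_Suc One_nat_def)

lemma e_serre:
  assumes "i \<le> 6" "j \<le> 6" "i \<noteq> j" "cartan_E6 i j = -1"
  shows "ad G (e i) (ad G (e i) (e j)) = 0"
  using serre_e[OF assms(1-3)] assms(4) by (simp add: numeral_2_eq_2)

lemma f_ad_e:
  assumes "i \<le> 6" "j \<le> 6"
  shows "ad G (f i) (ad G (e j) x) = (if i = j then - ad G (coroot G i) x else 0) + ad G (e j) (ad G (f i) x)"
  by (simp add: ad_ad[of "f i" "e j" x] f_e assms ad_minus_left)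

lemma cartan_ad_e:
  assumes "h \<in> cartan_subalgebra G" "i \<le> 6"
  shows "ad G h (ad G (e i) x) = form G h (coroot G i) \<cdot> ad G (e i) x + ad G (e i) (ad G h x)"
  by (simp add: ad_ad[of h "e i" x] cartan_e assms ad_scale_left)

lemma cartan_word:
  assumes "h \<in> cartan_subalgebra G" "set w \<subseteq> {..6}"
  shows "ad G h (e_word G w) = (\<Sum>i\<leftarrow>w. form G h (coroot G i)) \<cdot> e_word G w"
  using assms(2)
  by (induction w rule: induct_list012)
    (auto simp: cartan_e cartan_ad_e assms(1) vs.scale_left_distrib ad_scale_right ad_add_right)

section \<open>Normal forms of words under e_2, e_4, e_6\<close>

lemma e_34: "ad G (e 3) (e 4) = - ad G (e 4) (e 3)" and e_36: "ad G (e 3) (e 6) = - ad G (e 6) (e 3)"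
  by (rule ad_antisym)+

lemma e_commutes:
  "ad G (e 4) (ad G (e 2) x) = ad G (e 2) (ad G (e 4) x)"
  "ad G (e 6) (ad G (e 2) x) = ad G (e 2) (ad G (e 6) x)"
  "ad G (e 6) (ad G (e 4) x) = ad G (e 4) (ad G (e 6) x)"
  by (rule e_comm(2); simp add: cartan_E6_def doubleton_eq_iff)+

lemma e_zeros:
  "ad G (e 2) (e 0) = 0" "ad G (e 2) (e 5) = 0" "ad G (e 4) (e 0) = 0" "ad G (e 4) (e 1) = 0"
  "ad G (e 6) (e 1) = 0" "ad G (e 6) (e 5) = 0"
  "ad G (e 2) (ad G (e 2) (e 1)) = 0" "ad G (e 4) (ad G (e 4) (e 5)) = 0"
  "ad G (e 6) (ad G (e 6) (e 0)) = 0"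
  by (rule e_comm(1) e_serre; simp add: cartan_E6_def doubleton_eq_iff)+

lemma e_serre_3:
  "ad G (e 2) (ad G (e 2) (e 3)) = 0" "ad G (e 4) (ad G (e 4) (e 3)) = 0"
  "ad G (e 6) (ad G (e 6) (e 3)) = 0"
  by (rule e_serre; simp add: cartan_E6_def doubleton_eq_iff)+

lemma e_zeros_3:
  "ad G (e 2) (ad G (e 6) (e 0)) = 0" "ad G (e 2) (ad G (e 4) (e 5)) = 0"
  "ad G (e 4) (ad G (e 6) (e 0)) = 0"
  "ad G (e 2) (ad G (e 2) (ad G (e 4) (e 3))) = 0" "ad G (e 2) (ad G (e 2) (ad G (e 6) (e 3))) = 0"
  "ad G (e 4) (ad G (e 4) (ad G (e 6) (e 3))) = 0"
  "ad G (e 2) (ad G (e 2) (ad G (e 4) (ad G (e 6) (e 3)))) = 0"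
  by (metis e_commutes e_serre_3 e_zeros ad_zero_right)+

lemmas e_word_simps = e_34 e_36 e_commutes e_zeros e_serre_3 e_zeros_3 ad_minus_right

definition V1 :: "(nat list \<Rightarrow> complex) \<Rightarrow> 'g" where
  "V1 n = (\<Sum>w\<in>words. n w \<cdot> e_word G w)"

lemma V1_add: "V1 (\<lambda>w. m w + n w) = V1 m + V1 n"
  by (simp add: V1_def vs.scale_left_distrib sum.distrib)

lemma V1_scale: "V1 (\<lambda>w. a * n w) = a \<cdot> V1 n"
  by (simp add: V1_def vs.scale_sum_right)

lemma V1_uminus: "V1 (\<lambda>w. - n w) = - V1 n"
  using V1_scale[of "-1" n] by simp

lemma V1_diff: "V1 (\<lambda>w. m w - n w) = V1 m - V1 n"
  using V1_add[of m "\<lambda>w. - n w"] by (simp add: V1_uminus)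

lemma V1_cong: "(\<And>w. w \<in> words \<Longrightarrow> m w = n w) \<Longrightarrow> V1 m = V1 n"
  by (simp add: V1_def)

lemma V1_explicit:
  "V1 n = n [0] \<cdot> e_word G [0] + n [6,0] \<cdot> e_word G [6,0] + n [1] \<cdot> e_word G [1]
     + n [2,1] \<cdot> e_word G [2,1] + n [5] \<cdot> e_word G [5] + n [4,5] \<cdot> e_word G [4,5]
     + n [3] \<cdot> e_word G [3] + n [2,3] \<cdot> e_word G [2,3] + n [4,3] \<cdot> e_word G [4,3]
     + n [6,3] \<cdot> e_word G [6,3] + n [2,3,4] \<cdot> e_word G [2,3,4] + n [2,3,6] \<cdot> e_word G [2,3,6]
     + n [4,3,6] \<cdot> e_word G [4,3,6] + n [6,2,3,4] \<cdot> e_word G [6,2,3,4]"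
  by (simp add: V1_def words_def add.assoc del: e_word.simps)

lemma cartan_V1:
  assumes "h \<in> cartan_subalgebra G"
  shows "ad G h (V1 n) = V1 (\<lambda>w. (\<Sum>i\<leftarrow>w. form G h (coroot G i)) * n w)"
proof -
  have "set w \<subseteq> {..6}" if "w \<in> words" for w
    using that by (auto simp: words_def)
  then show ?thesis
    by (simp add: V1_def ad_sum_right ad_scale_right cartan_word[OF assms] mult.commute)
qed

lemma e_V1: "i \<in> {2,4,6} \<Longrightarrow> ad G (e i) (V1 n) = V1 (raise i n)"
  by (auto simp: V1_explicit raise_def ad_add_right ad_diff_right ad_scale_right e_word_simps algebra_simps)

lemmas f_word_simps = f_ad_e f_e ad_minus_right cartan_ad_e[OF coroot_cartan] coroot_e ad_scale_right
  form_coroot_coroot cartan_E6_def doubleton_eq_iff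

lemma f_V1: "i \<in> {2,4,6} \<Longrightarrow> ad G (f i) (V1 n) = V1 (lower i n)"
  by (auto simp: V1_explicit lower_def ad_add_right ad_diff_right ad_scale_right e_34 e_36 e_commutes f_word_simps algebra_simps)

text \<open>These four operators lower degree 1 to degree 0. Words with two or more raising letters
  applied to e_3 are annihilated by f_3: it leaves a coroot, the first raising letter turns this
  into a multiple of itself, and e_2, e_4, e_6 commute.\<close>

lemma f_V1_outer:
  "ad G (f 0) (V1 n) = - (n [0] \<cdot> coroot G 0 + n [6,0] \<cdot> e 6)"
  "ad G (f 1) (V1 n) = - (n [1] \<cdot> coroot G 1 + n [2,1] \<cdot> e 2)"
  "ad G (f 5) (V1 n) = - (n [5] \<cdot> coroot G 5 + n [4,5] \<cdot> e 4)"
  "ad G (f 3) (V1 n) = - (n [3] \<cdot> coroot G 3 + n [2,3] \<cdot> e 2 + n [4,3] \<cdot> e 4 + n [6,3] \<cdot> e 6)"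
  by (auto simp: V1_explicit ad_add_right ad_diff_right ad_scale_right e_34 e_36 f_word_simps algebra_simps
     ad_antisym[of "e _" "coroot G _"] e_comm)

text \<open>Independence of the fourteen root vectors. Lowering to degree 0 exposes the coefficients
  of words with at most one raising letter; the four longer words are first shortened by f_2 and
  f_4.\<close>

lemma V1_eq_0:
  assumes "V1 n = 0" "w \<in> words"
  shows "n w = 0"
proof -
  have co: "coroot G j \<noteq> 0" if "j \<le> 6" for j
  proof
    assume "coroot G j = 0"
    then have "(\<Sum>i\<le>6. (if i = j then 1 else 0) \<cdot> coroot G i) + 0 \<cdot> scaling G = 0"
      by (auto intro!: sum.neutral)
    with cartan_independent[of "\<lambda>i. if i = j then 1 else 0" 0] that show False by auto
  qed
  have *: "m [0] = 0 \<and> m [6,0] = 0 \<and> m [1] = 0 \<and> m [2,1] = 0 \<and> m [5] = 0 \<and> m [4,5] = 0 \<and>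
      m [3] = 0 \<and> m [2,3] = 0 \<and> m [4,3] = 0 \<and> m [6,3] = 0" if m: "V1 m = 0" for m
  proof -
    \<comment> \<open>Pairing with f_k removes the coroot and isolates the coefficient of e_k;
      afterwards the coroot, being nonzero, gives the remaining coefficient.\<close>
    have "form G (f k) (m [j] \<cdot> coroot G j + x) = form G (f k) x" if "j \<le> 6" "k \<le> 6" for j k x
      using form_cartan[OF coroot_cartan[OF that(1)] that(2)] form_sym[of "f k" "coroot G j"]
      by (simp add: form_add form_scale)
    note fk = this[of 0 6] this[of 1 2] this[of 5 4] this[of 3 2] this[of 3 4] this[of 3 6]
    have 0: "m [0] \<cdot> coroot G 0 + m [6,0] \<cdot> e 6 = 0"
      and 1: "m [1] \<cdot> coroot G 1 + m [2,1] \<cdot> e 2 = 0"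
      and 5: "m [5] \<cdot> coroot G 5 + m [4,5] \<cdot> e 4 = 0"
      and 3: "m [3] \<cdot> coroot G 3 + (m [2,3] \<cdot> e 2 + (m [4,3] \<cdot> e 4 + m [6,3] \<cdot> e 6)) = 0"
      using f_V1_outer[of m, unfolded m ad_zero_right neg_0_equal_iff_equal add.assoc, symmetric] .
    have "m [6,0] = 0" "m [2,1] = 0" "m [4,5] = 0" "m [2,3] = 0" "m [4,3] = 0" "m [6,3] = 0"
      using fk(1)[of "m [6,0] \<cdot> e 6"] fk(2)[of "m [2,1] \<cdot> e 2"] fk(3)[of "m [4,5] \<cdot> e 4"]
        fk(4-6)[of "m [2,3] \<cdot> e 2 + (m [4,3] \<cdot> e 4 + m [6,3] \<cdot> e 6)"]
      unfolding 0 1 3 5 by (simp_all add: form_zero form_add form_scale form_f_e)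
    moreover from this have "m [0] = 0" "m [1] = 0" "m [5] = 0" "m [3] = 0"
      using 0 1 3 5 co by auto
    ultimately show ?thesis by simp
  qed
  \<comment> \<open>\<open>lower 2\<close> moves the coefficients at 234 and 236 to words covered by
    \<open>*\<close>, \<open>lower 4\<close> the one at 436, and both together the one at
    6234.\<close>
  have l: "V1 (lower 2 n) = 0" "V1 (lower 4 n) = 0" "V1 (lower 4 (lower 2 n)) = 0"
    using f_V1[of 2 n] f_V1[of 4 n] f_V1[of 4 "lower 2 n"] assms(1) by simp_all
  show ?thesis
    using assms(2) *[OF assms(1)] *[OF l(1)] *[OF l(2)] *[OF l(3)]
    by (auto simp: words_def lower_def)
qed

lemma V1_eqD: "V1 m = V1 n \<Longrightarrow> w \<in> words \<Longrightarrow> m w = n w"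
  using V1_eq_0[of "\<lambda>w. m w - n w" w] by (simp add: V1_diff)

definition Ve :: "(nat \<Rightarrow> complex) \<Rightarrow> 'g" where
  "Ve x = (\<Sum>i\<in>{2,4,6}. x i \<cdot> e i)"

lemma Ve_explicit: "Ve x = x 2 \<cdot> e 2 + (x 4 \<cdot> e 4 + x 6 \<cdot> e 6)"
  by (simp add: Ve_def)

lemma form_f_Ve: "i \<in> {2,4,6} \<Longrightarrow> form G (f i) (Ve x) = x i"
  by (auto simp: Ve_explicit form_add form_scale form_f_e)

lemma form_f_cartan: "h \<in> cartan_subalgebra G \<Longrightarrow> i \<le> 6 \<Longrightarrow> form G (f i) h = 0"
  using form_cartan form_sym by metis

lemma cartan_Ve:
  "h \<in> cartan_subalgebra G \<Longrightarrow> ad G h (Ve x) = Ve (\<lambda>i. form G h (coroot G i) * x i)"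
  by (simp add: Ve_explicit ad_add_right ad_scale_right cartan_e mult.commute)

lemma Ve_Ve: "ad G (Ve x) (Ve y) = 0"
  by (simp add: Ve_explicit ad_add_right ad_add_left ad_scale_right ad_scale_left ad_self
      e_comm(1) cartan_E6_def doubleton_eq_iff)

lemma Ve_V1: "ad G (Ve x) (V1 n) = V1 (\<lambda>w. x 2 * raise 2 n w + (x 4 * raise 4 n w + x 6 * raise 6 n w))"
  by (simp add: Ve_explicit ad_add_left ad_scale_left e_V1 V1_add V1_scale add_ac)

text \<open>Invariance makes ad h skew for the form, so eigenvalues of vectors that are not
  orthogonal must be opposite.\<close>

lemma form_eigenvectors:
  assumes "ad G h x = a \<cdot> x" "ad G h y = b \<cdot> y" "a + b \<noteq> 0"
  shows "form G x y = 0"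
proof -
  have "b * form G x y = form G (ad G x h) y"
    by (simp add: form_invariant assms(2) form_scale)
  also have "\<dots> = - a * form G x y"
    using ad_antisym[of x h] by (simp add: assms(1) functional_minus[OF functional_form_left] form_scale)
  finally have "(a + b) * form G x y = 0" by (simp add: algebra_simps)
  with assms(3) show ?thesis by simp
qed

text \<open>The grading by height: \<open>\<rho>\<close> is twelve times the scaling element plus half the sum of the
  positive coroots of \<open>E\<^sub>6\<close>.\<close>

definition \<rho> :: 'g where
  "\<rho> = 12 \<cdot> scaling G + (8 \<cdot> coroot G 1 + (15 \<cdot> coroot G 2 + (21 \<cdot> coroot G 3 + (15 \<cdot> coroot G 4
     + (8 \<cdot> coroot G 5 + 11 \<cdot> coroot G 6)))))"

lemma \<rho>_cartan: "\<rho> \<in> cartan_subalgebra G"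
  unfolding \<rho>_def
  by (intro vs.subspace_add[OF subspace_cartan] vs.subspace_scale[OF subspace_cartan]
      coroot_cartan scaling_cartan) auto

lemma \<rho>_e:
  assumes "i \<le> 6"
  shows "ad G \<rho> (e i) = e i"
proof -
  have "i \<in> {0,1,2,3,4,5,6}" using assms by auto
  then have "form G \<rho> (coroot G i) = 1"
    by (auto simp: \<rho>_def form_add form_scale form_coroot_coroot form_scaling_coroot cartan_E6_def doubleton_eq_iff)
  then show ?thesis by (simp add: cartan_e[OF \<rho>_cartan assms])
qed

text \<open>Heights add under brackets, so the span of eigenvectors of positive height is closed
  under the bracket, and it contains the generators.\<close>

lemma n_plus_height:
  assumes "y \<in> lie_generated G (e ` {..6})"
  shows "y \<in> vs.span {x. \<exists>n::nat. n \<ge> 1 \<and> ad G \<rho> x = of_nat n \<cdot> x}"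
proof -
  define S where "S = {x. \<exists>n::nat. n \<ge> 1 \<and> ad G \<rho> x = of_nat n \<cdot> x}"
  have S: "ad G x y \<in> S" if xy: "x \<in> S" "y \<in> S" for x y
  proof -
    obtain m n :: nat where "m \<ge> 1" "n \<ge> 1" "ad G \<rho> x = of_nat m \<cdot> x" "ad G \<rho> y = of_nat n \<cdot> y"
      using xy by (auto simp: S_def)
    then show ?thesis
      by (auto intro!: exI[of _ "m + n"]
          simp: S_def ad_ad[of \<rho>] ad_scale_left ad_scale_right vs.scale_left_distrib)
  qed
  have S1: "ad G x y \<in> vs.span S" if "x \<in> S" "y \<in> vs.span S" for x y
    using that(2) by (induction rule: vs.span_induct)
      (auto intro!: vs.subspaceI intro: vs.span_base S that(1) vs.span_add vs.span_scale vs.span_zero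
        simp: ad_add_right ad_scale_right)
  have S2: "ad G x y \<in> vs.span S" if "x \<in> vs.span S" "y \<in> vs.span S" for x y
    using that(1) by (induction rule: vs.span_induct)
      (auto intro!: vs.subspaceI intro: S1 that(2) vs.span_add vs.span_scale vs.span_zero
        simp: ad_add_left ad_scale_left)
  have "e i \<in> S" if "i \<le> 6" for i
    using that by (auto simp: S_def \<rho>_e intro!: exI[of _ "1::nat"])
  with assms show ?thesis
    unfolding S_def[symmetric]
    by induction (auto intro: S2 vs.span_base vs.span_add vs.span_scale vs.span_zero)
qed

text \<open>The vector e_i has height 1 and pairs nontrivially only with height -1, while the Borel
  subalgebra has nonnegative heights. The pairing will detect components along f_i.\<close>

lemma form_e_borel:
  assumes "i \<le> 6" "x \<in> borel_plus G"
  shows "form G (e i) x = 0"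
proof -
  obtain h y where x: "x = h + y" and h: "h \<in> cartan_subalgebra G" and y: "y \<in> lie_generated G (e ` {..6})"
    using assms(2) by (auto simp: borel_plus_def)
  have z: "form G (e i) z = 0" if "ad G \<rho> z = of_nat n \<cdot> z" "n \<ge> 1" for z and n :: nat
    by (rule form_eigenvectors[of \<rho> _ 1 _ "of_nat n"])
      (use \<rho>_e[OF assms(1)] that in \<open>auto simp flip: of_nat_Suc\<close>)
  from n_plus_height[OF y] have "form G (e i) y = 0"
    by (induction rule: vs.span_induct)
      (auto intro!: vs.subspaceI intro: z simp: form_add form_scale form_zero)
  then show ?thesis using form_cartan[OF h assms(1)] form_sym[of "e i" h] by (simp add: x form_add)
qed

end

locale affine_E6_theta = affine_E6 G for G :: "'g::ab_group_add km_data" (structure) +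
  fixes \<theta>
  assumes theta: "is_theta G \<theta>"
begin

lemma theta_cartan: "\<theta> \<in> cartan_subalgebra G"
  using theta by (simp add: is_theta_def)

lemma theta_coroot: "form G \<theta> (coroot G i) = (if i \<in> {2,4,6} then 0 else 1)" if "i \<le> 6"
proof -
  have "i \<in> {0,1,2,3,4,5,6}" using that by auto
  then show ?thesis using theta by (auto simp: is_theta_def)
qed

lemma theta_V1: "ad G \<theta> (V1 n) = V1 n"
  unfolding cartan_V1[OF theta_cartan]
  by (rule V1_cong) (auto simp: words_def theta_coroot)

lemma theta_Ve: "ad G \<theta> (Ve x) = 0"
  by (simp add: Ve_explicit ad_add_right ad_scale_right cartan_e[OF theta_cartan] theta_coroot)

lemma form_f_V1: "i \<in> {2,4,6} \<Longrightarrow> form G (f i) (V1 n) = 0"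
  by (rule form_eigenvectors[of \<theta> _ 0 _ 1]) (auto simp: theta_V1 cartan_f[OF theta_cartan] theta_coroot)

lemma form_e_V1: "i \<in> {2,4,6} \<Longrightarrow> form G (e i) (V1 n) = 0"
  by (rule form_eigenvectors[of \<theta> _ 0 _ 1]) (auto simp: theta_V1 cartan_e[OF theta_cartan] theta_coroot)

text \<open>Applying ad \<theta> once and twice gives enough equations to separate the eigenvalues
  0, 1 and 2.\<close>

lemma graded_eq_0:
  assumes "ad G \<theta> x0 = 0" "ad G \<theta> x1 = x1" "ad G \<theta> x2 = 2 \<cdot> x2" "x0 + x1 + x2 = 0"
  shows "x0 = 0" "x1 = 0" "x2 = 0"
proof -
  have 1: "x1 + 2 \<cdot> x2 = 0"
    using arg_cong[OF assms(4), of "ad G \<theta>"]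
    by (simp only: ad_add_right assms(1-3) ad_zero_right add_0)
  have "x1 + 2 \<cdot> (2 \<cdot> x2) = 0"
    using arg_cong[OF 1, of "ad G \<theta>"] by (simp only: ad_add_right ad_scale_right assms ad_zero_right)
  with 1 have "2 \<cdot> x2 = 2 \<cdot> (2 \<cdot> x2)" by (metis add_left_cancel)
  then have "(2 - 4 :: complex) \<cdot> x2 = 0"
    unfolding vs.scale_left_diff_distrib by simp
  then show "x2 = 0" by simp
  with 1 show "x1 = 0" by simp
  with \<open>x2 = 0\<close> assms(4) show "x0 = 0" by simp
qed

text \<open>The bracket has parts in degrees 0, 1 and 2 only. Since e_2, e_4, e_6 commute with each
  other and the Cartan subalgebra is abelian, degree 0 decouples into one scalar equation for each
  of the three indices.\<close>

lemma Lax_components: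
  assumes h: "h \<in> cartan_subalgebra G" and k: "k \<in> cartan_subalgebra G"
    and Lax: "Ve d + V1 b = ad G (h + Ve x + V1 n) (k + Ve m + V1 a)"
  shows "i \<in> {2,4,6} \<Longrightarrow> d i = form G h (coroot G i) * m i - form G k (coroot G i) * x i" (is "_ \<Longrightarrow> ?deg0")
    and "w \<in> words \<Longrightarrow> b w = (\<Sum>i\<leftarrow>w. form G h (coroot G i)) * a w - (\<Sum>i\<leftarrow>w. form G k (coroot G i)) * n w
           + (x 2 * raise 2 a w + (x 4 * raise 4 a w + x 6 * raise 6 a w))
           - (m 2 * raise 2 n w + (m 4 * raise 4 n w + m 6 * raise 6 n w))" (is "_ \<Longrightarrow> ?deg1")
    and "ad G (V1 n) (V1 a) = 0" (is ?deg2)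
proof -
  define y0 where "y0 = Ve (\<lambda>i. form G h (coroot G i) * m i - form G k (coroot G i) * x i)"
  define y1 where "y1 = (\<lambda>w. (\<Sum>i\<leftarrow>w. form G h (coroot G i)) * a w - (\<Sum>i\<leftarrow>w. form G k (coroot G i)) * n w
           + (x 2 * raise 2 a w + (x 4 * raise 4 a w + x 6 * raise 6 a w))
           - (m 2 * raise 2 n w + (m 4 * raise 4 n w + m 6 * raise 6 n w)))"
  have Vd: "Ve (\<lambda>i. u i - v i) = Ve u - Ve v" for u v
    by (simp add: Ve_explicit vs.scale_left_diff_distrib)
  have *: "ad G (Ve x) k = - Ve (\<lambda>i. form G k (coroot G i) * x i)"
    "ad G (V1 n) k = - V1 (\<lambda>w. (\<Sum>i\<leftarrow>w. form G k (coroot G i)) * n w)"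
    "ad G (V1 n) (Ve m) = - V1 (\<lambda>w. m 2 * raise 2 n w + (m 4 * raise 4 n w + m 6 * raise 6 n w))"
    using ad_antisym[of "Ve x" k] ad_antisym[of "V1 n" k] ad_antisym[of "V1 n" "Ve m"]
    by (simp_all add: cartan_Ve k cartan_V1 Ve_V1)
  have "ad G (h + Ve x + V1 n) (k + Ve m + V1 a) = y0 + V1 y1 + ad G (V1 n) (V1 a)"
    unfolding ad_add_left ad_add_right y0_def y1_def Vd V1_diff V1_add[of "\<lambda>w. _ w - _ w"] * cartan_Ve[OF h] cartan_V1[OF h] Ve_V1 Ve_Ve
      cartan_cartan[OF k h]
    by (simp add: algebra_simps V1_add)
  with Lax have sum0: "(y0 - Ve d) + V1 (\<lambda>w. y1 w - b w) + ad G (V1 n) (V1 a) = 0"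
    by (simp add: V1_diff algebra_simps)
  have y0: "y0 - Ve d = Ve (\<lambda>i. form G h (coroot G i) * m i - form G k (coroot G i) * x i - d i)"
    by (simp only: y0_def Vd)
  have "ad G \<theta> (ad G (V1 n) (V1 a)) = 2 \<cdot> ad G (V1 n) (V1 a)"
    using vs.scale_left_distrib[of 1 1 "ad G (V1 n) (V1 a)"] by (simp add: ad_ad[of \<theta>] theta_V1)
  note zero = graded_eq_0[OF _ _ this sum0, unfolded y0 theta_Ve theta_V1, OF refl refl]
  show ?deg2 by (rule zero(3))
  show ?deg1 if "w \<in> words"
    using V1_eq_0[OF zero(2) that] by (simp add: y1_def)
  show ?deg0 if "i \<in> {2,4,6}"
    using form_f_Ve[OF that, of "\<lambda>i. form G h (coroot G i) * m i - form G k (coroot G i) * x i - d i"]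
    by (simp add: zero(1) form_zero)
qed

text \<open>The hypothesis lives in degree 2. Applying ad f_j turns it into [[f_j, N], A] =
  [[f_j, A], N], where the inner brackets have degree 0 and are known explicitly, so both sides have
  degree 1 and can be compared at each word.\<close>

lemma V1_commute:
  assumes "ad G (V1 n) (V1 a) = 0" "w \<in> words"
  defines "c \<equiv> \<lambda>j. \<Sum>i\<leftarrow>w. complex_of_int (cartan_E6 j i)"
  shows "n [0] * (c 0 * a w) + n [6,0] * raise 6 a w = a [0] * (c 0 * n w) + a [6,0] * raise 6 n w"
    and "n [1] * (c 1 * a w) + n [2,1] * raise 2 a w = a [1] * (c 1 * n w) + a [2,1] * raise 2 n w"
    and "n [5] * (c 5 * a w) + n [4,5] * raise 4 a w = a [5] * (c 5 * n w) + a [4,5] * raise 4 n w"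
    and "n [3] * (c 3 * a w) + (n [2,3] * raise 2 a w + (n [4,3] * raise 4 a w + n [6,3] * raise 6 a w))
       = a [3] * (c 3 * n w) + (a [2,3] * raise 2 n w + (a [4,3] * raise 4 n w + a [6,3] * raise 6 n w))"
proof -
  have "set w \<subseteq> {..6}" using assms(2) by (auto simp: words_def)
  then have c: "(\<Sum>i\<leftarrow>w. form G (coroot G j) (coroot G i)) = c j" if "j \<le> 6" for j
    using that unfolding c_def by (intro arg_cong[of _ _ sum_list] map_cong) (auto simp: form_coroot_coroot)
  have f: "ad G (- ad G (f j) (V1 n)) (V1 a) = ad G (- ad G (f j) (V1 a)) (V1 n)" for j
    using ad_antisym[of "V1 n" "ad G (f j) (V1 a)"] ad_ad[of "f j" "V1 n" "V1 a"]
    by (simp add: assms(1) ad_minus_left eq_neg_iff_add_eq_0) (metis add.commute add_left_cancel)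
  have "V1 (\<lambda>w. n [0] * ((\<Sum>i\<leftarrow>w. form G (coroot G 0) (coroot G i)) * a w) + n [6,0] * raise 6 a w)
      = V1 (\<lambda>w. a [0] * ((\<Sum>i\<leftarrow>w. form G (coroot G 0) (coroot G i)) * n w) + a [6,0] * raise 6 n w)"
    using f[of 0] by (simp add: f_V1_outer ad_add_left ad_scale_left
      cartan_V1[OF coroot_cartan] e_V1 V1_add V1_scale add_ac)
  from V1_eqD[OF this assms(2)]
  show "n [0] * (c 0 * a w) + n [6,0] * raise 6 a w = a [0] * (c 0 * n w) + a [6,0] * raise 6 n w"
    by (simp add: c)
  have "V1 (\<lambda>w. n [1] * ((\<Sum>i\<leftarrow>w. form G (coroot G 1) (coroot G i)) * a w) + n [2,1] * raise 2 a w)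
      = V1 (\<lambda>w. a [1] * ((\<Sum>i\<leftarrow>w. form G (coroot G 1) (coroot G i)) * n w) + a [2,1] * raise 2 n w)"
    using f[of 1] by (simp add: f_V1_outer ad_add_left ad_scale_left
      cartan_V1[OF coroot_cartan] e_V1 V1_add V1_scale add_ac)
  from V1_eqD[OF this assms(2)]
  show "n [1] * (c 1 * a w) + n [2,1] * raise 2 a w = a [1] * (c 1 * n w) + a [2,1] * raise 2 n w"
    by (simp add: c)
  have "V1 (\<lambda>w. n [5] * ((\<Sum>i\<leftarrow>w. form G (coroot G 5) (coroot G i)) * a w) + n [4,5] * raise 4 a w)
      = V1 (\<lambda>w. a [5] * ((\<Sum>i\<leftarrow>w. form G (coroot G 5) (coroot G i)) * n w) + a [4,5] * raise 4 n w)"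
    using f[of 5] by (simp add: f_V1_outer ad_add_left ad_scale_left
      cartan_V1[OF coroot_cartan] e_V1 V1_add V1_scale add_ac)
  from V1_eqD[OF this assms(2)]
  show "n [5] * (c 5 * a w) + n [4,5] * raise 4 a w = a [5] * (c 5 * n w) + a [4,5] * raise 4 n w"
    by (simp add: c)
  have "V1 (\<lambda>w. n [3] * ((\<Sum>i\<leftarrow>w. form G (coroot G 3) (coroot G i)) * a w)
          + (n [2,3] * raise 2 a w + (n [4,3] * raise 4 a w + n [6,3] * raise 6 a w)))
      = V1 (\<lambda>w. a [3] * ((\<Sum>i\<leftarrow>w. form G (coroot G 3) (coroot G i)) * n w)
          + (a [2,3] * raise 2 n w + (a [4,3] * raise 4 n w + a [6,3] * raise 6 n w)))"
    using f[of 3, unfolded f_V1_outer minus_minus] by (simp add: ad_add_left ad_scale_left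
      cartan_V1[OF coroot_cartan] e_V1 V1_add V1_scale add_ac)
  from V1_eqD[OF this assms(2)]
  show "n [3] * (c 3 * a w) + (n [2,3] * raise 2 a w + (n [4,3] * raise 4 a w + n [6,3] * raise 6 a w))
       = a [3] * (c 3 * n w) + (a [2,3] * raise 2 n w + (a [4,3] * raise 4 n w + a [6,3] * raise 6 n w))"
    by (simp add: c)
qed

end

section \<open>The system in coordinates\<close>

text \<open>Here \<open>n\<close> is \<open>N\<close>, and \<open>a\<close>, \<open>b\<close>, \<open>g\<close> are the coefficients of \<open>M\<^sup>+\<close> that are not constant: \<open>a\<^sub>i\<close> at \<open>e\<^sub>i\<close>,
  \<open>b\<^sub>2\<close> at \<open>e\<^sub>4\<^sub>3\<close>, \<open>b\<^sub>4\<close> at \<open>e\<^sub>2\<^sub>3\<close>, \<open>g\<close> at \<open>e\<^sub>6\<^sub>3\<close>. The values \<open>H i\<close> are \<open>(h|\<alpha>\<^sub>i\<^sup>\<or>)\<close>, the prefix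
  \<open>d\<close> stands for \<open>s(s - 1) d/ds\<close>, and \<open>n\<^sub>6\<^sub>0 = 0\<close> after subtraction of a multiple of \<open>M\<^sup>+\<close>.\<close>

locale Lax_coefficients =
  fixes s g u1 u5 v q1 q2 q3 p1 p2 p3 :: complex and al :: "nat \<Rightarrow> complex"
    and a0 a1 a3 a5 b2 b4 m2 m4 m6 :: complex
    and n0 n1 n21 n5 n45 n3 n23 n43 n63 n234 n236 n436 n6234 :: complex
    and H :: "nat \<Rightarrow> complex" and X2 X4 X6 :: complex
    and d0 d1 d3 d5 db2 db4 dg dm2 dm4 dm6 :: complex
  assumes s: "s \<noteq> 0" "s \<noteq> 1" and q3: "q3 \<noteq> 0"
    and s1: "g * v = 6 * s" and s2: "g * u1 * u5 = 6"
    and sum_al: "al 0 + al 1 + 2 * al 2 + 3 * al 3 + 2 * al 4 + al 5 + 2 * al 6 = 1"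
    and u1: "a1 + b2 = u1" and u5: "a5 + b4 = u5"
    and qp: "b2 = q1 * u1" "b4 = q2 * u5" "(v + g * a0) * q3 = v" "a3 + b2 * b4 = v + g * a0"
      "u1 * m2 = - 6 * p1" "u5 * m4 = - 6 * p2"
      "(v + g * a0) * ((v + g * a0) * m6 + g * (6 * al 6)) = - (6 * g * v) * p3"
    and deg2: "a0 * n63 = g * n0 + n3" "a0 * n236 + n23 = 0" "a0 * n436 + n43 = 0" "n234 = a0 * n6234"
      "b4 * n1 + n3 = a1 * n23 + a3 * n21" "n1 = a1 * n234 - b2 * n21 + n43"
      "a1 * n236 + n63 = g * n21" "n5 = a5 * n234 - b4 * n45 + n23" "a5 * n436 + n63 = g * n45"
      "n63 = b2 * n236 + b4 * n436 + g * n234 - a3 * n6234"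
      "n236 = a5 * n6234" "n436 = a1 * n6234"
    and deg1:
      "d0 = a0 * H 0 - 6 * al 0 * n0" "d1 = a1 * H 1 - 6 * al 1 * n1"
      "d3 = a3 * H 3 - 6 * al 3 * n3" "d5 = a5 * H 5 - 6 * al 5 * n5"
      "0 = a1 * X2 - 6 * (al 1 + al 2) * n21 - m2 * n1 + H 1 + H 2"
      "0 = a5 * X4 - 6 * (al 4 + al 5) * n45 - m4 * n5 + H 4 + H 5"
      "0 = a0 * X6 - m6 * n0 + H 0 + H 6"
      "db4 = a3 * X2 + b4 * (H 2 + H 3) - 6 * (al 2 + al 3) * n23 - m2 * n3"
      "db2 = a3 * X4 + b2 * (H 3 + H 4) - 6 * (al 3 + al 4) * n43 - m4 * n3"
      "dg = a3 * X6 + g * (H 3 + H 6) - 6 * (al 3 + al 6) * n63 - m6 * n3"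
      "0 = - b2 * X2 - b4 * X4 - 6 * (al 2 + al 3 + al 4) * n234 + m2 * n43 + m4 * n23 + H 2 + H 3 + H 4"
      "0 = - b4 * X6 - g * X2 - 6 * (al 2 + al 3 + al 6) * n236 + m2 * n63 + m6 * n23"
      "0 = - b2 * X6 - g * X4 - 6 * (al 3 + al 4 + al 6) * n436 + m4 * n63 + m6 * n43"
      "X6 = 6 * (al 2 + al 3 + al 4 + al 6) * n6234 + m2 * n436 + m4 * n236 + m6 * n234"
    and deg0: "dm2 = H 2 * m2 - 6 * al 2 * X2" "dm4 = H 4 * m4 - 6 * al 4 * X4"
      "dm6 = H 6 * m6 - 6 * al 6 * X6"
    and ds2: "dg * u1 * u5 + g * (d1 + db2) * u5 + g * u1 * (d5 + db4) = 0"
    and ds1: "dg * v + g * (d3 + db2 * b4 + b2 * db4 - dg * a0 - g * d0) = 6 * (s * (s - 1))"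
begin

lemma nonzero: "g \<noteq> 0" "u1 \<noteq> 0" "u5 \<noteq> 0" "v \<noteq> 0"
  using s1 s2 s(1) by auto

text \<open>\<open>om\<close> is the factor of \<open>N\<close> that the Lax equation leaves open; it turns out to be 1. The inverses
  have names because the identities below are polynomial modulo \<open>inv\<close>.\<close>

definition "r = 1 / q3"
definition "gi = 1 / g"
definition "ui = 1 / u1"
definition "si = 1 / s"
definition "om = 36 * n6234 * gi\<^sup>2"

lemma inv: "g * gi = 1" "u1 * ui = 1" "q3 * r = 1" "s * si = 1"
  using nonzero q3 s by (simp_all add: r_def gi_def ui_def si_def)

text \<open>The relations s_1 = s and s_2 = 1 eliminate \<open>v\<close> and \<open>u5\<close>. What
  remains besides the canonical variables are \<open>g\<close> and \<open>u1\<close>, coordinates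
  along the torus that have to drop out in the end.\<close>

lemma normal_form:
  "u5 = 6 * gi * ui" "v = 6 * s * gi" "b2 = q1 * u1" "a1 = (1 - q1) * u1"
  "b4 = 6 * q2 * gi * ui" "a5 = 6 * (1 - q2) * gi * ui" "a0 = 6 * s * (r - 1) * gi\<^sup>2"
  "a3 = 6 * (s * r - q1 * q2) * gi" "m2 = - 6 * p1 * ui" "m4 = - (p2 * g * u1)"
  "m6 = - (g\<^sup>2 * q3 * (q3 * p3 + al 6) * si)" "n6234 = g\<^sup>2 * om / 36"
proof -
  show u5': "u5 = 6 * gi * ui" using s2 nonzero by (simp add: gi_def ui_def field_simps)
  show v': "v = 6 * s * gi" using s1 inv(1) by algebra
  show "b2 = q1 * u1" by (rule qp)
  show "a1 = (1 - q1) * u1" using u1 qp(1) by (simp add: algebra_simps)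
  show b4': "b4 = 6 * q2 * gi * ui" using qp(2) u5' by simp
  show "a5 = 6 * (1 - q2) * gi * ui" using u5 unfolding b4' u5' by (simp add: algebra_simps)
  have D: "v + g * a0 = v * r" using qp(3) q3 by (simp add: r_def field_simps)
  then show "a0 = 6 * s * (r - 1) * gi\<^sup>2" using nonzero v' by (simp add: gi_def field_simps power2_eq_square)
  show "a3 = 6 * (s * r - q1 * q2) * gi" using qp(4) D nonzero by (simp add: v' b4' qp(1) gi_def ui_def field_simps)
  show "m2 = - 6 * p1 * ui" using qp(5) nonzero by (simp add: ui_def field_simps)
  have "g * u1 * u5 * m4 = - 6 * p2 * g * u1" using qp(6) by algebra
  then show "m4 = - (p2 * g * u1)" unfolding s2 by simp
  have "v * r * (v * r * m6 + g * (6 * al 6)) = - (6 * g * v) * p3" using qp(7) unfolding D .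
  moreover have "v = 6 * s / g" using v' by (simp add: gi_def)
  ultimately have "m6 = - (g\<^sup>2 * q3 * (q3 * p3 + al 6) / s)"
    using nonzero s q3 by (simp add: r_def field_simps power2_eq_square) algebra
  then show "m6 = - (g\<^sup>2 * q3 * (q3 * p3 + al 6) * si)"
    by (simp add: si_def)
  show "n6234 = g\<^sup>2 * om / 36" using inv(1) unfolding om_def by algebra
qed

text \<open>Twelve linear equations for thirteen unknowns, solved downwards from the longest word
  6234: each value follows from earlier ones, with divisions by \<open>g\<close> only.\<close>

lemma n_values:
  "n21 = (1 - s) * om / 6" "n45 = (1 - s) * om / 6"
  "n236 = (1 - q2) * g * ui * om / 6" "n436 = (1 - q1) * u1 * g\<^sup>2 * om / 36"
  "n234 = s * (r - 1) * om / 6" "n23 = - (s * (r - 1) * (1 - q2) * om * gi * ui)"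
  "n43 = - (s * (r - 1) * (1 - q1) * u1 * om / 6)"
  "n63 = g * om / 6 * ((1 - s) - (1 - q1) * (1 - q2))"
  "n1 = - (q1 * u1 * (1 - s) * om / 6)" "n5 = - (q2 * (1 - s) * om * gi * ui)"
  "n3 = s * om * gi * ((1 - s) * r - (r - 1) * (1 - q1) * (1 - q2))" "n0 = - (s * (1 - s) * om * gi\<^sup>2)"
proof -
  note nf = normal_form(3-8)
  show n236: "n236 = (1 - q2) * g * ui * om / 6"
    unfolding deg2(11) nf using normal_form(12) inv(1) by algebra
  show n436: "n436 = (1 - q1) * u1 * g\<^sup>2 * om / 36"
    unfolding deg2(12) nf using normal_form(12) inv(1) by algebra
  show n234: "n234 = s * (r - 1) * om / 6"
    unfolding deg2(4) nf using normal_form(12) inv(1) by algebra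
  have "n23 = - (a0 * n236)" "n43 = - (a0 * n436)"
    using deg2(2,3) by algebra+
  note n23' = this(1) and n43' = this(2)
  show n23: "n23 = - (s * (r - 1) * (1 - q2) * om * gi * ui)"
    unfolding n23' nf n236 using inv(1) by algebra
  show n43: "n43 = - (s * (r - 1) * (1 - q1) * u1 * om / 6)"
    unfolding n43' nf n436 using inv(1) by algebra
  show n63: "n63 = g * om / 6 * ((1 - s) - (1 - q1) * (1 - q2))"
    unfolding deg2(10) nf n236 n436 n234 using normal_form(12) inv(1,2) by algebra
  have "g * n21 = g * ((1 - s) * om / 6)"
    unfolding deg2(7)[symmetric] nf n236 n63 using inv(1,2) by algebra
  then show n21: "n21 = (1 - s) * om / 6" using nonzero(1) by (metis mult_left_cancel)
  have "g * n45 = g * ((1 - s) * om / 6)"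
    unfolding deg2(9)[symmetric] nf n436 n63 using inv(1,2) by algebra
  then show n45: "n45 = (1 - s) * om / 6" using nonzero(1) by (metis mult_left_cancel)
  show n1: "n1 = - (q1 * u1 * (1 - s) * om / 6)"
    unfolding deg2(6) nf n21 n234 n43 by (simp add: field_simps)
  show "n5 = - (q2 * (1 - s) * om * gi * ui)"
    unfolding deg2(8) nf n45 n234 n23 by (simp add: field_simps)
  have n3': "n3 = a1 * n23 + a3 * n21 - b4 * n1"
    using deg2(5) by algebra
  show n3: "n3 = s * om * gi * ((1 - s) * r - (r - 1) * (1 - q1) * (1 - q2))"
    unfolding n3' nf n21 n23 n1 using inv(1,2) by algebra
  have "g * n0 = g * - (s * (1 - s) * om * gi\<^sup>2)"
    using deg2(1) unfolding nf n3 n63 using inv(1,2) by algebra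
  then show "n0 = - (s * (1 - s) * om * gi\<^sup>2)"
    using nonzero(1) by (metis mult_left_cancel)
qed

text \<open>\<open>P1\<close>, \<open>P2\<close>, \<open>P3\<close> are the factors that occur in
  the coupling terms of the Hamiltonian.\<close>

definition "P1 = (q1 - 1) * p1 + al 2"
definition "P2 = (q2 - 1) * p2 + al 4"
definition "P3 = (q3 - 1) * p3 + al 6"
definition "R3 = q3 * P3"
text \<open>From here to \<open>F2\<close>: the values of \<open>X2\<close>, \<open>X4\<close>,
  \<open>H 1\<close>, \<open>H 5\<close>, \<open>H 3\<close> and of the derivatives of
  \<open>b2\<close>, \<open>b4\<close>, \<open>u1\<close>, \<open>u5\<close>, stripped of the factor
  \<open>om\<close>, of the torus weights and of the terms in \<open>H 2\<close> and
  \<open>H 4\<close>.\<close>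

definition "Y2 = P1 + al 3 + R3 + q2 * P2 + (1 - s) * p1"
definition "Y4 = P2 + al 3 + R3 + q1 * P1 + (1 - s) * p2"
definition "A1 = (1 - q1) * Y2 + (1 - s) * (al 1 + al 2 + p1 * q1)"
definition "A5 = (1 - q2) * Y4 + (1 - s) * (al 5 + al 4 + p2 * q2)"
definition "A3 = s * (r - 1) * (P1 + P2 + al 3) - q1 * Y2 - q2 * Y4"
definition "G1 = - (q1\<^sup>2 * Y2) - s * (q1 * P1 + P2 + P3 + al 3)"
definition "G2 = - (q2\<^sup>2 * Y4) - s * (q2 * P2 + P1 + P3 + al 3)"
definition "F1 = G1 + (1 - q1) * A1 + al 1 * q1 * (1 - s)"
definition "F2 = G2 + (1 - q2) * A5 + al 5 * q2 * (1 - s)"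

text \<open>The words 236, 436 and 6234 do not occur in M^+, so the Lax equation is purely algebraic
  there.\<close>

lemma X_values:
  "X6 = g\<^sup>2 / 6 * om * (P1 + P2 + R3 + al 3)" "X2 = - (om * ui * Y2)" "X4 = - (om * g * u1 / 6 * Y4)"
proof -
  note nf = normal_form(3-11) and R = R3_def P1_def P2_def P3_def
  show X6: "X6 = g\<^sup>2 / 6 * om * (P1 + P2 + R3 + al 3)"
    unfolding deg1(14) nf n_values R using normal_form(12) inv by algebra
  have "g * X2 = - b4 * X6 - 6 * (al 2 + al 3 + al 6) * n236 + m2 * n63 + m6 * n23"
    using deg1(12) by algebra
  also have "\<dots> = g * - (om * ui * Y2)"
    unfolding Y2_def nf X6 n_values R using inv by algebra
  finally show "X2 = - (om * ui * Y2)" using nonzero(1) by (metis mult_left_cancel)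
  have "g * X4 = - b2 * X6 - 6 * (al 3 + al 4 + al 6) * n436 + m4 * n63 + m6 * n43"
    using deg1(13) by algebra
  also have "\<dots> = g * - (om * g * u1 / 6 * Y4)"
    unfolding Y4_def nf X6 n_values R using inv by algebra
  finally show "X4 = - (om * g * u1 / 6 * Y4)" using nonzero(1) by (metis mult_left_cancel)
qed

text \<open>The coefficients of M^+ at e_21, e_45 and e_234 are constantly 1, so the equations at
  these words contain no derivative.\<close>

lemma H_values:
  "H 1 = - H 2 + om * A1" "H 5 = - H 4 + om * A5" "H 3 = - H 2 - H 4 + om * A3"
proof -
  note nf = normal_form(3-11) and R = R3_def P1_def P2_def P3_def
  have "H 1 + H 2 = - (a1 * X2 - 6 * (al 1 + al 2) * n21 - m2 * n1)"
    using deg1(5) by algebra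
  also have "\<dots> = om * A1"
    unfolding A1_def nf X_values n_values using inv by algebra
  finally show "H 1 = - H 2 + om * A1" by algebra
  have "H 5 + H 4 = - (a5 * X4 - 6 * (al 4 + al 5) * n45 - m4 * n5)"
    using deg1(6) by algebra
  also have "\<dots> = om * A5"
    unfolding A5_def nf X_values n_values using inv by algebra
  finally show "H 5 = - H 4 + om * A5" by algebra
  have "H 3 + H 2 + H 4 = b2 * X2 + b4 * X4 + 6 * (al 2 + al 3 + al 4) * n234 - m2 * n43 - m4 * n23"
    using deg1(11) by algebra
  also have "\<dots> = om * A3"
    unfolding A3_def nf X_values n_values R using inv by algebra
  finally show "H 3 = - H 2 - H 4 + om * A3" by algebra
qed

lemma G_values:
  "db2 = u1 * (om * G1 - q1 * H 2)" "d1 + db2 = u1 * (om * F1 - H 2)"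
  "db4 = u5 * (om * G2 - q2 * H 4)" "d5 + db4 = u5 * (om * F2 - H 4)"
proof -
  note nf = normal_form(1,3-11) and R = R3_def P1_def P2_def P3_def
  show b2: "db2 = u1 * (om * G1 - q1 * H 2)"
    unfolding deg1(9) G1_def A3_def Y2_def Y4_def H_values nf X_values n_values R using inv by algebra
  have "d1 = u1 * (om * ((1 - q1) * A1 + al 1 * q1 * (1 - s)) - (1 - q1) * H 2)"
    unfolding deg1(2) H_values nf n_values by algebra
  then show "d1 + db2 = u1 * (om * F1 - H 2)"
    unfolding b2 F1_def by algebra
  show b4: "db4 = u5 * (om * G2 - q2 * H 4)"
    unfolding deg1(8) G2_def A3_def Y2_def Y4_def H_values nf X_values n_values R using inv by algebra
  have "d5 = u5 * (om * ((1 - q2) * A5 + al 5 * q2 * (1 - s)) - (1 - q2) * H 4)"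
    unfolding deg1(4) H_values nf n_values by algebra
  then show "d5 + db4 = u5 * (om * F2 - H 4)"
    unfolding b4 F2_def by algebra
qed

definition "Q = (1 - q1) * (1 - q2)"
definition "S = P1 + P2 + R3 + al 3"
definition "A6 = - (F1 + F2) - A3 - (s * r - q1 * q2) * S + (al 3 + al 6) * ((1 - s) - Q)
  - (q3 * p3 + al 6) * ((1 - s) - (1 - q3) * Q)"
definition "A0 = A6 + s * (r - 1) * S - q3 * (q3 * p3 + al 6) * (1 - s)"
text \<open>With D = v + g a_0 one has g D = 6 s / q_3. This is invariant under the torus, and
  \<open>om * T\<close> is s(s - 1) times the derivative of s / q_3.\<close>

definition "T = (s * r - q1 * q2) * A3 - al 3 * s * ((1 - s) * r - (r - 1) * Q) + G1 * q2 + q1 * G2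
  - s * r * (F1 + F2)"

text \<open>As g u_1 u_5 = 6 is constant, the logarithmic derivatives of the three factors add up to
  0.\<close>

lemma dg_value: "dg = g * (H 2 + H 4 - om * (F1 + F2))"
proof -
  have "dg * u1 * u5 + g * (u1 * (om * F1 - H 2)) * u5 + g * u1 * (u5 * (om * F2 - H 4)) = 0"
    using ds2 unfolding G_values(2,4) .
  then have "(u1 * u5) * dg = (u1 * u5) * (g * (H 2 + H 4 - om * (F1 + F2)))"
    by algebra
  then show ?thesis using nonzero by (simp add: mult.assoc)
qed

text \<open>With \<open>dg\<close> known, the equation at e_63 yields \<open>H 6\<close>, and the
  constant coefficient 1 at e_60 then yields \<open>H 0\<close>.\<close>

lemma H_values_outer: "H 6 = 2 * (H 2 + H 4) + om * A6" "H 0 = - 2 * (H 2 + H 4) - om * A0"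
proof -
  note nf = normal_form(3-11)
  have "g * H 6 = dg - a3 * X6 - g * H 3 + 6 * (al 3 + al 6) * n63 + m6 * n3"
    using deg1(10) by algebra
  also have "\<dots> = g * (2 * (H 2 + H 4) + om * A6)"
  proof -
    have "m6 * n3 = - (g * (q3 * p3 + al 6) * om * ((1 - s) - (1 - q3) * Q))"
      unfolding nf n_values Q_def using inv(1,3,4) by algebra
    moreover have "a3 * X6 = g * om * (s * r - q1 * q2) * S"
      unfolding nf X_values S_def using inv(1) by algebra
    ultimately show ?thesis
      unfolding dg_value H_values n_values A6_def Q_def by algebra
  qed
  finally show H6: "H 6 = 2 * (H 2 + H 4) + om * A6"
    using nonzero(1) by (metis mult_left_cancel)
  have "H 0 = - H 6 - a0 * X6 + m6 * n0" using deg1(7) by algebra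
  moreover have "m6 * n0 = om * q3 * (q3 * p3 + al 6) * (1 - s)"
    unfolding nf n_values using inv(1,4) by algebra
  moreover have "a0 * X6 = om * s * (r - 1) * S"
    unfolding nf X_values S_def using inv(1) by algebra
  ultimately show "H 0 = - 2 * (H 2 + H 4) - om * A0"
    unfolding H6 A0_def by algebra
qed

text \<open>Multiplied by \<open>om\<close>, the left side is s(s - 1) times the derivative of s_1 =
  g v / 6 as the Lax equation computes it. The level relation \<open>sum_al\<close> is what makes it
  collapse.\<close>

lemma T_identity:
  "T - s * (r - 1) * (- 2 * (F1 + F2) - A0) - al 0 * s * (1 - s) = s * (s - 1)"
proof -
  have al: "al 0 = 1 - al 1 - 2 * al 2 - 3 * al 3 - 2 * al 4 - al 5 - 2 * al 6"
    using sum_al by algebra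
  show ?thesis
    unfolding T_def A0_def A6_def F1_def F2_def G1_def G2_def A1_def A5_def A3_def Y2_def Y4_def
      S_def Q_def R3_def P1_def P2_def P3_def al
    using inv(3) by algebra
qed

definition "D = 6 * s * r * gi"

lemma D_value: "v + g * a0 = D"
  unfolding D_def normal_form(2,7) using inv(1) by algebra

lemma dD_value: "dg * D + g * (d3 + db2 * b4 + b2 * db4) = 6 * om * T"
  unfolding D_def deg1(3) G_values dg_value H_values normal_form(1,3-8) n_values T_def Q_def
  using inv(1,2) by algebra

text \<open>The derivative of s_1 along the flow comes out as \<open>om\<close>, but s_1 is the
  independent variable.\<close>

lemma om: "om = 1"
proof -
  define dD where "dD = d3 + db2 * b4 + b2 * db4"
  have v: "v = D - g * a0" by (simp flip: D_value)
  have "g * a0 = 6 * s * (r - 1) * gi" unfolding normal_form(7) using inv(1) by algebra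
  moreover have "g\<^sup>2 * d0 = 6 * s * (r - 1) * (- 2 * (H 2 + H 4) - om * A0) + 6 * al 0 * s * (1 - s) * om"
    unfolding deg1(1) H_values_outer normal_form(7) n_values using inv(1) by algebra
  ultimately have "dg * (D - g * a0) + g * (dD - dg * a0 - g * d0) =
      6 * om * T - 6 * om * (s * (r - 1) * (- 2 * (F1 + F2) - A0) + al 0 * s * (1 - s))"
    using dD_value inv(1) unfolding dg_value dD_def[symmetric] by algebra
  also have "\<dots> = 6 * om * (s * (s - 1))"
    unfolding T_identity[symmetric] by algebra
  finally have "6 * om * (s * (s - 1)) = 6 * (s * (s - 1))"
    using ds1 unfolding v dD_def by algebra
  then show ?thesis using s by simp
qed

text \<open>The left side is the numerator of the quotient rule for q_1 = b_2 / u_1, as d_1 + db_2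
  is the derivative of u_1. The terms in \<open>H 2\<close> cancel and leave G_1 - q_1 F_1.\<close>

lemma flow_q1: "db2 * u1 - b2 * (d1 + db2) = u1\<^sup>2 *
    (2 * q1 * (q1 - 1) * (q1 - s) * p1 + (al 1 + 2 * al 2 + 2 * al 3) * q1 * (q1 - 1)
     - al 1 * q1 * (q1 - s) - al 3 * (q1 - 1) * (q1 - s)
     + (q1 - 1) * (P2 * (q1 * q2 + s) + P3 * (q1 * q3 + s)))"
proof -
  have "db2 * u1 - b2 * (d1 + db2) = u1\<^sup>2 * (G1 - q1 * F1)"
    unfolding G_values(2) unfolding G_values(1) normal_form(3) om by algebra
  then show ?thesis
    unfolding F1_def G1_def A1_def Y2_def R3_def P1_def by algebra
qed

lemma flow_p1: "(d1 + db2) * m2 + u1 * dm2 = 6 *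
    (p1\<^sup>2 * ((2 * q1 - 1) * (q1 - s) + q1 * (q1 - 1))
     + ((al 1 + 2 * al 2 + 2 * al 3) * (2 * q1 - 1) - al 1 * (2 * q1 - s) - al 3 * (2 * q1 - 1 - s)) * p1
     + al 2 * (al 3 + al 2) + p1 * (P2 * (q1 * q2 + s) + P3 * (q1 * q3 + s)) + P1 * (P2 * q2 + P3 * q3))"
proof -
  have "(d1 + db2) * m2 + u1 * dm2 = 6 * (al 2 * Y2 - p1 * F1)"
    unfolding G_values(2) deg0(1) normal_form(9) X_values om using inv(2) by algebra
  then show ?thesis
    unfolding F1_def G1_def A1_def Y2_def R3_def P1_def by algebra
qed

lemma flow_q2: "db4 * u5 - b4 * (d5 + db4) = u5\<^sup>2 *
    (2 * q2 * (q2 - 1) * (q2 - s) * p2 + (al 5 + 2 * al 4 + 2 * al 3) * q2 * (q2 - 1)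
     - al 5 * q2 * (q2 - s) - al 3 * (q2 - 1) * (q2 - s)
     + (q2 - 1) * (P1 * (q1 * q2 + s) + P3 * (q2 * q3 + s)))"
proof -
  have "db4 * u5 - b4 * (d5 + db4) = u5\<^sup>2 * (G2 - q2 * F2)"
    unfolding G_values(4) unfolding G_values(3) qp(2) om by algebra
  then show ?thesis
    unfolding F2_def G2_def A5_def Y4_def R3_def P2_def by algebra
qed

lemma flow_p2: "(d5 + db4) * m4 + u5 * dm4 = 6 *
    (p2\<^sup>2 * ((2 * q2 - 1) * (q2 - s) + q2 * (q2 - 1))
     + ((al 5 + 2 * al 4 + 2 * al 3) * (2 * q2 - 1) - al 5 * (2 * q2 - s) - al 3 * (2 * q2 - 1 - s)) * p2
     + al 4 * (al 3 + al 4) + p2 * (P1 * (q1 * q2 + s) + P3 * (q2 * q3 + s)) + P2 * (P1 * q1 + P3 * q3))"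
proof -
  have "(d5 + db4) * m4 + u5 * dm4 = 6 * (al 4 * Y4 - p2 * F2)"
    unfolding G_values(4) deg0(2) normal_form(1,10) X_values om using inv(1,2) by algebra
  then show ?thesis
    unfolding F2_def G2_def A5_def Y4_def R3_def P2_def by algebra
qed

lemma flow_q3:
  "(d3 + db2 * b4 + b2 * db4 - dg * a0 - g * d0) * (v + g * a0) - v * (d3 + db2 * b4 + b2 * db4)
    = (v + g * a0)\<^sup>2 *
    (2 * q3 * (q3 - 1) * (q3 - s) * p3 + (al 0 + 2 * al 6 + 2 * al 3) * q3 * (q3 - 1)
     - al 0 * q3 * (q3 - s) - al 3 * (q3 - 1) * (q3 - s)
     + (q3 - 1) * (P1 * (q1 * q3 + s) + P2 * (q2 * q3 + s)))" (is "_ = _ * ?h")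
proof -
  \<comment> \<open>The quotient rule for q_3 = s / (s r), in which the denominator has derivative
    \<open>T\<close> up to the factor s(s - 1).\<close>
  have h: "((s - 1) * q3 * s - T * q3\<^sup>2) = s * ?h"
    unfolding T_def F1_def F2_def G1_def G2_def A1_def A5_def A3_def Y2_def Y4_def
      S_def Q_def R3_def P1_def P2_def P3_def
    using inv(3) sum_al by algebra
  define dD where "dD = d3 + db2 * b4 + b2 * db4"
  define dv where "dv = dD - dg * a0 - g * d0"
  have dv: "dg * v + g * dv = 6 * (s * (s - 1))" and dD: "dg * D + g * dD = 6 * T"
    using ds1 dD_value by (simp_all add: dv_def dD_def om)
  have "g * (dv * D - v * dD) = D * (dg * v + g * dv) - v * (dg * D + g * dD)"
    by algebra
  also have "\<dots> = g * (36 * s * gi\<^sup>2 * (s * (s - 1) * r - T))"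
    unfolding dv dD unfolding D_def normal_form(2) using inv(1) by algebra
  also have "36 * s * gi\<^sup>2 * (s * (s - 1) * r - T) = 36 * s * gi\<^sup>2 * r\<^sup>2 * ((s - 1) * q3 * s - T * q3\<^sup>2)"
    using inv(3) by algebra
  also have "\<dots> = D\<^sup>2 * ?h"
    unfolding h D_def by algebra
  finally have "dv * D - v * dD = D\<^sup>2 * ?h"
    using nonzero(1) by (metis mult_left_cancel)
  then show ?thesis
    unfolding D_value dv_def dD_def .
qed

text \<open>Since 6 g v = 36 s, the product that defines p_3 equals -36 s p_3. Its derivative also
  hits the explicit s, which is balanced by the last term on the left.\<close>

lemma flow_p3:
  "(d3 + db2 * b4 + b2 * db4) * ((v + g * a0) * m6 + g * (6 * al 6))
   + (v + g * a0) * ((d3 + db2 * b4 + b2 * db4) * m6 + (v + g * a0) * dm6 + dg * (6 * al 6))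
   + 36 * (s * (s - 1)) * p3 = 36 * s *
    (p3\<^sup>2 * ((2 * q3 - 1) * (q3 - s) + q3 * (q3 - 1))
     + ((al 0 + 2 * al 6 + 2 * al 3) * (2 * q3 - 1) - al 0 * (2 * q3 - s) - al 3 * (2 * q3 - 1 - s)) * p3
     + al 6 * (al 3 + al 6) + p3 * (P1 * (q1 * q3 + s) + P2 * (q2 * q3 + s)) + P3 * (P1 * q1 + P2 * q2))" (is "_ = _ * ?h")
proof -
  define dD where "dD = d3 + db2 * b4 + b2 * db4"
  define S' where "S' = q3 * p3 + al 6"
  have dD: "dg * D + g * dD = 6 * T" and dg: "dg = g * (H 2 + H 4 - (F1 + F2))"
    and H6: "H 6 = 2 * (H 2 + H 4) + A6" and X6: "X6 = g\<^sup>2 / 6 * S"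
    using dD_value dg_value H_values_outer X_values by (simp_all add: dD_def om S_def)
  have h: "- T * (q3 * p3 + S') - s * r * S' * (2 * (F1 + F2) + A6) - al 6 * s\<^sup>2 * r\<^sup>2 * S
      + s * (s - 1) * p3 = s * ?h"
    unfolding S'_def T_def A6_def F1_def F2_def G1_def G2_def A1_def A5_def A3_def Y2_def Y4_def
      S_def Q_def R3_def P1_def P2_def P3_def
    using inv(3) sum_al by algebra
  have Dm6: "D * m6 = - 6 * g * S'"
    unfolding D_def normal_form(11) S'_def using inv(1,3,4) by algebra
  have gD: "g * D = 6 * s * r"
    unfolding D_def using inv(1) by algebra
  have "dD * (D * m6 + g * (6 * al 6)) + D * (dD * m6 + D * dm6 + dg * (6 * al 6))
      = (g * dD) * (- 6 * (q3 * p3 + S')) + D * (D * dm6 + dg * (6 * al 6))"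
    using Dm6 S'_def by algebra
  also have "g * dD = 6 * T - dg * D"
    using dD by algebra
  also have "D * (D * dm6 + dg * (6 * al 6)) = - 6 * (g * D) * S' * H 6 - al 6 * (g * D)\<^sup>2 * S + 6 * dg * D * al 6"
    unfolding deg0(3) X6 using Dm6 by algebra
  also have "dg * D = 6 * s * r * (H 2 + H 4 - (F1 + F2))"
    unfolding dg using gD by algebra
  finally have "dD * (D * m6 + g * (6 * al 6)) + D * (dD * m6 + D * dm6 + dg * (6 * al 6))
      = 36 * (- T * (q3 * p3 + S') - s * r * S' * (2 * (F1 + F2) + A6) - al 6 * s\<^sup>2 * r\<^sup>2 * S)"
    unfolding gD H6 S'_def using \<open>dg * D = _\<close> by algebra
  then show ?thesis
    unfolding D_value dD_def[symmetric] using h by algebra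
qed

lemmas flow = flow_q1[unfolded P1_def P2_def P3_def] flow_q2[unfolded P1_def P2_def P3_def]
  flow_q3[unfolded P1_def P2_def P3_def] flow_p1[unfolded P1_def P2_def P3_def]
  flow_p2[unfolded P1_def P2_def P3_def] flow_p3[unfolded P1_def P2_def P3_def]

end

section \<open>Local solutions of the similarity reduction\<close>

lemma partial_eq:
  assumes "(F has_derivative (\<lambda>v. a * fst v + b * snd v)) (at \<tau>)"
  shows "partial 1 F \<tau> = a" "partial 2 F \<tau> = b"
proof -
  have F: "(F has_derivative (\<lambda>v. a * fst v + b * snd v)) (at (fst \<tau>, snd \<tau>))"
    using assms by simp
  have "((\<lambda>z. F (z, snd \<tau>)) has_derivative (\<lambda>h. a * fst (h, 0::complex) + b * snd (h, 0::complex))) (at (fst \<tau>))"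
    by (rule has_derivative_compose[where f = "\<lambda>z. (z, snd \<tau>)" and g = F, OF _ F])
      (auto intro!: derivative_eq_intros)
  then show "partial 1 F \<tau> = a"
    unfolding partial_def by (auto intro!: DERIV_imp_deriv simp: has_field_derivative_def)
  have "((\<lambda>z. F (fst \<tau>, z)) has_derivative (\<lambda>h. a * fst (0::complex, h) + b * snd (0::complex, h))) (at (snd \<tau>))"
    by (rule has_derivative_compose[where f = "\<lambda>z. (fst \<tau>, z)" and g = F, OF _ F])
      (auto intro!: derivative_eq_intros)
  then show "partial 2 F \<tau> = b"
    unfolding partial_def by (auto intro!: DERIV_imp_deriv simp: has_field_derivative_def)
qed

lemma has_field_derivative_curve:
  assumes F: "(F has_derivative (\<lambda>v. a * fst v + b * snd v)) (at (t z))"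
    and t: "((\<lambda>z. fst (t z)) has_field_derivative t1) (at z)"
      "((\<lambda>z. snd (t z)) has_field_derivative t2) (at z)"
  shows "((\<lambda>z. F (t z)) has_field_derivative (t1 * a + t2 * b)) (at z)"
proof -
  have "((\<lambda>z. (fst (t z), snd (t z))) has_derivative (\<lambda>h. (t1 * h, t2 * h))) (at z)"
    using t by (intro has_derivative_Pair) (simp_all add: has_field_derivative_def)
  then have "(t has_derivative (\<lambda>h. (t1 * h, t2 * h))) (at z)"
    by simp
  from has_derivative_compose[OF this F] show ?thesis
    unfolding has_field_derivative_def
    by (rule has_derivative_eq_rhs) (auto simp: fun_eq_iff algebra_simps)
qed

lemma holomorphic2_const: "holomorphic2_on (\<lambda>\<tau>. a) W"
  and holomorphic2_fst: "holomorphic2_on fst W"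
  and holomorphic2_snd: "holomorphic2_on snd W"
proof -
  show "holomorphic2_on (\<lambda>\<tau>. a) W"
    unfolding holomorphic2_on_def by (intro ballI exI[of _ 0]) (auto intro!: derivative_eq_intros)
  show "holomorphic2_on fst W"
    unfolding holomorphic2_on_def
    by (intro ballI exI[of _ 1] exI[of _ 0]) (auto intro!: derivative_eq_intros)
  show "holomorphic2_on snd W"
    unfolding holomorphic2_on_def
    by (intro ballI exI[of _ 0] exI[of _ 1]) (auto intro!: derivative_eq_intros)
qed

lemma holomorphic2_add:
  assumes "holomorphic2_on F W" "holomorphic2_on F' W"
  shows "holomorphic2_on (\<lambda>\<tau>. F \<tau> + F' \<tau>) W"
  unfolding holomorphic2_on_def
proof
  fix \<tau> assume "\<tau> \<in> W"
  then obtain a b a' b' where "(F has_derivative (\<lambda>v. a * fst v + b * snd v)) (at \<tau>)"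
      "(F' has_derivative (\<lambda>v. a' * fst v + b' * snd v)) (at \<tau>)"
    using assms unfolding holomorphic2_on_def by blast
  from has_derivative_add[OF this]
  have "((\<lambda>\<tau>. F \<tau> + F' \<tau>) has_derivative (\<lambda>v. (a + a') * fst v + (b + b') * snd v)) (at \<tau>)"
    by (simp add: algebra_simps)
  then show "\<exists>a b. ((\<lambda>\<tau>. F \<tau> + F' \<tau>) has_derivative (\<lambda>v. a * fst v + b * snd v)) (at \<tau>)"
    by blast
qed

lemma holomorphic2_mult:
  assumes "holomorphic2_on F W" "holomorphic2_on F' W"
  shows "holomorphic2_on (\<lambda>\<tau>. F \<tau> * F' \<tau>) W"
  unfolding holomorphic2_on_def
proof
  fix \<tau> assume "\<tau> \<in> W"
  then obtain a b a' b' where "(F has_derivative (\<lambda>v. a * fst v + b * snd v)) (at \<tau>)"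
      "(F' has_derivative (\<lambda>v. a' * fst v + b' * snd v)) (at \<tau>)"
    using assms unfolding holomorphic2_on_def by blast
  from has_derivative_mult[OF this]
  have "((\<lambda>\<tau>. F \<tau> * F' \<tau>) has_derivative
      (\<lambda>v. (F \<tau> * a' + a * F' \<tau>) * fst v + (F \<tau> * b' + b * F' \<tau>) * snd v)) (at \<tau>)"
    by (simp add: algebra_simps)
  then show "\<exists>a b. ((\<lambda>\<tau>. F \<tau> * F' \<tau>) has_derivative (\<lambda>v. a * fst v + b * snd v)) (at \<tau>)"
    by blast
qed

lemma holomorphic2_diff:
  assumes "holomorphic2_on F W" "holomorphic2_on F' W"
  shows "holomorphic2_on (\<lambda>\<tau>. F \<tau> - F' \<tau>) W"
  using holomorphic2_add[OF assms(1) holomorphic2_mult[OF holomorphic2_const[of "-1"] assms(2)]]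
  by simp

context affine_E6
begin

text \<open>The finitely many coordinates yield two vectors that represent the differential against
  all functionals at once; these are the partial derivatives, and the scalar chain rule
  applies.\<close>

lemma lie_partial_curve:
  assumes c: "coordinates X Bs r" and W: "open W" "t z \<in> W"
    and F: "\<And>\<tau>. \<tau> \<in> W \<Longrightarrow> F \<tau> \<in> X" "lie_holomorphic2_on G F W"
    and t: "((\<lambda>z. fst (t z)) has_field_derivative t1) (at z)"
      "((\<lambda>z. snd (t z)) has_field_derivative t2) (at z)"
  shows "wderiv (\<lambda>z. F (t z)) (t1 \<cdot> lie_partial G 1 F (t z) + t2 \<cdot> lie_partial G 2 F (t z)) z"
    and "lie_partial G 1 F (t z) \<in> X" "lie_partial G 2 F (t z) \<in> X"
proof -
  let ?\<tau> = "t z"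
  have "\<forall>b\<in>Bs. \<exists>x y. ((\<lambda>\<tau>. r b (F \<tau>)) has_derivative (\<lambda>v. x * fst v + y * snd v)) (at ?\<tau>)"
    using F(2) c W(2) by (auto simp: lie_holomorphic2_on_def holomorphic2_on_def coordinates_def)
  then obtain x y where xy: "\<And>b. b \<in> Bs \<Longrightarrow>
      ((\<lambda>\<tau>. r b (F \<tau>)) has_derivative (\<lambda>v. x b * fst v + y b * snd v)) (at ?\<tau>)"
    by metis
  have der: "((\<lambda>\<tau>. \<phi> (F \<tau>)) has_derivative
      (\<lambda>v. \<phi> (\<Sum>b\<in>Bs. x b \<cdot> b) * fst v + \<phi> (\<Sum>b\<in>Bs. y b \<cdot> b) * snd v)) (at ?\<tau>)"
    if \<phi>: "functional G \<phi>" for \<phi>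
  proof -
    have "((\<lambda>\<tau>. \<Sum>b\<in>Bs. r b (F \<tau>) * \<phi> b) has_derivative
        (\<lambda>v. \<Sum>b\<in>Bs. (x b * fst v + y b * snd v) * \<phi> b)) (at ?\<tau>)"
      by (intro has_derivative_sum has_derivative_mult_left xy)
    also have "(\<lambda>v. \<Sum>b\<in>Bs. (x b * fst v + y b * snd v) * \<phi> b)
        = (\<lambda>v. \<phi> (\<Sum>b\<in>Bs. x b \<cdot> b) * fst v + \<phi> (\<Sum>b\<in>Bs. y b \<cdot> b) * snd v)"
      by (simp add: functional_sum functional_scale \<phi> sum_distrib_right sum_distrib_left algebra_simps sum.distrib)
    finally show ?thesis
      by (rule has_derivative_transform_within_open[OF _ W])
        (simp add: coordinates_functional[OF c F(1) \<phi>])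
  qed
  have p1: "lie_partial G 1 F ?\<tau> = (\<Sum>b\<in>Bs. x b \<cdot> b)" and p2: "lie_partial G 2 F ?\<tau> = (\<Sum>b\<in>Bs. y b \<cdot> b)"
    unfolding lie_partial_def using partial_eq[OF der]
    by (intro the_equality; auto intro!: functional_eqI)+
  show "lie_partial G 1 F ?\<tau> \<in> X" "lie_partial G 2 F ?\<tau> \<in> X"
    unfolding p1 p2 using c
    by (auto simp: coordinates_def intro!: vs.subspace_sum vs.subspace_scale)
  show "wderiv (\<lambda>z. F (t z)) (t1 \<cdot> lie_partial G 1 F (t z) + t2 \<cdot> lie_partial G 2 F (t z)) z"
    unfolding wderiv_def p1 p2
    using has_field_derivative_curve[OF der t] by (simp add: functional_add functional_scale)
qed

text \<open>The span is where \<open>U k\<close> and both gauge parameters take their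
  values.\<close>

definition gens0 :: "'g set" where
  "gens0 = coroot G ` {..6} \<union> e ` {2,4,6} \<union> f ` {2,4,6}"

text \<open>Adds the scaling element, needed for \<theta>, and degree 1, needed for
  \<Lambda>_k.\<close>

definition gens :: "'g set" where
  "gens = insert (scaling G) (gens0 \<union> e_word G ` words)"

lemma ad_span:
  assumes "\<And>x y. x \<in> A \<Longrightarrow> y \<in> C \<Longrightarrow> ad G x y \<in> vs.span F"
    and "x \<in> vs.span A" "y \<in> vs.span C"
  shows "ad G x y \<in> vs.span F"
proof -
  have 1: "ad G x y \<in> vs.span F" if "x \<in> A" for x
    using assms(3) by (induction rule: vs.span_induct)
      (auto intro!: vs.subspaceI intro: assms(1) that vs.span_add vs.span_scale vs.span_zero
        simp: ad_add_right ad_scale_right)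
  show ?thesis
    using assms(2) by (induction rule: vs.span_induct)
      (auto intro!: vs.subspaceI intro: 1 vs.span_add vs.span_scale vs.span_zero
        simp: ad_add_left ad_scale_left)
qed

lemma V1_unit: "w \<in> words \<Longrightarrow> V1 (\<lambda>u. if u = w then 1 else 0) = e_word G w"
proof -
  assume w: "w \<in> words"
  have fin: "finite words" by (simp add: words_def)
  have "V1 (\<lambda>u. if u = w then 1 else 0) = (\<Sum>u\<in>words. if u = w then e_word G u else 0)"
    unfolding V1_def by (intro sum.cong) auto
  then show ?thesis using w fin by simp
qed

lemma gens0_subset: "vs.span gens0 \<subseteq> vs.span gens"
  by (rule vs.span_mono) (auto simp: gens_def)

lemma cartan_gens: "h \<in> cartan_subalgebra G \<Longrightarrow> h \<in> vs.span gens"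
  using vs.span_mono[of "coroot G ` {..6} \<union> {scaling G}" gens]
  by (auto simp: cartan_subalgebra_def gens_def gens0_def)

lemma V1_gens: "V1 n \<in> vs.span gens"
  unfolding V1_def by (intro vs.span_sum vs.span_scale vs.span_base) (auto simp: gens_def)

lemma gens_cases [consumes 1, case_names scaling coroot e f word]:
  assumes "y \<in> gens"
  obtains "y = scaling G" | j where "j \<le> 6" "y = coroot G j" | j where "j \<in> {2,4,6}" "y = e j"
    | j where "j \<in> {2,4,6}" "y = f j" | w where "w \<in> words" "y = e_word G w"
proof -
  have "y = scaling G \<or> y \<in> coroot G ` {..6} \<or> y \<in> e ` {2,4,6} \<or> y \<in> f ` {2,4,6} \<or> y \<in> e_word G ` words"
    using assms unfolding gens_def gens0_def by (simp only: Un_iff insert_iff[of _ "scaling G"] disj_assoc)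
  then show thesis
    by (elim disjE imageE) (rule that; simp; fail)+
qed

lemma gens_memb:
  "i \<le> 6 \<Longrightarrow> coroot G i \<in> gens" "i \<in> {2,4,6} \<Longrightarrow> e i \<in> gens" "i \<in> {2,4,6} \<Longrightarrow> f i \<in> gens"
  "w \<in> words \<Longrightarrow> e_word G w \<in> gens"
  by (auto simp: gens_def gens0_def)

lemma words_le: "w \<in> words \<Longrightarrow> set w \<subseteq> {..6}"
  by (auto simp: words_def)

lemma coroot_gens:
  assumes "i \<le> 6" "y \<in> gens"
  shows "ad G (coroot G i) y \<in> vs.span gens"
proof -
  note ci = coroot_cartan[OF assms(1)]
  have "\<exists>a. ad G (coroot G i) y = a \<cdot> y"
    using assms(2)
  proof (cases rule: gens_cases)
    case scaling
    then show ?thesis using cartan_scaling[OF ci] by (intro exI[of _ 0]) simp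
  next
    case (coroot j)
    then show ?thesis using coroot_coroot[OF assms(1), of j] by (intro exI[of _ 0]) simp
  next
    case (e j)
    then have "j \<le> 6" by auto
    from cartan_e[OF ci this] show ?thesis unfolding e(2) by blast
  next
    case (f j)
    then have "j \<le> 6" by auto
    from cartan_f[OF ci this] show ?thesis unfolding f(2) by blast
  next
    case (word w)
    from cartan_word[OF ci words_le[OF word(1)]] show ?thesis unfolding word(2) by blast
  qed
  then show ?thesis using vs.span_scale[OF vs.span_base[OF assms(2)]] by auto
qed

lemma e_gens:
  assumes "i \<in> {2,4,6}" "y \<in> gens"
  shows "ad G (e i) y \<in> vs.span gens"
proof -
  have i: "i \<le> 6" "i \<noteq> 0" using assms(1) by auto
  show ?thesis
    using assms(2)
  proof (cases rule: gens_cases)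
    case scaling
    then show ?thesis
      using ad_antisym[of "e i" "scaling G"] scaling_e[OF i(1)] i(2) by (simp add: vs.span_zero)
  next
    case (coroot j)
    then show ?thesis
      using ad_antisym[of "e i" "coroot G j"] coroot_e[OF coroot(1) i(1)] gens_memb(2)[OF assms(1)]
      by (simp add: vs.span_neg vs.span_scale vs.span_base)
  next
    case (e j)
    then have "j \<le> 6" "i \<noteq> j \<Longrightarrow> cartan_E6 i j = 0"
      using assms(1) by (auto simp: cartan_E6_def doubleton_eq_iff)
    then show ?thesis using e(2) i by (cases "i = j") (simp_all add: ad_self e_comm(1) vs.span_zero)
  next
    case (f j)
    then have "j \<le> 6" by auto
    then show ?thesis using i f(2) by (simp add: e_f vs.span_zero vs.span_base gens_memb(1))
  next
    case (word w)
    show ?thesis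
      using e_V1[OF assms(1), of "\<lambda>u. if u = w then 1 else 0"] V1_unit[OF word(1)] V1_gens word(2) by simp
  qed
qed

lemma f_gens:
  assumes "i \<in> {2,4,6}" "y \<in> gens"
  shows "ad G (f i) y \<in> vs.span gens"
proof -
  have i: "i \<le> 6" "i \<noteq> 0" using assms(1) by auto
  show ?thesis
    using assms(2)
  proof (cases rule: gens_cases)
    case scaling
    then show ?thesis
      using ad_antisym[of "f i" "scaling G"] scaling_f[OF i(1)] i(2) by (simp add: vs.span_zero)
  next
    case (coroot j)
    then show ?thesis
      using ad_antisym[of "f i" "coroot G j"] coroot_f[OF coroot(1) i(1)] gens_memb(3)[OF assms(1)]
      by (simp add: vs.span_neg vs.span_scale vs.span_base)
  next
    case (e j)
    then have "j \<le> 6" by auto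
    then show ?thesis using i e(2) by (simp add: f_e vs.span_zero vs.span_neg vs.span_base gens_memb(1))
  next
    case (f j)
    then have "j \<le> 6" "i \<noteq> j \<Longrightarrow> cartan_E6 i j = 0"
      using assms(1) by (auto simp: cartan_E6_def doubleton_eq_iff)
    then show ?thesis using f(2) i by (cases "i = j") (simp_all add: ad_self f_comm vs.span_zero)
  next
    case (word w)
    show ?thesis
      using f_V1[OF assms(1), of "\<lambda>u. if u = w then 1 else 0"] V1_unit[OF word(1)] V1_gens word(2) by simp
  qed
qed

lemma ad_gens:
  assumes "x \<in> vs.span gens0" "y \<in> vs.span gens"
  shows "ad G x y \<in> vs.span gens"
proof (rule ad_span[OF _ assms])
  fix x y assume "x \<in> gens0" "y \<in> gens"
  then show "ad G x y \<in> vs.span gens"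
    unfolding gens0_def Un_iff
    by (elim disjE imageE) (simp_all only: atMost_iff coroot_gens e_gens f_gens)
qed

lemma finite_gens: "finite gens0" "finite gens"
  by (simp_all add: gens_def gens0_def words_def)

definition Vf :: "(nat \<Rightarrow> complex) \<Rightarrow> 'g" where
  "Vf y = (\<Sum>i\<in>{2,4,6}. y i \<cdot> f i)"

lemma Vf_explicit: "Vf y = y 2 \<cdot> f 2 + (y 4 \<cdot> f 4 + y 6 \<cdot> f 6)"
  by (simp add: Vf_def)

lemma gens_decompose:
  assumes "X \<in> vs.span gens"
  shows "\<exists>h\<in>cartan_subalgebra G. \<exists>x y n. X = h + Ve x + Vf y + V1 n"
  using assms
proof (induction rule: vs.span_induct_alt)
  case base
  have "0 = 0 + Ve (\<lambda>_. 0) + Vf (\<lambda>_. 0) + V1 (\<lambda>_. 0)"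
    by (simp add: Ve_explicit Vf_explicit V1_def)
  then show ?case using vs.subspace_0[OF subspace_cartan] by blast
next
  case (step c X Y)
  from step.IH obtain h x y n where h: "h \<in> cartan_subalgebra G" and Y: "Y = h + Ve x + Vf y + V1 n"
    by blast
  show ?case
    using step.hyps(1)
  proof (cases rule: gens_cases)
    case scaling
    have "c \<cdot> X + Y = (c \<cdot> scaling G + h) + Ve x + Vf y + V1 n" by (simp add: Y scaling add.assoc)
    moreover have "c \<cdot> scaling G + h \<in> cartan_subalgebra G"
      by (intro vs.subspace_add[OF subspace_cartan] vs.subspace_scale[OF subspace_cartan] scaling_cartan h)
    ultimately show ?thesis by blast
  next
    case (coroot j)
    have "c \<cdot> X + Y = (c \<cdot> coroot G j + h) + Ve x + Vf y + V1 n" by (simp add: Y coroot add.assoc)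
    moreover have "c \<cdot> coroot G j + h \<in> cartan_subalgebra G"
      by (intro vs.subspace_add[OF subspace_cartan] vs.subspace_scale[OF subspace_cartan]
          coroot_cartan[OF coroot(1)] h)
    ultimately show ?thesis by blast
  next
    case (e j)
    have "c \<cdot> X + Y = h + Ve (x(j := x j + c)) + Vf y + V1 n"
      using e by (auto simp: Y Ve_explicit vs.scale_left_distrib algebra_simps)
    then show ?thesis using h by blast
  next
    case (f j)
    have "c \<cdot> X + Y = h + Ve x + Vf (y(j := y j + c)) + V1 n"
      using f by (auto simp: Y Vf_explicit vs.scale_left_distrib algebra_simps)
    then show ?thesis using h by blast
  next
    case (word w)
    have "V1 (\<lambda>u. c * (if u = w then 1 else 0) + n u) = c \<cdot> e_word G w + V1 n"
      unfolding V1_add V1_scale V1_unit[OF word(1)] ..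
    then have "c \<cdot> X + Y = h + Ve x + Vf y + V1 (\<lambda>u. c * (if u = w then 1 else 0) + n u)"
      by (simp add: Y word algebra_simps)
    then show ?thesis using h by blast
  qed
qed

lemma subspace_borel: "vs.subspace (borel_plus G)"
proof (rule vs.subspaceI)
  show "0 \<in> borel_plus G"
    unfolding borel_plus_def using vs.subspace_0[OF subspace_cartan] lie_generated.intros(2)
    by (metis (mono_tags, lifting) add_0 mem_Collect_eq)
next
  fix a x assume "x \<in> borel_plus G"
  then show "a \<cdot> x \<in> borel_plus G"
    unfolding borel_plus_def using vs.subspace_scale[OF subspace_cartan] lie_generated.intros(4)
    by (smt (verit) mem_Collect_eq vs.scale_right_distrib)
next
  fix x y assume "x \<in> borel_plus G" "y \<in> borel_plus G"
  then obtain h n h' n' where "x = h + n" "y = h' + n'" "h \<in> cartan_subalgebra G" "h' \<in> cartan_subalgebra G"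
      "n \<in> lie_generated G (e ` {..6})" "n' \<in> lie_generated G (e ` {..6})"
    unfolding borel_plus_def by blast
  moreover from this have "x + y = (h + h') + (n + n')" by (simp add: algebra_simps)
  ultimately show "x + y \<in> borel_plus G"
    unfolding borel_plus_def using vs.subspace_add[OF subspace_cartan] lie_generated.intros(3) by blast
qed

end

context affine_E6_theta
begin

text \<open>Pairing with e_i reads off the coefficient of f_i, and it vanishes on the Borel
  subalgebra.\<close>

lemma borel_decompose:
  assumes "X \<in> vs.span gens" "X \<in> borel_plus G"
  shows "\<exists>h\<in>cartan_subalgebra G. \<exists>x n. X = h + Ve x + V1 n"
proof -
  obtain h x y n where h: "h \<in> cartan_subalgebra G" and X: "X = h + Ve x + Vf y + V1 n"
    using gens_decompose[OF assms(1)] by blast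
  have "y i = 0" if i: "i \<in> {2,4,6}" for i
  proof -
    have i6: "i \<le> 6" using i by auto
    have "form G (e i) (e j) = 0" if "j \<le> 6" for j
      by (rule form_eigenvectors[of \<rho> _ 1 _ 1]) (simp_all add: \<rho>_e i6 that)
    moreover have "form G (e i) (Vf y) = y i"
      using i by (auto simp: Vf_explicit form_add form_scale form_e_f)
    ultimately have "form G (e i) X = y i"
      using form_cartan[OF h i6] form_sym[of "e i" h] form_e_V1[OF i]
      by (simp add: X form_add form_scale Ve_explicit)
    with form_e_borel[OF i6 assms(2)] show ?thesis by simp
  qed
  then have "X = h + Ve x + V1 n" by (simp add: X Vf_explicit)
  with h show ?thesis by blast
qed

lemma gauge_eq: "gauge G \<Gamma> k b \<tau> = exp_ad G (\<Gamma> \<tau>) (b \<tau>) + gauge_term (\<Gamma> \<tau>) (lie_partial G k \<Gamma> \<tau>)"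
  by (simp add: gauge_def gauge_term_def log_term_def)

lemma Lambda_gens: "Lambda G k \<in> vs.span gens"
proof -
  have w: "e_word G w \<in> vs.span gens" if "w \<in> words" for w
    using gens_memb(4)[OF that] by (rule vs.span_base)
  note intros = vs.span_add vs.span_diff vs.span_scale w
  show ?thesis
  proof (cases "k = 1")
    case True
    show ?thesis
      unfolding Lambda_def if_P[OF True] by (intro intros) (simp_all add: words_def)
  next
    case False
    show ?thesis
      unfolding Lambda_def if_not_P[OF False] by (intro intros) (simp_all add: words_def)
  qed
qed

lemma lie_holomorphic2_M_op:
  assumes "lie_holomorphic2_on G (U 1) W" "lie_holomorphic2_on G (U 2) W"
  shows "lie_holomorphic2_on G (M_op G \<theta> U) W"
  unfolding lie_holomorphic2_on_def
proof (intro allI impI)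
  fix \<phi> assume \<phi>: "functional G \<phi>"
  have "holomorphic2_on (\<lambda>\<tau>. \<phi> \<theta> - fst \<tau> * (\<phi> (U 1 \<tau>) + \<phi> (Lambda G 1))
     - snd \<tau> * (\<phi> (U 2 \<tau>) + \<phi> (Lambda G 2))) W"
    using assms \<phi> unfolding lie_holomorphic2_on_def
    by (intro holomorphic2_diff holomorphic2_mult holomorphic2_add holomorphic2_const
        holomorphic2_fst holomorphic2_snd) auto
  then show "holomorphic2_on (\<lambda>\<tau>. \<phi> (M_op G \<theta> U \<tau>)) W"
    by (simp add: M_op_def B_op_def functional_diff functional_scale functional_add \<phi>)
qed

lemma lie_holomorphic2_Gamma2:
  assumes "\<And>i. i \<in> {2,4,6} \<Longrightarrow> holomorphic2_on (l i) W"
  shows "lie_holomorphic2_on G (Gamma2 G l) W"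
  unfolding lie_holomorphic2_on_def
proof (intro allI impI)
  fix \<phi> assume \<phi>: "functional G \<phi>"
  have "holomorphic2_on (\<lambda>\<tau>. l 2 \<tau> * \<phi> (f 2) + (l 4 \<tau> * \<phi> (f 4) + l 6 \<tau> * \<phi> (f 6))) W"
    using assms by (intro holomorphic2_mult holomorphic2_add holomorphic2_const) auto
  then show "holomorphic2_on (\<lambda>\<tau>. \<phi> (Gamma2 G l \<tau>)) W"
    by (simp add: Gamma2_def functional_scale functional_add \<phi>)
qed

text \<open>Along the curve the two flows combine into a single Lax equation with operator B_1
  dt_1/ds + B_2 dt_2/ds. Gauge covariance in one variable is applied twice, and linearity in the
  tangent vector identifies the result with the combination of the two
  \<open>B_plus\<close>.\<close>

lemma local_solution_Lax:
  assumes gauge1: "first_gauge G D \<Gamma>1 c" and S: "open S" "s \<in> S" and slice: "slice_curve D c S t"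
    and W: "open W" "t s \<in> W" "W \<subseteq> D"
    and red: "similarity_reduction G \<theta> W U" and gauge2: "second_gauge G \<theta> \<Gamma>1 c \<kappa> W U l \<xi>"
  defines "M \<equiv> \<lambda>z. M_plus G \<kappa> (\<lambda>j. c j (t z)) (\<lambda>i. l i (t z)) (\<lambda>i. \<xi> i (t z))"
    and "Y \<equiv> deriv (\<lambda>z. fst (t z)) s \<cdot> B_plus G \<Gamma>1 l U 1 (t s)
        + deriv (\<lambda>z. snd (t z)) s \<cdot> B_plus G \<Gamma>1 l U 2 (t s)"
  shows "wderiv M (ad G Y (M s)) s" "Y \<in> vs.span gens" "Y \<in> borel_plus G"
proof -
  define t1 where "t1 z = deriv (\<lambda>z. fst (t z)) z" for z
  define t2 where "t2 z = deriv (\<lambda>z. snd (t z)) z" for z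
  \<comment> \<open>The part of \<open>S\<close> over which the curve stays in the domain of the
    local solution.\<close>
  define V where "V = S \<inter> t -` W"
  have hol: "(\<lambda>s. fst (t s)) holomorphic_on S" "(\<lambda>s. snd (t s)) holomorphic_on S"
    using slice by (simp_all add: slice_curve_def)
  have t: "((\<lambda>z. fst (t z)) has_field_derivative t1 z) (at z)"
      "((\<lambda>z. snd (t z)) has_field_derivative t2 z) (at z)" if "z \<in> V" for z
    unfolding t1_def t2_def using that S(1) hol
    by (auto simp: V_def intro: holomorphic_derivI)
  have "continuous_on S (\<lambda>s. (fst (t s), snd (t s)))"
    by (intro continuous_on_Pair holomorphic_on_imp_continuous_on hol)
  then have V: "open V" "s \<in> V"
    unfolding V_def using S W by (auto intro: continuous_open_preimage)
  have tW: "t z \<in> W" if "z \<in> V" for z using that by (simp add: V_def)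
  obtain B0 r0 where c0: "coordinates (vs.span gens0) B0 r0"
    using coordinates_exist[OF finite_gens(1)] by blast
  obtain Bs r where cc: "coordinates (vs.span gens) Bs r"
    using coordinates_exist[OF finite_gens(2)] by blast
  interpret ad_invariant G "vs.span gens0" B0 r0 "vs.span gens" Bs r
    by unfold_locales (use c0 cc ad_gens gens0_subset in auto)
  have U: "lie_holomorphic2_on G (U k) W" "\<And>\<tau>. \<tau> \<in> W \<Longrightarrow> U k \<tau> \<in> vs.span gens0"
      "\<And>\<tau>. \<tau> \<in> W \<Longrightarrow> lie_partial G k (M_op G \<theta> U) \<tau> = ad G (B_op G U k \<tau>) (M_op G \<theta> U \<tau>)"
    if "k \<in> {1,2}" for k
    using red that unfolding similarity_reduction_def gens0_def[symmetric] by blast+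
  have BW: "B_op G U k \<tau> \<in> vs.span gens" if "k \<in> {1,2}" "\<tau> \<in> W" for k \<tau>
    unfolding B_op_def using U(2)[OF that] gens0_subset Lambda_gens by (auto intro: vs.span_add)
  have MW: "M_op G \<theta> U \<tau> \<in> vs.span gens" if "\<tau> \<in> W" for \<tau>
    unfolding M_op_def using BW[OF _ that] cartan_gens[OF theta_cartan]
    by (intro vs.span_diff vs.span_scale) auto
  define Bz where "Bz z = t1 z \<cdot> B_op G U 1 (t z) + t2 z \<cdot> B_op G U 2 (t z)" for z
  have BzW: "Bz z \<in> vs.span gens" if "z \<in> V" for z
    unfolding Bz_def using BW tW[OF that] by (intro vs.span_add vs.span_scale) auto
  have y0: "wderiv (\<lambda>z. M_op G \<theta> U (t z)) (ad G (Bz z) (M_op G \<theta> U (t z))) z" if "z \<in> V" for z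
    using lie_partial_curve(1)[OF cc W(1) tW[OF that] MW lie_holomorphic2_M_op[OF U(1) U(1)] t[OF that]]
      U(3)[OF _ tW[OF that]]
    by (simp add: Bz_def ad_add_left ad_scale_left)
  have G1: "lie_holomorphic2_on G \<Gamma>1 W" "\<Gamma>1 \<tau> \<in> vs.span gens0" if "\<tau> \<in> W" for \<tau>
  proof -
    show "lie_holomorphic2_on G \<Gamma>1 W"
      using gauge1 W(3) unfolding first_gauge_def lie_holomorphic2_on_def holomorphic2_on_def by blast
    have "\<Gamma>1 \<tau> \<in> lspan G (coroot G ` {..6} \<union> e ` {2,4,6})"
      using gauge1 W(3) that unfolding first_gauge_def by blast
    then show "\<Gamma>1 \<tau> \<in> vs.span gens0"
      using vs.span_mono[of "coroot G ` {..6} \<union> e ` {2,4,6}" gens0] by (auto simp: gens0_def)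
  qed
  define dG1 where "dG1 z = t1 z \<cdot> lie_partial G 1 \<Gamma>1 (t z) + t2 z \<cdot> lie_partial G 2 \<Gamma>1 (t z)" for z
  note pG1 = lie_partial_curve[OF c0 W(1) tW G1(2) G1(1)[OF W(2)] t]
  have dG1: "wderiv (\<lambda>z. \<Gamma>1 (t z)) (dG1 z) z" if "z \<in> V" for z
    unfolding dG1_def using pG1(1) that by blast
  have pG1W: "lie_partial G 1 \<Gamma>1 (t z) \<in> vs.span gens" "lie_partial G 2 \<Gamma>1 (t z) \<in> vs.span gens"
    if "z \<in> V" for z
    using pG1(2,3)[OF that _ that that] gens0_subset by auto
  define y1 where "y1 z = exp_ad G (\<Gamma>1 (t z)) (M_op G \<theta> U (t z))" for z
  define B1 where "B1 z = exp_ad G (\<Gamma>1 (t z)) (Bz z) + gauge_term (\<Gamma>1 (t z)) (dG1 z)" for z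
  have y1: "wderiv y1 (ad G (B1 z) (y1 z)) z" if "z \<in> V" for z
    unfolding y1_def B1_def
    by (rule wderiv_exp_ad_Lax[OF V(1) that G1(2)[OF tW] dG1 MW[OF tW] y0 BzW[OF that]])
  have y1W: "y1 z \<in> vs.span gens" if "z \<in> V" for z
    unfolding y1_def by (rule exp_ad_W[OF G1(2)[OF tW[OF that]] MW[OF tW[OF that]]])
  have B1: "B1 z = t1 z \<cdot> gauge G \<Gamma>1 1 (B_op G U 1) (t z) + t2 z \<cdot> gauge G \<Gamma>1 2 (B_op G U 2) (t z)"
    and gW: "k \<in> {1,2} \<Longrightarrow> gauge G \<Gamma>1 k (B_op G U k) (t z) \<in> vs.span gens" if "z \<in> V" for z k
  proof -
    note g = G1(2)[OF tW[OF that]]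
    note b = BW[OF _ tW[OF that]]
    have b12: "B_op G U 1 (t z) \<in> vs.span gens" "B_op G U 2 (t z) \<in> vs.span gens"
      using b by auto
    show "B1 z = t1 z \<cdot> gauge G \<Gamma>1 1 (B_op G U 1) (t z) + t2 z \<cdot> gauge G \<Gamma>1 2 (B_op G U 2) (t z)"
      unfolding B1_def Bz_def dG1_def gauge_eq
      using b12 pG1W[OF that]
      by (simp add: exp_ad_add[OF g] exp_ad_scale[OF g] gauge_term_add[OF g] gauge_term_scale[OF g]
          vs.span_scale vs.scale_right_distrib algebra_simps)
    show "k \<in> {1,2} \<Longrightarrow> gauge G \<Gamma>1 k (B_op G U k) (t z) \<in> vs.span gens"
      unfolding gauge_eq using b12 pG1W[OF that]
      by (auto intro!: vs.span_add exp_ad_W[OF g] gauge_term_W[OF g])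
  qed
  have B1W: "B1 z \<in> vs.span gens" if "z \<in> V" for z
    unfolding B1[OF that] using gW[OF that] by (intro vs.span_add vs.span_scale) auto
  have G2: "Gamma2 G l \<tau> \<in> vs.span gens0" for \<tau>
    unfolding Gamma2_def by (intro vs.span_sum vs.span_scale vs.span_base) (auto simp: gens0_def)
  have hG2: "lie_holomorphic2_on G (Gamma2 G l) W"
    using gauge2 unfolding second_gauge_def by (intro lie_holomorphic2_Gamma2) blast
  define dG2 where "dG2 z = t1 z \<cdot> lie_partial G 1 (Gamma2 G l) (t z) + t2 z \<cdot> lie_partial G 2 (Gamma2 G l) (t z)" for z
  note pG2 = lie_partial_curve[OF c0 W(1) tW G2 hG2 t]
  have dG2: "wderiv (\<lambda>z. Gamma2 G l (t z)) (dG2 z) z" if "z \<in> V" for z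
    unfolding dG2_def using pG2(1) that by blast
  have pG2W: "lie_partial G 1 (Gamma2 G l) (t s) \<in> vs.span gens" "lie_partial G 2 (Gamma2 G l) (t s) \<in> vs.span gens"
    using pG2(2,3)[OF V(2) V(2) V(2)] gens0_subset by auto
  have y2: "wderiv (\<lambda>z. exp_ad G (Gamma2 G l (t z)) (y1 z))
      (ad G (exp_ad G (Gamma2 G l (t s)) (B1 s) + gauge_term (Gamma2 G l (t s)) (dG2 s))
        (exp_ad G (Gamma2 G l (t s)) (y1 s))) s"
    by (rule wderiv_exp_ad_Lax[OF V G2 dG2 y1W y1 B1W[OF V(2)]])
  have Y: "exp_ad G (Gamma2 G l (t s)) (B1 s) + gauge_term (Gamma2 G l (t s)) (dG2 s) = Y"
    unfolding Y_def B_plus_def B1[OF V(2)] dG2_def gauge_eq[of "Gamma2 G l"] t1_def[symmetric] t2_def[symmetric]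
    using gW[OF V(2), of 1] gW[OF V(2), of 2] pG2W
    by (simp add: exp_ad_add[OF G2] exp_ad_scale[OF G2] gauge_term_add[OF G2] gauge_term_scale[OF G2]
          vs.span_scale vs.scale_right_distrib algebra_simps)
  have M: "exp_ad G (Gamma2 G l (t z)) (y1 z) = M z" if "z \<in> V" for z
    using gauge2 tW[OF that] unfolding second_gauge_def M_star_def y1_def M_def by blast
  show "wderiv M (ad G Y (M s)) s"
    using wderiv_transform[OF y2 V M] unfolding Y M[OF V(2)] .
  show "Y \<in> vs.span gens"
    unfolding Y[symmetric] dG2_def
    using B1W[OF V(2)] pG2W by (intro vs.span_add vs.span_scale exp_ad_W[OF G2] gauge_term_W[OF G2])
  show "Y \<in> borel_plus G"
    unfolding Y_def using gauge2 W(2) unfolding second_gauge_def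
    by (intro vs.subspace_add[OF subspace_borel] vs.subspace_scale[OF subspace_borel]) blast+
qed

end

section \<open>Equivalence with the Hamiltonian system\<close>

lemma poisson_q:
  assumes "i \<in> {1,2,3}"
  shows "poisson F (\<lambda>p q. q i) p q = deriv (\<lambda>z. F (p(i := z)) q) (p i)"
  using assms by (auto simp: poisson_def fun_upd_def)

lemma poisson_p:
  assumes "i \<in> {1,2,3}"
  shows "poisson F (\<lambda>p q. p i) p q = - deriv (\<lambda>z. F p (q(i := z))) (q i)"
  using assms by (auto simp: poisson_def fun_upd_def)

text \<open>In the three Painleve summands the relation between the parameters gives \<alpha>_2,
  \<alpha>_4 and \<alpha>_6 as the value of \<beta>_2.\<close>

lemma H_coupled_explicit:
  "H_coupled \<alpha> s p q =
    q 1 * (q 1 - 1) * (q 1 - s) * (p 1)\<^sup>2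
      + ((\<alpha> 1 + 2 * \<alpha> 2 + 2 * \<alpha> 3) * (q 1 * (q 1 - 1)) - \<alpha> 1 * (q 1 * (q 1 - s)) - \<alpha> 3 * ((q 1 - 1) * (q 1 - s))) * p 1
      + \<alpha> 2 * (\<alpha> 3 + \<alpha> 2) * q 1
    + (q 2 * (q 2 - 1) * (q 2 - s) * (p 2)\<^sup>2
      + ((\<alpha> 5 + 2 * \<alpha> 4 + 2 * \<alpha> 3) * (q 2 * (q 2 - 1)) - \<alpha> 5 * (q 2 * (q 2 - s)) - \<alpha> 3 * ((q 2 - 1) * (q 2 - s))) * p 2
      + \<alpha> 4 * (\<alpha> 3 + \<alpha> 4) * q 2)
    + (q 3 * (q 3 - 1) * (q 3 - s) * (p 3)\<^sup>2
      + ((\<alpha> 0 + 2 * \<alpha> 6 + 2 * \<alpha> 3) * (q 3 * (q 3 - 1)) - \<alpha> 0 * (q 3 * (q 3 - s)) - \<alpha> 3 * ((q 3 - 1) * (q 3 - s))) * p 3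
      + \<alpha> 6 * (\<alpha> 3 + \<alpha> 6) * q 3)
    + (((q 1 - 1) * p 1 + \<alpha> 2) * ((q 2 - 1) * p 2 + \<alpha> 4) * (q 1 * q 2 + s)
      + ((q 1 - 1) * p 1 + \<alpha> 2) * ((q 3 - 1) * p 3 + \<alpha> 6) * (q 1 * q 3 + s)
      + ((q 2 - 1) * p 2 + \<alpha> 4) * ((q 3 - 1) * p 3 + \<alpha> 6) * (q 2 * q 3 + s))"
proof -
  have set: "{(i, j). 1 \<le> i \<and> i < j \<and> j \<le> (3::nat)} = {(1,2), (1,3), (2,3)}"
    by auto
  have VI: "H_VI p q s (\<alpha> 3) b1 b3 (\<alpha> 3) = q * (q - 1) * (q - s) * p\<^sup>2
      + ((1 - b1) * (q * (q - 1)) - b3 * (q * (q - s)) - \<alpha> 3 * ((q - 1) * (q - s))) * p + b2 * (\<alpha> 3 + b2) * q"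
    if "b1 = 1 - b3 - 2 * b2 - 2 * \<alpha> 3" for p q b1 b2 b3
  proof -
    have b2: "(1 - \<alpha> 3 - b1 - b3 - \<alpha> 3) / 2 = b2" by (simp add: that)
    show ?thesis unfolding H_VI_def Let_def b2 by (simp add: algebra_simps)
  qed
  have "H_VI (p 1) (q 1) s (\<alpha> 3) (1 - \<alpha> 1 - 2 * \<alpha> 2 - 2 * \<alpha> 3) (\<alpha> 1) (\<alpha> 3) = q 1 * (q 1 - 1) * (q 1 - s) * (p 1)\<^sup>2
      + ((\<alpha> 1 + 2 * \<alpha> 2 + 2 * \<alpha> 3) * (q 1 * (q 1 - 1)) - \<alpha> 1 * (q 1 * (q 1 - s)) - \<alpha> 3 * ((q 1 - 1) * (q 1 - s))) * p 1
      + \<alpha> 2 * (\<alpha> 3 + \<alpha> 2) * q 1"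
    by (subst VI[where ?b2.0 = "\<alpha> 2"]) (simp_all add: add_diff_eq)
  moreover have "H_VI (p 2) (q 2) s (\<alpha> 3) (1 - 2 * \<alpha> 3 - 2 * \<alpha> 4 - \<alpha> 5) (\<alpha> 5) (\<alpha> 3) = q 2 * (q 2 - 1) * (q 2 - s) * (p 2)\<^sup>2
      + ((\<alpha> 5 + 2 * \<alpha> 4 + 2 * \<alpha> 3) * (q 2 * (q 2 - 1)) - \<alpha> 5 * (q 2 * (q 2 - s)) - \<alpha> 3 * ((q 2 - 1) * (q 2 - s))) * p 2
      + \<alpha> 4 * (\<alpha> 3 + \<alpha> 4) * q 2"
    by (subst VI[where ?b2.0 = "\<alpha> 4"]) (simp_all add: algebra_simps)
  moreover have "H_VI (p 3) (q 3) s (\<alpha> 3) (1 - \<alpha> 0 - 2 * \<alpha> 3 - 2 * \<alpha> 6) (\<alpha> 0) (\<alpha> 3) = q 3 * (q 3 - 1) * (q 3 - s) * (p 3)\<^sup>2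
      + ((\<alpha> 0 + 2 * \<alpha> 6 + 2 * \<alpha> 3) * (q 3 * (q 3 - 1)) - \<alpha> 0 * (q 3 * (q 3 - s)) - \<alpha> 3 * ((q 3 - 1) * (q 3 - s))) * p 3
      + \<alpha> 6 * (\<alpha> 3 + \<alpha> 6) * q 3"
    by (subst VI[where ?b2.0 = "\<alpha> 6"]) (simp_all add: algebra_simps)
  ultimately show ?thesis
    unfolding H_coupled_def set by (simp add: add.assoc)
qed

lemma deriv_eqI: "(F has_field_derivative y) (at x) \<Longrightarrow> y = y' \<Longrightarrow> deriv F x = y'"
  using DERIV_imp_deriv by blast

lemma H_coupled_flow:
  fixes \<alpha> p q :: "nat \<Rightarrow> complex"
  defines "P1 \<equiv> (q 1 - 1) * p 1 + \<alpha> 2" and "P2 \<equiv> (q 2 - 1) * p 2 + \<alpha> 4" and "P3 \<equiv> (q 3 - 1) * p 3 + \<alpha> 6"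
  shows "poisson (H_coupled \<alpha> s) (\<lambda>p q. q 1) p q =
      2 * q 1 * (q 1 - 1) * (q 1 - s) * p 1 + (\<alpha> 1 + 2 * \<alpha> 2 + 2 * \<alpha> 3) * q 1 * (q 1 - 1)
     - \<alpha> 1 * q 1 * (q 1 - s) - \<alpha> 3 * (q 1 - 1) * (q 1 - s)
     + (q 1 - 1) * (P2 * (q 1 * q 2 + s) + P3 * (q 1 * q 3 + s))"
    and "poisson (H_coupled \<alpha> s) (\<lambda>p q. q 2) p q =
      2 * q 2 * (q 2 - 1) * (q 2 - s) * p 2 + (\<alpha> 5 + 2 * \<alpha> 4 + 2 * \<alpha> 3) * q 2 * (q 2 - 1)
     - \<alpha> 5 * q 2 * (q 2 - s) - \<alpha> 3 * (q 2 - 1) * (q 2 - s)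
     + (q 2 - 1) * (P1 * (q 1 * q 2 + s) + P3 * (q 2 * q 3 + s))"
    and "poisson (H_coupled \<alpha> s) (\<lambda>p q. q 3) p q =
      2 * q 3 * (q 3 - 1) * (q 3 - s) * p 3 + (\<alpha> 0 + 2 * \<alpha> 6 + 2 * \<alpha> 3) * q 3 * (q 3 - 1)
     - \<alpha> 0 * q 3 * (q 3 - s) - \<alpha> 3 * (q 3 - 1) * (q 3 - s)
     + (q 3 - 1) * (P1 * (q 1 * q 3 + s) + P2 * (q 2 * q 3 + s))"
    and "poisson (H_coupled \<alpha> s) (\<lambda>p q. p 1) p q =
      - ((p 1)\<^sup>2 * ((2 * q 1 - 1) * (q 1 - s) + q 1 * (q 1 - 1))
     + ((\<alpha> 1 + 2 * \<alpha> 2 + 2 * \<alpha> 3) * (2 * q 1 - 1) - \<alpha> 1 * (2 * q 1 - s) - \<alpha> 3 * (2 * q 1 - 1 - s)) * p 1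
     + \<alpha> 2 * (\<alpha> 3 + \<alpha> 2) + p 1 * (P2 * (q 1 * q 2 + s) + P3 * (q 1 * q 3 + s)) + P1 * (P2 * q 2 + P3 * q 3))"
    and "poisson (H_coupled \<alpha> s) (\<lambda>p q. p 2) p q =
      - ((p 2)\<^sup>2 * ((2 * q 2 - 1) * (q 2 - s) + q 2 * (q 2 - 1))
     + ((\<alpha> 5 + 2 * \<alpha> 4 + 2 * \<alpha> 3) * (2 * q 2 - 1) - \<alpha> 5 * (2 * q 2 - s) - \<alpha> 3 * (2 * q 2 - 1 - s)) * p 2
     + \<alpha> 4 * (\<alpha> 3 + \<alpha> 4) + p 2 * (P1 * (q 1 * q 2 + s) + P3 * (q 2 * q 3 + s)) + P2 * (P1 * q 1 + P3 * q 3))"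
    and "poisson (H_coupled \<alpha> s) (\<lambda>p q. p 3) p q =
      - ((p 3)\<^sup>2 * ((2 * q 3 - 1) * (q 3 - s) + q 3 * (q 3 - 1))
     + ((\<alpha> 0 + 2 * \<alpha> 6 + 2 * \<alpha> 3) * (2 * q 3 - 1) - \<alpha> 0 * (2 * q 3 - s) - \<alpha> 3 * (2 * q 3 - 1 - s)) * p 3
     + \<alpha> 6 * (\<alpha> 3 + \<alpha> 6) + p 3 * (P1 * (q 1 * q 3 + s) + P2 * (q 2 * q 3 + s)) + P3 * (P1 * q 1 + P2 * q 2))"
  unfolding P1_def P2_def P3_def
  by (subst poisson_q, simp, rule deriv_eqI, simp only: H_coupled_explicit fun_upd_apply, simp,
      (rule derivative_eq_intros refl)+, simp add: algebra_simps power2_eq_square)+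
    (subst poisson_p, simp, rule arg_cong[of _ _ uminus], rule deriv_eqI,
      simp only: H_coupled_explicit fun_upd_apply, simp,
      (rule derivative_eq_intros refl)+, simp add: algebra_simps power2_eq_square)+

definition M_coeff :: "(nat \<Rightarrow> complex) \<Rightarrow> (nat \<Rightarrow> complex) \<Rightarrow> nat list \<Rightarrow> complex" where
  "M_coeff c l w =
    (if w = [0] then c 0 + l 6 else if w = [1] then c 1 + l 2
     else if w = [3] then c 3 + l 2 + l 4 + c 63 * l 6 - l 2 * l 4 else if w = [5] then c 5 + l 4
     else if w = [2,3] then 1 - l 4 else if w = [4,3] then 1 - l 2 else if w = [6,3] then c 63
     else if w \<in> {[2,1], [4,5], [6,0], [2,3,4]} then 1 else 0)"

text \<open>The derivatives are separate arguments, so that those of the given functions and those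
  of the local solution can be inserted at the same base point.\<close>

definition dM_coeff ::
  "(nat \<Rightarrow> complex) \<Rightarrow> (nat \<Rightarrow> complex) \<Rightarrow> (nat \<Rightarrow> complex) \<Rightarrow> (nat \<Rightarrow> complex) \<Rightarrow> nat list \<Rightarrow> complex" where
  "dM_coeff c l c' l' w =
    (if w = [0] then c' 0 + l' 6 else if w = [1] then c' 1 + l' 2
     else if w = [3] then c' 3 + l' 2 + l' 4 + (c' 63 * l 6 + c 63 * l' 6) - (l' 2 * l 4 + l 2 * l' 4)
     else if w = [5] then c' 5 + l' 4
     else if w = [2,3] then - l' 4 else if w = [4,3] then - l' 2 else if w = [6,3] then c' 63 else 0)"

lemma M_coeff_derivative:
  assumes c: "\<And>j. j \<in> {0,1,3,5,63} \<Longrightarrow> ((\<lambda>z. c z j) has_field_derivative c' j) (at s)"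
    and l: "\<And>i. i \<in> {2,4,6} \<Longrightarrow> ((\<lambda>z. l z i) has_field_derivative l' i) (at s)"
    and w: "w \<in> words"
  shows "((\<lambda>z. M_coeff (c z) (l z) w) has_field_derivative dM_coeff (c s) (l s) c' l' w) (at s)"
proof -
  have "((\<lambda>z. c z j) has_field_derivative c' j) (at s)" if "j = 0 \<or> j = 1 \<or> j = 3 \<or> j = 5 \<or> j = 63" for j
    using that by (intro c) auto
  note cs = this[of 0, simplified] this[of 1, simplified] this[of 3, simplified] this[of 5, simplified] this[of 63, simplified]
  have "((\<lambda>z. l z i) has_field_derivative l' i) (at s)" if "i = 2 \<or> i = 4 \<or> i = 6" for i
    using that by (intro l) auto
  note ls = this[of 2, simplified] this[of 4, simplified] this[of 6, simplified]
  show ?thesis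
    using w unfolding words_def
    by (elim insertE; simp add: M_coeff_def dM_coeff_def)
      (auto intro!: derivative_eq_intros cs ls)
qed

context affine_E6
begin

lemma M_plus_V1: "M_plus G \<kappa> c l m = \<kappa> + Ve m + V1 (M_coeff c l)"
  by (simp add: M_plus_def V1_explicit M_coeff_def Ve_explicit add_ac)

lemma wderiv_M_plus:
  assumes "\<And>j. j \<in> {0,1,3,5,63} \<Longrightarrow> ((\<lambda>z. c z j) has_field_derivative c' j) (at s)"
    and "\<And>i. i \<in> {2,4,6} \<Longrightarrow> ((\<lambda>z. l z i) has_field_derivative l' i) (at s)"
    and "\<And>i. i \<in> {2,4,6} \<Longrightarrow> ((\<lambda>z. m z i) has_field_derivative m' i) (at s)"
  shows "wderiv (\<lambda>z. M_plus G \<kappa> (c z) (l z) (m z)) (Ve m' + V1 (dM_coeff (c s) (l s) c' l')) s"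
proof -
  have "wderiv (\<lambda>z. \<kappa> + Ve (m z) + V1 (M_coeff (c z) (l z))) (0 + Ve m' + V1 (dM_coeff (c s) (l s) c' l')) s"
    unfolding Ve_def V1_def
    by (intro wderiv_add wderiv_const wderiv_sum wderiv_scale M_coeff_derivative assms)
  then show ?thesis by (simp add: M_plus_V1)
qed

end

context affine_E6_theta
begin

lemma kappa_cartan:
  assumes "\<kappa> - \<theta> \<in> vs.span (coroot G ` {..6})"
  shows "\<kappa> \<in> cartan_subalgebra G"
proof -
  have "\<kappa> - \<theta> \<in> cartan_subalgebra G"
    using assms vs.span_mono[of "coroot G ` {..6}" "coroot G ` {..6} \<union> {scaling G}"]
    by (auto simp: cartan_subalgebra_def)
  from vs.subspace_add[OF subspace_cartan this theta_cartan] show ?thesis by simp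
qed

text \<open>The weights 1, 1, 2, 3, 2, 1, 2 are the marks of the affine diagram and annihilate the
  Cartan matrix: \<open>N\<close> pairs with the canonical central element. Hence \<kappa> has the
  level of \<theta>, which is 1 + 1 + 3 + 1.\<close>

lemma kappa_level:
  assumes "\<kappa> - \<theta> \<in> vs.span (coroot G ` {..6})"
  defines "k \<equiv> \<lambda>i. form G \<kappa> (coroot G i)"
  shows "k 0 + k 1 + 2 * k 2 + 3 * k 3 + 2 * k 4 + k 5 + 2 * k 6 = 6"
proof -
  define N where "N h = form G h (coroot G 0) + form G h (coroot G 1) + 2 * form G h (coroot G 2)
    + 3 * form G h (coroot G 3) + 2 * form G h (coroot G 4) + form G h (coroot G 5)
    + 2 * form G h (coroot G 6)" for h
  have N_linear: "N 0 = 0" "N (x + y) = N x + N y" "N (a \<cdot> x) = a * N x" for a x y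
    by (simp_all add: N_def form_zero form_add form_scale algebra_simps)
  have "N (coroot G j) = 0" if "j \<le> 6" for j
  proof -
    have "j \<in> {0,1,2,3,4,5,6}" using that by auto
    then show ?thesis
      by (auto simp: N_def form_coroot_coroot cartan_E6_def doubleton_eq_iff)
  qed
  note N = this
  from assms(1) have "N (\<kappa> - \<theta>) = 0"
    by (induction rule: vs.span_induct)
      (auto intro!: vs.subspaceI intro: N simp: N_linear)
  moreover have "N \<theta> = 6"
    by (simp add: N_def theta_coroot)
  ultimately show ?thesis
    by (simp add: N_def k_def functional_diff[OF functional_form_left] algebra_simps)
qed

text \<open>The bridge from the Lie algebra to scalars: the Lax equation of the local solution,
  split by degree and read word by word, supplies the assumptions of
  \<open>Lax_coefficients\<close>.\<close>

lemma Lax_coefficients_exist: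
  fixes c l m c' l' m' \<alpha> :: "nat \<Rightarrow> complex"
  assumes X: "X \<in> vs.span gens" "X \<in> borel_plus G"
    and kappa: "\<kappa> - \<theta> \<in> vs.span (coroot G ` {..6})"
    and s: "s \<noteq> 0" "s \<noteq> 1" and s1: "c 63 * (1 + c 3 - c 0 * c 63) = 6 * s"
    and s2: "c 63 * (1 + c 1) * (1 + c 5) = 6"
    and D: "1 + c 3 + c 63 * l 6 \<noteq> 0"
    and alpha: "\<And>i. i \<le> 6 \<Longrightarrow> \<alpha> i = form G \<kappa> (coroot G i) / 6"
    and ds1: "c' 63 * (1 + c 3 - c 0 * c 63) + c 63 * (c' 3 - c' 0 * c 63 - c 0 * c' 63) = 6"
    and ds2: "c' 63 * (1 + c 1) * (1 + c 5) + c 63 * c' 1 * (1 + c 5) + c 63 * (1 + c 1) * c' 5 = 0"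
    and Lax: "\<sigma> \<cdot> (Ve m' + V1 (dM_coeff c l c' l')) = ad G X (M_plus G \<kappa> c l m)"
    and \<sigma>: "\<sigma> = s * (s - 1)"
    and q1: "q1 = (1 - l 2) / (1 + c 1)" and q2: "q2 = (1 - l 4) / (1 + c 5)"
    and q3: "q3 = (1 + c 3 - c 0 * c 63) / (1 + c 3 + c 63 * l 6)"
    and p1: "p1 = - ((1 + c 1) * m 2) / 6" and p2: "p2 = - ((1 + c 5) * m 4) / 6"
    and p3: "p3 = - ((1 + c 3 + c 63 * l 6) * ((1 + c 3 + c 63 * l 6) * m 6 + c 63 * form G \<kappa> (coroot G 6)))
              / (6 * c 63 * (1 + c 3 - c 0 * c 63))"
  shows "\<exists>n0 n1 n21 n5 n45 n3 n23 n43 n63 n234 n236 n436 n6234 H X2 X4 X6.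
    Lax_coefficients s (c 63) (1 + c 1) (1 + c 5) (1 + c 3 - c 0 * c 63) q1 q2 q3 p1 p2 p3 \<alpha>
      (c 0 + l 6) (c 1 + l 2) (c 3 + l 2 + l 4 + c 63 * l 6 - l 2 * l 4) (c 5 + l 4) (1 - l 2) (1 - l 4)
      (m 2) (m 4) (m 6) n0 n1 n21 n5 n45 n3 n23 n43 n63 n234 n236 n436 n6234 H X2 X4 X6
      (\<sigma> * (c' 0 + l' 6)) (\<sigma> * (c' 1 + l' 2))
      (\<sigma> * (c' 3 + l' 2 + l' 4 + (c' 63 * l 6 + c 63 * l' 6) - (l' 2 * l 4 + l 2 * l' 4)))
      (\<sigma> * (c' 5 + l' 4)) (\<sigma> * - l' 2) (\<sigma> * - l' 4) (\<sigma> * c' 63)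
      (\<sigma> * m' 2) (\<sigma> * m' 4) (\<sigma> * m' 6)"
proof -
  define a where "a = M_coeff c l"
  note kap = kappa_cartan[OF kappa]
  obtain h0 x0 n0 where h0: "h0 \<in> cartan_subalgebra G" and X0: "X = h0 + Ve x0 + V1 n0"
    using borel_decompose[OF X] by blast
  \<comment> \<open>M^+ commutes with itself and has coefficient 1 at e_60, so subtracting this
    multiple of it removes the e_60 component of X without changing the bracket.\<close>
  define \<nu> where "\<nu> = n0 [6,0]"
  define h where "h = h0 - \<nu> \<cdot> \<kappa>"
  define x where "x i = x0 i - \<nu> * m i" for i
  define n where "n w = n0 w - \<nu> * a w" for w
  have h: "h \<in> cartan_subalgebra G"
    unfolding h_def by (intro vs.subspace_diff[OF subspace_cartan] vs.subspace_scale[OF subspace_cartan] h0 kap)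
  have M: "M_plus G \<kappa> c l m = \<kappa> + Ve m + V1 a"
    by (simp add: M_plus_V1 a_def)
  have "Ve x = Ve x0 - \<nu> \<cdot> Ve m"
    by (simp add: Ve_explicit x_def vs.scale_left_diff_distrib vs.scale_right_distrib)
  moreover have "V1 n = V1 n0 - \<nu> \<cdot> V1 a"
    unfolding n_def V1_diff V1_scale ..
  ultimately have "h + Ve x + V1 n = X - \<nu> \<cdot> M_plus G \<kappa> c l m"
    by (simp add: h_def X0 M vs.scale_right_distrib algebra_simps)
  then have "ad G X (M_plus G \<kappa> c l m) = ad G (h + Ve x + V1 n) (\<kappa> + Ve m + V1 a)"
    by (simp add: ad_diff_left ad_scale_left ad_self flip: M)
  moreover have "\<sigma> \<cdot> (Ve m' + V1 (dM_coeff c l c' l')) = Ve (\<lambda>i. \<sigma> * m' i) + V1 (\<lambda>w. \<sigma> * dM_coeff c l c' l' w)"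
    unfolding V1_scale by (simp add: Ve_explicit vs.scale_right_distrib)
  ultimately have Lax': "Ve (\<lambda>i. \<sigma> * m' i) + V1 (\<lambda>w. \<sigma> * dM_coeff c l c' l' w)
      = ad G (h + Ve x + V1 n) (\<kappa> + Ve m + V1 a)"
    using Lax by simp
  note comp = Lax_components[OF h kap Lax']
  have [simp]: "n [6,0] = 0" "a [6,0] = 1" "a [2,1] = 1" "a [4,5] = 1" "a [2,3,4] = 1"
      "a [2,3,6] = 0" "a [4,3,6] = 0" "a [6,2,3,4] = 0" "a [0] = c 0 + l 6" "a [1] = c 1 + l 2"
      "a [3] = c 3 + l 2 + l 4 + c 63 * l 6 - l 2 * l 4" "a [5] = c 5 + l 4" "a [2,3] = 1 - l 4"
      "a [4,3] = 1 - l 2" "a [6,3] = c 63"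
    by (simp_all add: n_def \<nu>_def a_def M_coeff_def)
  have K: "form G \<kappa> (coroot G i) = 6 * \<alpha> i" if "i \<le> 6" for i
    by (simp add: alpha[OF that])
  define H where "H i = form G h (coroot G i)" for i
  have nz: "c 63 \<noteq> 0" "1 + c 1 \<noteq> 0" "1 + c 5 \<noteq> 0" "1 + c 3 - c 0 * c 63 \<noteq> 0"
    using s1 s2 s(1) by auto
  note C = V1_commute[OF comp(3)]
  note deg1 = comp(2)[unfolded H_def[symmetric]]
  have "Lax_coefficients s (c 63) (1 + c 1) (1 + c 5) (1 + c 3 - c 0 * c 63) q1 q2 q3 p1 p2 p3 \<alpha>
      (c 0 + l 6) (c 1 + l 2) (c 3 + l 2 + l 4 + c 63 * l 6 - l 2 * l 4) (c 5 + l 4) (1 - l 2) (1 - l 4)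
      (m 2) (m 4) (m 6) (n [0]) (n [1]) (n [2,1]) (n [5]) (n [4,5]) (n [3]) (n [2,3]) (n [4,3]) (n [6,3])
      (n [2,3,4]) (n [2,3,6]) (n [4,3,6]) (n [6,2,3,4]) H (x 2) (x 4) (x 6)
      (\<sigma> * (c' 0 + l' 6)) (\<sigma> * (c' 1 + l' 2))
      (\<sigma> * (c' 3 + l' 2 + l' 4 + (c' 63 * l 6 + c 63 * l' 6) - (l' 2 * l 4 + l 2 * l' 4)))
      (\<sigma> * (c' 5 + l' 4)) (\<sigma> * - l' 2) (\<sigma> * - l' 4) (\<sigma> * c' 63)
      (\<sigma> * m' 2) (\<sigma> * m' 4) (\<sigma> * m' 6)" (is "Lax_coefficients _ ?g ?u1 ?u5 ?v _ _ _ _ _ _ _ ?a0 ?a1 ?a3 ?a5 ?b2 ?b4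
      _ _ _ ?n0 ?n1 ?n21 ?n5 ?n45 ?n3 ?n23 ?n43 ?n63 ?n234 ?n236 ?n436 ?n6234 _ ?X2 ?X4 ?X6 ?d0 ?d1 ?d3 ?d5 ?db2 ?db4 ?dg _ _ _")
  proof (rule Lax_coefficients.intro)
    show "s \<noteq> 0" "s \<noteq> 1" by (rule s)+
    have D': "?v + ?g * ?a0 = 1 + c 3 + c 63 * l 6" by (simp add: algebra_simps)
    show "q3 \<noteq> 0" using D nz by (simp add: q3)
    show "?g * ?v = 6 * s" "?g * ?u1 * ?u5 = 6" by (rule s1 s2)+
    show "\<alpha> 0 + \<alpha> 1 + 2 * \<alpha> 2 + 3 * \<alpha> 3 + 2 * \<alpha> 4 + \<alpha> 5 + 2 * \<alpha> 6 = 1"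
      using kappa_level[OF kappa] by (simp add: alpha field_simps)
    show "?a1 + ?b2 = ?u1" "?a5 + ?b4 = ?u5" by simp_all
    show "?b2 = q1 * ?u1" "?b4 = q2 * ?u5" "?u1 * m 2 = - 6 * p1" "?u5 * m 4 = - 6 * p2"
      using nz by (simp_all add: q1 q2 p1 p2)
    show "(?v + ?g * ?a0) * q3 = ?v" unfolding D' q3 using D by simp
    show "?a3 + ?b2 * ?b4 = ?v + ?g * ?a0" by (simp add: algebra_simps)
    show "(?v + ?g * ?a0) * ((?v + ?g * ?a0) * m 6 + ?g * (6 * \<alpha> 6)) = - (6 * ?g * ?v) * p3"
      unfolding D' p3 using nz by (simp add: K)
    \<comment> \<open>\<open>C(1)\<close> to \<open>C(4)\<close> are the identities obtained with
      f_0, f_1, f_5 and f_3, in this order.\<close>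
    note sm = raise_def cartan_E6_def doubleton_eq_iff words_def algebra_simps
    show "?a0 * ?n63 = ?g * ?n0 + ?n3" using C(1)[of "[6,3]"] by (simp add: sm)
    show "?a0 * ?n236 + ?n23 = 0" using C(1)[of "[2,3,6]"] by (simp add: sm)
    show "?a0 * ?n436 + ?n43 = 0" using C(1)[of "[4,3,6]"] by (simp add: sm)
    show "?n234 = ?a0 * ?n6234" using C(1)[of "[6,2,3,4]"] by (simp add: sm)
    show "?b4 * ?n1 + ?n3 = ?a1 * ?n23 + ?a3 * ?n21" using C(2)[of "[2,3]"] by (simp add: sm)
    show "?n1 = ?a1 * ?n234 - ?b2 * ?n21 + ?n43" using C(2)[of "[2,3,4]"] by (simp add: sm)
    show "?a1 * ?n236 + ?n63 = ?g * ?n21" using C(2)[of "[2,3,6]"] by (simp add: sm)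
    show "?n436 = ?a1 * ?n6234" using C(2)[of "[6,2,3,4]"] by (simp add: sm)
    show "?n5 = ?a5 * ?n234 - ?b4 * ?n45 + ?n23" using C(3)[of "[2,3,4]"] by (simp add: sm)
    show "?a5 * ?n436 + ?n63 = ?g * ?n45" using C(3)[of "[4,3,6]"] by (simp add: sm)
    show "?n236 = ?a5 * ?n6234" using C(3)[of "[6,2,3,4]"] by (simp add: sm)
    show "?n63 = ?b2 * ?n236 + ?b4 * ?n436 + ?g * ?n234 - ?a3 * ?n6234"
      using C(4)[of "[6,2,3,4]"] by (simp add: sm)
    note sm = raise_def words_def dM_coeff_def K algebra_simps
    show "?d0 = ?a0 * H 0 - 6 * \<alpha> 0 * ?n0" using deg1[of "[0]"] by (simp add: sm)
    show "?d1 = ?a1 * H 1 - 6 * \<alpha> 1 * ?n1" using deg1[of "[1]"] by (simp add: sm)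
    show "?d3 = ?a3 * H 3 - 6 * \<alpha> 3 * ?n3" using deg1[of "[3]"] by (simp add: sm)
    show "?d5 = ?a5 * H 5 - 6 * \<alpha> 5 * ?n5" using deg1[of "[5]"] by (simp add: sm)
    show "0 = ?a1 * ?X2 - 6 * (\<alpha> 1 + \<alpha> 2) * ?n21 - m 2 * ?n1 + H 1 + H 2"
      using deg1[of "[2,1]"] by (simp add: sm)
    show "0 = ?a5 * ?X4 - 6 * (\<alpha> 4 + \<alpha> 5) * ?n45 - m 4 * ?n5 + H 4 + H 5"
      using deg1[of "[4,5]"] by (simp add: sm)
    show "0 = ?a0 * ?X6 - m 6 * ?n0 + H 0 + H 6"
      using deg1[of "[6,0]"] by (simp add: sm)
    show "?db4 = ?a3 * ?X2 + ?b4 * (H 2 + H 3) - 6 * (\<alpha> 2 + \<alpha> 3) * ?n23 - m 2 * ?n3"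
      using deg1[of "[2,3]"] by (simp add: sm)
    show "?db2 = ?a3 * ?X4 + ?b2 * (H 3 + H 4) - 6 * (\<alpha> 3 + \<alpha> 4) * ?n43 - m 4 * ?n3"
      using deg1[of "[4,3]"] by (simp add: sm)
    show "?dg = ?a3 * ?X6 + ?g * (H 3 + H 6) - 6 * (\<alpha> 3 + \<alpha> 6) * ?n63 - m 6 * ?n3"
      using deg1[of "[6,3]"] by (simp add: sm)
    show "0 = - ?b2 * ?X2 - ?b4 * ?X4 - 6 * (\<alpha> 2 + \<alpha> 3 + \<alpha> 4) * ?n234 + m 2 * ?n43 + m 4 * ?n23 + H 2 + H 3 + H 4"
      using deg1[of "[2,3,4]"] by (simp add: sm)
    show "0 = - ?b4 * ?X6 - ?g * ?X2 - 6 * (\<alpha> 2 + \<alpha> 3 + \<alpha> 6) * ?n236 + m 2 * ?n63 + m 6 * ?n23"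
      using deg1[of "[2,3,6]"] by (simp add: sm)
    show "0 = - ?b2 * ?X6 - ?g * ?X4 - 6 * (\<alpha> 3 + \<alpha> 4 + \<alpha> 6) * ?n436 + m 4 * ?n63 + m 6 * ?n43"
      using deg1[of "[4,3,6]"] by (simp add: sm)
    show "?X6 = 6 * (\<alpha> 2 + \<alpha> 3 + \<alpha> 4 + \<alpha> 6) * ?n6234 + m 2 * ?n436 + m 4 * ?n236 + m 6 * ?n234"
      using deg1[of "[6,2,3,4]"] by (simp add: sm)
    show "\<sigma> * m' 2 = H 2 * m 2 - 6 * \<alpha> 2 * ?X2" "\<sigma> * m' 4 = H 4 * m 4 - 6 * \<alpha> 4 * ?X4"
      "\<sigma> * m' 6 = H 6 * m 6 - 6 * \<alpha> 6 * ?X6"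
      using comp(1)[of 2] comp(1)[of 4] comp(1)[of 6] by (simp_all add: H_def K)
    show "?dg * ?u1 * ?u5 + ?g * (?d1 + ?db2) * ?u5 + ?g * ?u1 * (?d5 + ?db4) = 0"
      using arg_cong[OF ds2, of "\<lambda>z. \<sigma> * z"] by (simp add: algebra_simps)
    show "?dg * ?v + ?g * (?d3 + ?db2 * ?b4 + ?b2 * ?db4 - ?dg * ?a0 - ?g * ?d0) = 6 * (s * (s - 1))"
      unfolding \<sigma>[symmetric] using arg_cong[OF ds1, of "\<lambda>z. \<sigma> * z"] by (simp add: algebra_simps)
  qed
  then show ?thesis by blast
qed

text \<open>With the same \<open>c'\<close> on both sides, the coefficients at e_0, e_23 and e_43
  recover the derivatives of \<lambda>_6, \<lambda>_4 and \<lambda>_2, and pairing with f_i those of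
  \<mu>_i.\<close>

lemma tangent_eqD:
  assumes "Ve m + V1 (dM_coeff c l c' x) = Ve m' + V1 (dM_coeff c l c' x')" "i \<in> {2,4,6}"
  shows "m i = m' i" "x i = x' i"
proof -
  have m: "m i = m' i" if "i \<in> {2,4,6}" for i
    using arg_cong[OF assms(1), of "form G (f i)"] form_f_Ve[OF that] form_f_V1[OF that]
    by (simp add: form_add)
  then show "m i = m' i" using assms(2) by blast
  have "Ve m = Ve m'" using m by (simp add: Ve_explicit)
  then have "V1 (dM_coeff c l c' x) = V1 (dM_coeff c l c' x')" using assms(1) by simp
  from V1_eqD[OF this, of "[0]"] V1_eqD[OF this, of "[2,3]"] V1_eqD[OF this, of "[4,3]"]
  show "x i = x' i" using assms(2) by (auto simp: words_def dM_coeff_def)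
qed

end

text \<open>Here \<open>a\<close> and \<open>b\<close> are the numerators for the given functions
  and for the local solution, over a common denominator \<open>w\<close>; \<open>h\<close> is the
  Hamiltonian right-hand side.\<close>

lemma quotient_eq_iff:
  fixes w h \<sigma> a b :: complex
  assumes "d = a / w" "w * h = \<sigma> * b" "w \<noteq> 0" "\<sigma> \<noteq> 0"
  shows "\<sigma> * d = h \<longleftrightarrow> a = b"
proof -
  have "\<sigma> * d = h \<longleftrightarrow> \<sigma> * a = w * h" using assms(1,3) by (auto simp: field_simps)
  then show ?thesis using assms(2,4) by simp
qed

theorem theorem4p2:
  fixes G :: "'g::ab_group_add km_data"
    and \<theta> \<kappa> :: 'g
    and D :: "(complex \<times> complex) set"
    and \<Gamma>1 :: "complex \<times> complex \<Rightarrow> 'g"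
    and c :: "nat \<Rightarrow> complex \<times> complex \<Rightarrow> complex"
    and S :: "complex set"
    and t :: "complex \<Rightarrow> complex \<times> complex"
    and B :: "complex \<Rightarrow> (nat \<Rightarrow> complex) \<Rightarrow> (nat \<Rightarrow> complex) \<Rightarrow> 'g"
    and l m q p :: "nat \<Rightarrow> complex \<Rightarrow> complex"
    and \<alpha> :: "nat \<Rightarrow> complex"
  assumes G: "affine_E6 G"
    and theta: "is_theta G \<theta>"
    and D: "open D"
    and gauge1: "first_gauge G D \<Gamma>1 c"
    and S: "open S" "0 \<notin> S" "1 \<notin> S"
    and slice: "slice_curve D c S t"
    and kappa: "\<kappa> - \<theta> \<in> lspan G (coroot G ` {..6})"
    and B: "\<And>s l\<^sub>0 m\<^sub>0. s \<in> S \<Longrightarrow> reduced_B G \<theta> D \<Gamma>1 c t \<kappa> s l\<^sub>0 m\<^sub>0 (B s l\<^sub>0 m\<^sub>0)"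
    and l_holo: "\<And>i. i \<in> {2,4,6} \<Longrightarrow> l i holomorphic_on S"
    and m_holo: "\<And>i. i \<in> {2,4,6} \<Longrightarrow> m i holomorphic_on S"
    and q3_defined: "\<And>s. s \<in> S \<Longrightarrow> 1 + c 3 (t s) + c 63 (t s) * l 6 s \<noteq> 0"
    and q1: "\<And>s. s \<in> S \<Longrightarrow> q 1 s = (1 - l 2 s) / (1 + c 1 (t s))"
    and q2: "\<And>s. s \<in> S \<Longrightarrow> q 2 s = (1 - l 4 s) / (1 + c 5 (t s))"
    and q3: "\<And>s. s \<in> S \<Longrightarrow>
      q 3 s = (1 + c 3 (t s) - c 0 (t s) * c 63 (t s)) / (1 + c 3 (t s) + c 63 (t s) * l 6 s)"
    and p1: "\<And>s. s \<in> S \<Longrightarrow> p 1 s = - ((1 + c 1 (t s)) * m 2 s) / 6"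
    and p2: "\<And>s. s \<in> S \<Longrightarrow> p 2 s = - ((1 + c 5 (t s)) * m 4 s) / 6"
    and p3: "\<And>s. s \<in> S \<Longrightarrow>
      p 3 s = - ((1 + c 3 (t s) + c 63 (t s) * l 6 s) *
                 ((1 + c 3 (t s) + c 63 (t s) * l 6 s) * m 6 s
                  + c 63 (t s) * form G \<kappa> (coroot G 6)))
              / (6 * c 63 (t s) * (1 + c 3 (t s) - c 0 (t s) * c 63 (t s)))"
    and alpha: "\<And>i. i \<le> 6 \<Longrightarrow> \<alpha> i = form G \<kappa> (coroot G i) / 6"
  shows "(\<forall>s\<in>S. lax_commutator G
                   (\<lambda>s. B s (\<lambda>i. l i s) (\<lambda>i. m i s))
                   (\<lambda>s. M_plus G \<kappa> (\<lambda>j. c j (t s)) (\<lambda>i. l i s) (\<lambda>i. m i s)) s = 0)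
     \<longleftrightarrow>
         (\<forall>s\<in>S. \<forall>i\<in>{1,2,3}.
            s * (s - 1) * deriv (q i) s
              = poisson (H_coupled \<alpha> s) (\<lambda>p q. q i) (\<lambda>j. p j s) (\<lambda>j. q j s) \<and>
            s * (s - 1) * deriv (p i) s
              = poisson (H_coupled \<alpha> s) (\<lambda>p q. p i) (\<lambda>j. p j s) (\<lambda>j. q j s))"
proof -
  interpret affine_E6_theta G \<theta>
    using G theta by (simp add: affine_E6_theta_def affine_E6_theta_axioms_def)
  have hol: "(\<lambda>s. fst (t s)) holomorphic_on S" "(\<lambda>s. snd (t s)) holomorphic_on S"
    and tD: "\<And>s. s \<in> S \<Longrightarrow> t s \<in> D"
    and s1: "\<And>s. s \<in> S \<Longrightarrow> c 63 (t s) * (1 + c 3 (t s) - c 0 (t s) * c 63 (t s)) = 6 * s"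
    and s2: "\<And>s. s \<in> S \<Longrightarrow> c 63 (t s) * (1 + c 1 (t s)) * (1 + c 5 (t s)) = 6"
    using slice by (auto simp: slice_curve_def s1_fun_def s2_fun_def)
  \<comment> \<open>The equivalence holds at every point separately, so a different local solution
    may be used at each \<open>s\<close>.\<close>
  have key: "lax_commutator G (\<lambda>s. B s (\<lambda>i. l i s) (\<lambda>i. m i s))
        (\<lambda>s. M_plus G \<kappa> (\<lambda>j. c j (t s)) (\<lambda>i. l i s) (\<lambda>i. m i s)) s = 0 \<longleftrightarrow>
      (\<forall>i\<in>{1,2,3}. s * (s - 1) * deriv (q i) s
              = poisson (H_coupled \<alpha> s) (\<lambda>p q. q i) (\<lambda>j. p j s) (\<lambda>j. q j s) \<and>
            s * (s - 1) * deriv (p i) s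
              = poisson (H_coupled \<alpha> s) (\<lambda>p q. p i) (\<lambda>j. p j s) (\<lambda>j. q j s))"
    if s: "s \<in> S" for s
  proof -
    define \<sigma> where "\<sigma> = s * (s - 1)"
    have s01: "s \<noteq> 0" "s \<noteq> 1" and \<sigma>: "\<sigma> \<noteq> 0" using S s by (auto simp: \<sigma>_def)
    \<comment> \<open>The local solution passes at \<open>s\<close> through the current values of
      \<open>l\<close> and \<open>m\<close>.\<close>
    obtain W U lt \<xi> where W: "open W" "t s \<in> W" "W \<subseteq> D" and red: "similarity_reduction G \<theta> W U"
      and gauge2: "second_gauge G \<theta> \<Gamma>1 c \<kappa> W U lt \<xi>"
      and init: "\<And>i. i \<in> {2,4,6} \<Longrightarrow> lt i (t s) = l i s" "\<And>i. i \<in> {2,4,6} \<Longrightarrow> \<xi> i (t s) = m i s"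
      and X: "B s (\<lambda>i. l i s) (\<lambda>i. m i s) = \<sigma> \<cdot>\<^bsub>G\<^esub>
              (deriv (\<lambda>z. fst (t z)) s \<cdot>\<^bsub>G\<^esub> B_plus G \<Gamma>1 lt U 1 (t s)
               + deriv (\<lambda>z. snd (t z)) s \<cdot>\<^bsub>G\<^esub> B_plus G \<Gamma>1 lt U 2 (t s))"
      using B[OF s, of "\<lambda>i. l i s" "\<lambda>i. m i s"] unfolding reduced_B_def \<sigma>_def by blast
    define Y where "Y = deriv (\<lambda>z. fst (t z)) s \<cdot>\<^bsub>G\<^esub> B_plus G \<Gamma>1 lt U 1 (t s)
               + deriv (\<lambda>z. snd (t z)) s \<cdot>\<^bsub>G\<^esub> B_plus G \<Gamma>1 lt U 2 (t s)"
    define X where "X = \<sigma> \<cdot>\<^bsub>G\<^esub> Y"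
    have BX: "B s (\<lambda>i. l i s) (\<lambda>i. m i s) = X" by (simp add: X X_def Y_def)
    note local = local_solution_Lax[OF gauge1 S(1) s slice W red gauge2, folded Y_def]
    have t': "((\<lambda>z. fst (t z)) has_field_derivative deriv (\<lambda>z. fst (t z)) s) (at s)"
        "((\<lambda>z. snd (t z)) has_field_derivative deriv (\<lambda>z. snd (t z)) s) (at s)"
      using holomorphic_derivI[OF hol(1) S(1) s] holomorphic_derivI[OF hol(2) S(1) s] .
    have pull: "\<exists>F'. ((\<lambda>z. F (t z)) has_field_derivative F') (at s)" if "holomorphic2_on F A" "t s \<in> A" for F A
      using that has_field_derivative_curve[OF _ t'] unfolding holomorphic2_on_def by blast
    have "\<exists>F'. ((\<lambda>z. c j (t z)) has_field_derivative F') (at s)" if "j \<in> {0,1,3,5,63}" for j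
      using pull tD[OF s] gauge1 that unfolding first_gauge_def by blast
    then obtain c' where c': "\<And>j. j \<in> {0,1,3,5,63} \<Longrightarrow> ((\<lambda>z. c j (t z)) has_field_derivative c' j) (at s)"
      by metis
    have "\<exists>F'. ((\<lambda>z. lt i (t z)) has_field_derivative F') (at s)" if "i \<in> {2,4,6}" for i
      using pull W(2) gauge2 that unfolding second_gauge_def by blast
    then obtain l' where l': "\<And>i. i \<in> {2,4,6} \<Longrightarrow> ((\<lambda>z. lt i (t z)) has_field_derivative l' i) (at s)"
      by metis
    note kap = kappa_cartan[OF kappa]
    \<comment> \<open>The differentiability of \<open>\<xi>\<close> along the curve comes from that
      of M^+, by pairing with f_i.\<close>
    have "\<exists>F'. ((\<lambda>z. \<xi> i (t z)) has_field_derivative F') (at s)" if i: "i \<in> {2,4,6}" for i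
    proof -
      have "i \<le> 6" using i by auto
      then have "form G (f i) (M_plus G \<kappa> c l m) = m i" for c l m
        by (simp add: M_plus_V1 form_add form_f_cartan[OF kap] form_f_Ve[OF i] form_f_V1[OF i])
      then show ?thesis
        using wderivD[OF local(1) functional_form, of "f i"] by auto
    qed
    then obtain m' where m': "\<And>i. i \<in> {2,4,6} \<Longrightarrow> ((\<lambda>z. \<xi> i (t z)) has_field_derivative m' i) (at s)"
      by metis
    have M: "M_plus G \<kappa> c0 (\<lambda>i. lt i (t s)) (\<lambda>i. \<xi> i (t s)) = M_plus G \<kappa> c0 (\<lambda>i. l i s) (\<lambda>i. m i s)" for c0
      by (simp add: M_plus_def init)
    have dM: "dM_coeff c0 (\<lambda>i. lt i (t s)) c1 l1 = dM_coeff c0 (\<lambda>i. l i s) c1 l1" for c0 c1 l1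
      by (simp add: dM_coeff_def init fun_eq_iff)
    have "Ve m' + V1 (dM_coeff (\<lambda>j. c j (t s)) (\<lambda>i. l i s) c' l')
        = ad G Y (M_plus G \<kappa> (\<lambda>j. c j (t s)) (\<lambda>i. l i s) (\<lambda>i. m i s))"
      using wderiv_unique[OF wderiv_M_plus[of "\<lambda>z j. c j (t z)" c' s "\<lambda>z i. lt i (t z)" l' "\<lambda>z i. \<xi> i (t z)" m', OF c' l' m']
          local(1)]
      unfolding M dM .
    then have Lax: "\<sigma> \<cdot>\<^bsub>G\<^esub> (Ve m' + V1 (dM_coeff (\<lambda>j. c j (t s)) (\<lambda>i. l i s) c' l'))
        = ad G X (M_plus G \<kappa> (\<lambda>j. c j (t s)) (\<lambda>i. l i s) (\<lambda>i. m i s))"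
      by (simp add: X_def ad_scale_left)
    define dl where "dl i = deriv (l i) s" for i
    define dm where "dm i = deriv (m i) s" for i
    have dl: "(l i has_field_derivative dl i) (at s)" and dm: "(m i has_field_derivative dm i) (at s)"
      if "i \<in> {2,4,6}" for i
      unfolding dl_def dm_def
      using holomorphic_derivI[OF l_holo[OF that] S(1) s] holomorphic_derivI[OF m_holo[OF that] S(1) s] .
    have "lie_deriv G (\<lambda>s. M_plus G \<kappa> (\<lambda>j. c j (t s)) (\<lambda>i. l i s) (\<lambda>i. m i s)) s
        = Ve dm + V1 (dM_coeff (\<lambda>j. c j (t s)) (\<lambda>i. l i s) c' dl)"
      by (intro lie_deriv_eq wderiv_M_plus[where c = "\<lambda>z j. c j (t z)"] c' dl dm)
    then have "lax_commutator G (\<lambda>s. B s (\<lambda>i. l i s) (\<lambda>i. m i s))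
        (\<lambda>s. M_plus G \<kappa> (\<lambda>j. c j (t s)) (\<lambda>i. l i s) (\<lambda>i. m i s)) s
        = \<sigma> \<cdot>\<^bsub>G\<^esub> (Ve dm + V1 (dM_coeff (\<lambda>j. c j (t s)) (\<lambda>i. l i s) c' dl))
          - \<sigma> \<cdot>\<^bsub>G\<^esub> (Ve m' + V1 (dM_coeff (\<lambda>j. c j (t s)) (\<lambda>i. l i s) c' l'))"
      by (simp add: lax_commutator_def BX Lax flip: \<sigma>_def)
    \<comment> \<open>The values of B and M^+ at \<open>s\<close> agree with those of the local
      solution, so the commutator is a nonzero multiple of the difference of two tangent
      vectors.\<close>
    then have lax_iff: "lax_commutator G (\<lambda>s. B s (\<lambda>i. l i s) (\<lambda>i. m i s))
        (\<lambda>s. M_plus G \<kappa> (\<lambda>j. c j (t s)) (\<lambda>i. l i s) (\<lambda>i. m i s)) s = 0 \<longleftrightarrow>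
        Ve dm + V1 (dM_coeff (\<lambda>j. c j (t s)) (\<lambda>i. l i s) c' dl)
          = Ve m' + V1 (dM_coeff (\<lambda>j. c j (t s)) (\<lambda>i. l i s) c' l')"
      using \<sigma> by simp
    have eq_iff: "Ve dm + V1 (dM_coeff (\<lambda>j. c j (t s)) (\<lambda>i. l i s) c' dl)
          = Ve m' + V1 (dM_coeff (\<lambda>j. c j (t s)) (\<lambda>i. l i s) c' l') \<longleftrightarrow>
        (dl 2 = l' 2 \<and> dl 4 = l' 4 \<and> dl 6 = l' 6) \<and> (dm 2 = m' 2 \<and> dm 4 = m' 4 \<and> dm 6 = m' 6)"
      (is "?E \<longleftrightarrow> ?R")
    proof
      assume ?E
      from tangent_eqD[OF this] show ?R by simp
    next
      assume ?R
      then have "dM_coeff (\<lambda>j. c j (t s)) (\<lambda>i. l i s) c' dl = dM_coeff (\<lambda>j. c j (t s)) (\<lambda>i. l i s) c' l'"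
        by (auto simp: dM_coeff_def fun_eq_iff)
      with \<open>?R\<close> show ?E by (simp add: Ve_explicit)
    qed
    define u1 u5 g v D0 where "u1 = 1 + c 1 (t s)" and "u5 = 1 + c 5 (t s)" and "g = c 63 (t s)"
      and "v = 1 + c 3 (t s) - c 0 (t s) * c 63 (t s)" and "D0 = 1 + c 3 (t s) + c 63 (t s) * l 6 s"
    have nz: "g \<noteq> 0" "u1 \<noteq> 0" "u5 \<noteq> 0" "v \<noteq> 0" "D0 \<noteq> 0"
      using s1[OF s] s2[OF s] s01 q3_defined[OF s] by (auto simp: g_def u1_def u5_def v_def D0_def)
    have cd: "((\<lambda>z. c 0 (t z)) has_field_derivative c' 0) (at s)" "((\<lambda>z. c 1 (t z)) has_field_derivative c' 1) (at s)"
      "((\<lambda>z. c 3 (t z)) has_field_derivative c' 3) (at s)" "((\<lambda>z. c 5 (t z)) has_field_derivative c' 5) (at s)"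
      "((\<lambda>z. c 63 (t z)) has_field_derivative c' 63) (at s)"
      by (rule c'; simp)+
    have lmd: "(l 2 has_field_derivative dl 2) (at s)" "(l 4 has_field_derivative dl 4) (at s)"
      "(l 6 has_field_derivative dl 6) (at s)" "(m 2 has_field_derivative dm 2) (at s)"
      "(m 4 has_field_derivative dm 4) (at s)" "(m 6 has_field_derivative dm 6) (at s)"
      by (rule dl dm; simp)+
    have derivI: "deriv F s = y" if "(F' has_field_derivative y) (at s)" "\<And>z. z \<in> S \<Longrightarrow> F z = F' z" for F F' y
      using has_field_derivative_transform_within_open[OF that(1) S(1) s, of F] that(2)
      by (auto intro: DERIV_imp_deriv)
    have "((\<lambda>z. c 63 (t z) * (1 + c 3 (t z) - c 0 (t z) * c 63 (t z))) has_field_derivative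
        c' 63 * (1 + c 3 (t s) - c 0 (t s) * c 63 (t s))
        + c 63 (t s) * (c' 3 - c' 0 * c 63 (t s) - c 0 (t s) * c' 63)) (at s)"
      by (rule derivative_eq_intros cd refl)+ (simp add: algebra_simps)
    from derivI[OF this, of "\<lambda>z. 6 * z"] s1
    have ds1: "c' 63 * (1 + c 3 (t s) - c 0 (t s) * c 63 (t s))
        + c 63 (t s) * (c' 3 - c' 0 * c 63 (t s) - c 0 (t s) * c' 63) = 6"
      by simp
    have "((\<lambda>z. c 63 (t z) * (1 + c 1 (t z)) * (1 + c 5 (t z))) has_field_derivative
        c' 63 * (1 + c 1 (t s)) * (1 + c 5 (t s)) + c 63 (t s) * c' 1 * (1 + c 5 (t s))
        + c 63 (t s) * (1 + c 1 (t s)) * c' 5) (at s)"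
      by (rule derivative_eq_intros cd refl)+ (simp add: algebra_simps)
    from derivI[OF this, of "\<lambda>z. 6"] s2
    have ds2: "c' 63 * (1 + c 1 (t s)) * (1 + c 5 (t s)) + c 63 (t s) * c' 1 * (1 + c 5 (t s))
        + c 63 (t s) * (1 + c 1 (t s)) * c' 5 = 0"
      by simp
    have XW: "X \<in> vs.span gens" "X \<in> borel_plus G"
      unfolding X_def using local(2,3) by (auto intro: vs.span_scale vs.subspace_scale[OF subspace_borel])
    from Lax_coefficients_exist[where c = "\<lambda>j. c j (t s)" and l = "\<lambda>i. l i s" and m = "\<lambda>i. m i s",
      OF XW kappa s01 s1[OF s] s2[OF s] q3_defined[OF s] alpha ds1 ds2 Lax \<sigma>_def
        q1[OF s] q2[OF s] q3[OF s] p1[OF s] p2[OF s] p3[OF s]]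
    obtain n0 n1 n21 n5 n45 n3 n23 n43 n63 n234 n236 n436 n6234 H X2 X4 X6 where
      L: "Lax_coefficients s (c 63 (t s)) (1 + c 1 (t s)) (1 + c 5 (t s)) (1 + c 3 (t s) - c 0 (t s) * c 63 (t s))
      (q 1 s) (q 2 s) (q 3 s) (p 1 s) (p 2 s) (p 3 s) \<alpha>
      (c 0 (t s) + l 6 s) (c 1 (t s) + l 2 s) (c 3 (t s) + l 2 s + l 4 s + c 63 (t s) * l 6 s - l 2 s * l 4 s)
      (c 5 (t s) + l 4 s) (1 - l 2 s) (1 - l 4 s)
      (m 2 s) (m 4 s) (m 6 s) n0 n1 n21 n5 n45 n3 n23 n43 n63 n234 n236 n436 n6234 H X2 X4 X6
      (\<sigma> * (c' 0 + l' 6)) (\<sigma> * (c' 1 + l' 2))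
      (\<sigma> * (c' 3 + l' 2 + l' 4 + (c' 63 * l 6 s + c 63 (t s) * l' 6) - (l' 2 * l 4 s + l 2 s * l' 4)))
      (\<sigma> * (c' 5 + l' 4)) (\<sigma> * - l' 2) (\<sigma> * - l' 4) (\<sigma> * c' 63)
      (\<sigma> * m' 2) (\<sigma> * m' 4) (\<sigma> * m' 6)"
      by blast
    note flow = Lax_coefficients.flow[OF L]
    note Ham = H_coupled_flow[where \<alpha> = \<alpha> and p = "\<lambda>j. p j s" and q = "\<lambda>j. q j s" and s = s]
    have Q1: "\<sigma> * deriv (q 1) s = poisson (H_coupled \<alpha> s) (\<lambda>p q. q 1) (\<lambda>j. p j s) (\<lambda>j. q j s) \<longleftrightarrow> dl 2 = l' 2"
    proof -
      have d: "deriv (q 1) s = (- dl 2 * u1 - (1 - l 2 s) * c' 1) / u1\<^sup>2"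
        unfolding u1_def
        by (rule derivI[OF _ q1]) (rule derivative_eq_intros cd lmd refl nz(2)[unfolded u1_def] | simp add: power2_eq_square)+
      have h: "u1\<^sup>2 * poisson (H_coupled \<alpha> s) (\<lambda>p q. q 1) (\<lambda>j. p j s) (\<lambda>j. q j s)
          = \<sigma> * (- l' 2 * u1 - (1 - l 2 s) * c' 1)"
        unfolding Ham(1) u1_def flow(1)[symmetric] by (simp add: algebra_simps)
      from quotient_eq_iff[OF d h _ \<sigma>] show ?thesis using nz by simp
    qed
    have Q2: "\<sigma> * deriv (q 2) s = poisson (H_coupled \<alpha> s) (\<lambda>p q. q 2) (\<lambda>j. p j s) (\<lambda>j. q j s) \<longleftrightarrow> dl 4 = l' 4"
    proof -
      have d: "deriv (q 2) s = (- dl 4 * u5 - (1 - l 4 s) * c' 5) / u5\<^sup>2"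
        unfolding u5_def
        by (rule derivI[OF _ q2]) (rule derivative_eq_intros cd lmd refl nz(3)[unfolded u5_def] | simp add: power2_eq_square)+
      have h: "u5\<^sup>2 * poisson (H_coupled \<alpha> s) (\<lambda>p q. q 2) (\<lambda>j. p j s) (\<lambda>j. q j s)
          = \<sigma> * (- l' 4 * u5 - (1 - l 4 s) * c' 5)"
        unfolding Ham(2) u5_def flow(2)[symmetric] by (simp add: algebra_simps)
      from quotient_eq_iff[OF d h _ \<sigma>] show ?thesis using nz by simp
    qed
    define v' where "v' = c' 3 - (c' 0 * g + c 0 (t s) * c' 63)"
    \<comment> \<open>The derivative of \<open>D0\<close> at \<open>s\<close> when \<lambda>_6 has
      derivative \<open>x\<close>.\<close>
    define D1 where "D1 x = c' 3 + (c' 63 * l 6 s + g * x)" for x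
    have D0: "v + g * (c 0 (t s) + l 6 s) = D0" by (simp add: v_def g_def D0_def algebra_simps)
    have D1: "\<sigma> * (c' 3 + l' 2 + l' 4 + (c' 63 * l 6 s + c 63 (t s) * l' 6) - (l' 2 * l 4 s + l 2 s * l' 4))
        + \<sigma> * - l' 2 * (1 - l 4 s) + (1 - l 2 s) * (\<sigma> * - l' 4) = \<sigma> * D1 (l' 6)"
      by (simp add: D1_def g_def algebra_simps)
    have Q3: "\<sigma> * deriv (q 3) s = poisson (H_coupled \<alpha> s) (\<lambda>p q. q 3) (\<lambda>j. p j s) (\<lambda>j. q j s) \<longleftrightarrow> dl 6 = l' 6"
    proof -
      have d: "deriv (q 3) s = (v' * D0 - v * D1 (dl 6)) / D0\<^sup>2"
        unfolding v'_def D1_def v_def D0_def g_def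
        by (rule derivI[OF _ q3])
          (rule derivative_eq_intros cd lmd refl nz(5)[unfolded D0_def] | simp add: power2_eq_square mult.commute)+
      have h: "D0\<^sup>2 * poisson (H_coupled \<alpha> s) (\<lambda>p q. q 3) (\<lambda>j. p j s) (\<lambda>j. q j s)
          = \<sigma> * (v' * D0 - v * D1 (l' 6))"
      proof -
        have e: "\<sigma> * D1 (l' 6) - \<sigma> * c' 63 * (c 0 (t s) + l 6 s) - g * (\<sigma> * (c' 0 + l' 6)) = \<sigma> * v'"
          by (simp add: D1_def v'_def algebra_simps)
        show ?thesis
          using flow(3) unfolding Ham(3)[symmetric] D1 unfolding g_def[symmetric] v_def[symmetric, folded g_def] D0
          unfolding e by (simp add: algebra_simps)
      qed
      from quotient_eq_iff[OF d h _ \<sigma>] show ?thesis using nz by (simp add: D1_def)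
    qed
    have PP1: "\<sigma> * deriv (p 1) s = poisson (H_coupled \<alpha> s) (\<lambda>p q. p 1) (\<lambda>j. p j s) (\<lambda>j. q j s) \<longleftrightarrow> dm 2 = m' 2"
    proof -
      have d: "deriv (p 1) s = (c' 1 * m 2 s + u1 * dm 2) / (- 6)"
        unfolding u1_def
        by (rule derivI[OF _ p1]) (rule derivative_eq_intros cd lmd refl | simp add: field_simps)+
      have h: "- 6 * poisson (H_coupled \<alpha> s) (\<lambda>p q. p 1) (\<lambda>j. p j s) (\<lambda>j. q j s)
          = \<sigma> * (c' 1 * m 2 s + u1 * m' 2)"
        unfolding Ham(4) u1_def using flow(4) by (simp add: algebra_simps)
      from quotient_eq_iff[OF d h _ \<sigma>] show ?thesis using nz by simp
    qed
    have PP2: "\<sigma> * deriv (p 2) s = poisson (H_coupled \<alpha> s) (\<lambda>p q. p 2) (\<lambda>j. p j s) (\<lambda>j. q j s) \<longleftrightarrow> dm 4 = m' 4"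
    proof -
      have d: "deriv (p 2) s = (c' 5 * m 4 s + u5 * dm 4) / (- 6)"
        unfolding u5_def
        by (rule derivI[OF _ p2]) (rule derivative_eq_intros cd lmd refl | simp add: field_simps)+
      have h: "- 6 * poisson (H_coupled \<alpha> s) (\<lambda>p q. p 2) (\<lambda>j. p j s) (\<lambda>j. q j s)
          = \<sigma> * (c' 5 * m 4 s + u5 * m' 4)"
        unfolding Ham(5) u5_def using flow(5) by (simp add: algebra_simps)
      from quotient_eq_iff[OF d h _ \<sigma>] show ?thesis using nz by simp
    qed
    \<comment> \<open>Unlike p_1 and p_2, p_3 depends on \<lambda>_6, so the derivatives of
      \<lambda>_6 have to agree before those of \<mu>_6 can be compared.\<close>
    have PP3: "\<sigma> * deriv (p 3) s = poisson (H_coupled \<alpha> s) (\<lambda>p q. p 3) (\<lambda>j. p j s) (\<lambda>j. q j s) \<longleftrightarrow> dm 6 = m' 6"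
      if l6: "dl 6 = l' 6"
    proof -
      define k6 where "k6 = form G \<kappa> (coroot G 6)"
      define N where "N = D0 * (D0 * m 6 s + g * k6)"
      define N' where "N' y = D1 (l' 6) * (D0 * m 6 s + g * k6) + D0 * (D1 (l' 6) * m 6 s + D0 * y + c' 63 * k6)" for y
      have k6: "6 * \<alpha> 6 = k6" by (simp add: alpha k6_def)
      \<comment> \<open>On the slice s_1 = z turns the denominator into 36 z, which is easy to
        differentiate.\<close>
      have p3': "p 3 z = - ((1 + c 3 (t z) + c 63 (t z) * l 6 z) *
                 ((1 + c 3 (t z) + c 63 (t z) * l 6 z) * m 6 z + c 63 (t z) * k6)) / (36 * z)" if "z \<in> S" for z
      proof -
        have "6 * c 63 (t z) * (1 + c 3 (t z) - c 0 (t z) * c 63 (t z)) = 36 * z"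
          using s1[OF that] by (simp add: mult.assoc)
        with p3[OF that] show ?thesis by (simp add: k6_def)
      qed
      have N: "N = - 36 * s * p 3 s"
        unfolding p3'[OF s] N_def D0_def g_def using s01 by simp
      define Nz where "Nz z = (1 + c 3 (t z) + c 63 (t z) * l 6 z) *
          ((1 + c 3 (t z) + c 63 (t z) * l 6 z) * m 6 z + c 63 (t z) * k6)" for z
      have dD: "((\<lambda>z. 1 + c 3 (t z) + c 63 (t z) * l 6 z) has_field_derivative D1 (l' 6)) (at s)"
        unfolding D1_def g_def l6[symmetric]
        by (rule derivative_eq_intros cd lmd refl)+ (simp add: mult.commute)
      have "(Nz has_field_derivative N' (dm 6)) (at s)"
        unfolding Nz_def
        by (rule DERIV_cong[OF DERIV_mult[OF dD DERIV_add[OF DERIV_mult[OF dD lmd(6)]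
                DERIV_cmult_right[OF cd(5), of k6]]]])
          (simp add: N'_def D0_def g_def algebra_simps)
      from DERIV_minus[OF DERIV_divide[OF this DERIV_cmult[OF DERIV_ident, of 36]]]
      have "((\<lambda>z. - (Nz z / (36 * z))) has_field_derivative
          - ((N' (dm 6) * (36 * s) - N * 36) / (36 * s * (36 * s)))) (at s)"
        using s01 by (simp add: N_def Nz_def D0_def g_def)
      then have "deriv (p 3) s = - ((N' (dm 6) * (36 * s) - N * 36) / (36 * s * (36 * s)))"
        by (rule derivI) (simp add: p3' Nz_def)
      also have "\<dots> = (N' (dm 6) + 36 * p 3 s) / (- (36 * s))"
        unfolding N using s01 by (simp add: divide_simps) (simp add: algebra_simps)
      finally have d: "deriv (p 3) s = (N' (dm 6) + 36 * p 3 s) / (- (36 * s))" .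
      have h: "- (36 * s) * poisson (H_coupled \<alpha> s) (\<lambda>p q. p 3) (\<lambda>j. p j s) (\<lambda>j. q j s)
          = \<sigma> * (N' (m' 6) + 36 * p 3 s)"
      proof -
        have "\<sigma> * D1 (l' 6) * (D0 * m 6 s + g * k6)
            + D0 * (\<sigma> * D1 (l' 6) * m 6 s + D0 * (\<sigma> * m' 6) + \<sigma> * c' 63 * k6) + 36 * \<sigma> * p 3 s
            = 36 * s * - poisson (H_coupled \<alpha> s) (\<lambda>p q. p 3) (\<lambda>j. p j s) (\<lambda>j. q j s)"
          using flow(6)
          unfolding Ham(6)[THEN arg_cong[of _ _ uminus], unfolded minus_minus, symmetric] D1
          unfolding g_def[symmetric] v_def[symmetric, folded g_def] D0 k6 \<sigma>_def[symmetric] .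
        then show ?thesis
          unfolding N'_def by algebra
      qed
      have "\<sigma> * deriv (p 3) s = poisson (H_coupled \<alpha> s) (\<lambda>p q. p 3) (\<lambda>j. p j s) (\<lambda>j. q j s) \<longleftrightarrow>
          N' (dm 6) + 36 * p 3 s = N' (m' 6) + 36 * p 3 s"
        by (rule quotient_eq_iff[OF d h _ \<sigma>]) (use s01 in simp)
      also have "\<dots> \<longleftrightarrow> dm 6 = m' 6"
        using nz by (simp add: N'_def)
      finally show ?thesis .
    qed
    show ?thesis
      unfolding lax_iff eq_iff \<sigma>_def[symmetric] using Q1 Q2 Q3 PP1 PP2 PP3 by auto
  qed
  then show ?thesis by blast
qed

end
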